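(* Let $p$ be an odd prime and let $G$ be a group of order $p^5$ with $|Z(G)|=p^2$. Then $|\mathcal{M}(G)|\neq p^5$; that is, no such group satisfies $|\mathcal{M}(G)|=p^{\frac12\cdot 5\cdot 4-5}$.
   Context: $\mathcal{M}(G)$ denotes the Schur multiplier of $G$ and $Z(G)$ the center. *)

theory Defs
  imports "HOL-Algebra.Algebra" Complex_Main
begin

definition group_center :: "('a, 'b) monoid_scheme \<Rightarrow> 'a set" where
  "group_center G = {z \<in> carrier G. \<forall>x \<in> carrier G. z \<otimes>\<^bsub>G\<^esub> x = x \<otimes>\<^bsub>G\<^esub> z}"

text \<open>Schur multiplier of a finite group G, defined (following Schur) as
  the second cohomology group H^2(G, C^*) with trivial action:
  normalised-outside-the-carrier 2-cocycles G x G -> C^* modulo 2-coboundaries.\<close>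
definition schur_cocycles :: "('a, 'b) monoid_scheme \<Rightarrow> ('a \<Rightarrow> 'a \<Rightarrow> complex) set" where
  "schur_cocycles G = {f.
     (\<forall>x y. f x y \<noteq> 0) \<and>
     (\<forall>x y. (x \<notin> carrier G \<or> y \<notin> carrier G) \<longrightarrow> f x y = 1) \<and>
     (\<forall>x\<in>carrier G. \<forall>y\<in>carrier G. \<forall>z\<in>carrier G.
        f x y * f (x \<otimes>\<^bsub>G\<^esub> y) z = f x (y \<otimes>\<^bsub>G\<^esub> z) * f y z)}"

definition schur_coboundaries :: "('a, 'b) monoid_scheme \<Rightarrow> ('a \<Rightarrow> 'a \<Rightarrow> complex) set" where
  "schur_coboundaries G = {(\<lambda>x y. if x \<in> carrier G \<and> y \<in> carrier G
                                  then g x * g y / g (x \<otimes>\<^bsub>G\<^esub> y) else 1)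
                           | g :: 'a \<Rightarrow> complex. \<forall>x \<in> carrier G. g x \<noteq> 0}"

definition cocycle_group :: "('a, 'b) monoid_scheme \<Rightarrow> ('a \<Rightarrow> 'a \<Rightarrow> complex) monoid" where
  "cocycle_group G = \<lparr>carrier = schur_cocycles G,
                       monoid.mult = (\<lambda>f g x y. f x y * g x y),
                       one = (\<lambda>x y. 1)\<rparr>"

definition schur_multiplier :: "('a, 'b) monoid_scheme \<Rightarrow> ('a \<Rightarrow> 'a \<Rightarrow> complex) set monoid" where
  "schur_multiplier G = cocycle_group G Mod schur_coboundaries G"

end

theory Submission
  imports Defs "HOL-Number_Theory.Cong"
begin

text \<open>
  A cocycle \<open>f\<close> is a coboundary as soon as the derived subgroup of the corresponding central
  extension of \<open>G\<close> by the nonzero complex numbers meets these scalars trivially. For the groups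
  in question this can be read off from the values \<open>f x y / f y x\<close> on commuting pairs, that is,
  from commutators of lifts, and these values obey bilinearity and the Hall--Witt identity.
  If \<open>G\<close> modulo its centre is not abelian, four values, each determined up to a \<open>p\<close>-th root of
  unity by the preceding ones, suffice, so there are at most \<open>p\<^sup>4\<close> classes.
  If it is abelian, \<open>G\<close> has an abelian subgroup of index \<open>p\<close>. When some \<open>p\<close>-th power is
  nontrivial, the relation \<open>f (x\<^sup>p) x = f x (x\<^sup>p)\<close> again leaves at most \<open>p\<^sup>4\<close> classes; when \<open>G\<close>
  has exponent \<open>p\<close>, six explicit cocycles span a group of \<open>p\<^sup>6\<close> classes. The order \<open>p\<^sup>5\<close> is
  skipped.
\<close>

section \<open>Commutators and the centre\<close>

text \<open>Why the value \<open>p^5\<close> is jumped over. If \<open>G\<close> modulo its centre Z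
  is abelian, then Z turns out to consist of commutators, and the pairing \<open>beta\<close>
  between Z and G/Z has 2 times 3 parameters. The Hall--Witt identity removes one of them, and the
  value of \<open>beta\<close> on two elements that generate A modulo Z, for an abelian A of index
  p, adds one back. All six survive in exponent p. A nontrivial p-th power w costs more than one
  parameter: polarising \<open>beta (x^p) x = 1\<close> determines the whole row
  \<open>beta w\<close>, so that only the three values against a second generator v of Z and the one
  on A remain. Nothing finer than these inequalities is needed. The recurrent obstacle is that
  \<open>beta\<close> makes sense on commuting pairs only. The sets \<open>bker x\<close> deal with
  it: they are subgroups, so triviality of \<open>beta\<close> spreads from a few pairs to all of
  them by generation and by counting orders.\<close>

context group
begin

definition com where "com x y = x \<otimes> y \<otimes> inv x \<otimes> inv y"

lemma cancel_left: "x \<in> carrier G \<Longrightarrow> y \<in> carrier G \<Longrightarrow> x \<otimes> (inv x \<otimes> y) = y"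
  by (simp flip: m_assoc)

lemma cancel_left': "x \<in> carrier G \<Longrightarrow> y \<in> carrier G \<Longrightarrow> inv x \<otimes> (x \<otimes> y) = y"
  by (simp flip: m_assoc)

lemmas word_simps = com_def m_assoc inv_mult_group cancel_left cancel_left'

lemma com_closed [simp]: "x \<in> carrier G \<Longrightarrow> y \<in> carrier G \<Longrightarrow> com x y \<in> carrier G"
  by (simp add: com_def)

lemma com_swap: "x \<in> carrier G \<Longrightarrow> y \<in> carrier G \<Longrightarrow> x \<otimes> y = com x y \<otimes> (y \<otimes> x)"
  by (simp add: word_simps)

lemma com_eq_one_iff: "x \<in> carrier G \<Longrightarrow> y \<in> carrier G \<Longrightarrow> com x y = \<one> \<longleftrightarrow> x \<otimes> y = y \<otimes> x"
  using com_swap[of x y] r_cancel_one[of "y \<otimes> x" "com x y"] by auto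

lemma inv_com: "x \<in> carrier G \<Longrightarrow> y \<in> carrier G \<Longrightarrow> inv (com x y) = com y x"
  by (simp add: word_simps)

lemma com_self [simp]: "x \<in> carrier G \<Longrightarrow> com x x = \<one>"
  by (simp add: word_simps)

lemma com_one [simp]: "x \<in> carrier G \<Longrightarrow> com x \<one> = \<one>" "x \<in> carrier G \<Longrightarrow> com \<one> x = \<one>"
  by (simp_all add: word_simps)

lemma com_mult_left:
  "x \<in> carrier G \<Longrightarrow> y \<in> carrier G \<Longrightarrow> z \<in> carrier G \<Longrightarrow>
    com (x \<otimes> y) z = x \<otimes> com y z \<otimes> inv x \<otimes> com x z"
  by (simp add: word_simps)

lemma com_inv_left:
  "x \<in> carrier G \<Longrightarrow> z \<in> carrier G \<Longrightarrow> com (inv x) z = inv x \<otimes> inv (com x z) \<otimes> x"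
  by (simp add: word_simps)

abbreviation "cen \<equiv> group_center G"

lemma cenD: "z \<in> cen \<Longrightarrow> z \<in> carrier G" "z \<in> cen \<Longrightarrow> x \<in> carrier G \<Longrightarrow> z \<otimes> x = x \<otimes> z"
  by (auto simp: group_center_def)

lemma cenI: "z \<in> carrier G \<Longrightarrow> (\<And>x. x \<in> carrier G \<Longrightarrow> z \<otimes> x = x \<otimes> z) \<Longrightarrow> z \<in> cen"
  unfolding group_center_def by blast

lemma com_cen: "z \<in> cen \<Longrightarrow> x \<in> carrier G \<Longrightarrow> com z x = \<one>" "z \<in> cen \<Longrightarrow> x \<in> carrier G \<Longrightarrow> com x z = \<one>"
  by (simp_all add: cenD com_eq_one_iff)

lemma cen_iff: "z \<in> cen \<longleftrightarrow> z \<in> carrier G \<and> (\<forall>x\<in>carrier G. com z x = \<one>)"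
  by (auto simp: group_center_def com_eq_one_iff)

lemma conj_cen: "z \<in> cen \<Longrightarrow> x \<in> carrier G \<Longrightarrow> x \<otimes> z \<otimes> inv x = z"
  using cenD[of z] by (simp add: m_assoc flip: cenD(2)[of z])

lemma com_mult_left_cen:
  assumes "x \<in> carrier G" "y \<in> carrier G" "z \<in> carrier G" "com y z \<in> cen"
  shows "com (x \<otimes> y) z = com x z \<otimes> com y z"
  using assms by (simp add: com_mult_left conj_cen cenD(2))

lemma com_mult_right_cen:
  assumes "x \<in> carrier G" "y \<in> carrier G" "z \<in> carrier G" "com x z \<in> cen"
  shows "com x (y \<otimes> z) = com x y \<otimes> com x z"
proof -
  have "com x (y \<otimes> z) = com x y \<otimes> (y \<otimes> com x z \<otimes> inv y)"
    using assms(1-3) by (simp add: word_simps)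
  then show ?thesis using assms by (simp add: conj_cen)
qed

lemma subgroup_cen: "subgroup cen G"
proof
  show "cen \<subseteq> carrier G" by (auto simp: group_center_def)
  show "\<one> \<in> cen" by (simp add: group_center_def)
  fix x y assume x: "x \<in> cen" and y: "y \<in> cen"
  have "x \<otimes> y \<otimes> g = g \<otimes> (x \<otimes> y)" if "g \<in> carrier G" for g
  proof -
    have c: "x \<in> carrier G" "y \<in> carrier G" using x y cenD(1) by auto
    have "x \<otimes> y \<otimes> g = x \<otimes> (g \<otimes> y)" using c that y by (simp add: m_assoc cenD(2))
    also have "\<dots> = x \<otimes> g \<otimes> y" using c that by (simp add: m_assoc)
    also have "\<dots> = g \<otimes> x \<otimes> y" by (simp only: cenD(2)[OF x that])
    also have "\<dots> = g \<otimes> (x \<otimes> y)" using c that by (simp add: m_assoc)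
    finally show ?thesis .
  qed
  then show "x \<otimes> y \<in> cen" by (intro cenI m_closed cenD(1)[OF x] cenD(1)[OF y])
next
  fix x assume x: "x \<in> cen"
  have "inv x \<otimes> g = g \<otimes> inv x" if g: "g \<in> carrier G" for g
  proof -
    have c: "x \<in> carrier G" using x cenD(1) by auto
    have "inv x \<otimes> g = inv x \<otimes> (g \<otimes> x) \<otimes> inv x" using c g by (simp add: m_assoc)
    also have "\<dots> = inv x \<otimes> (x \<otimes> g) \<otimes> inv x" using g by (simp only: cenD(2)[OF x])
    also have "\<dots> = g \<otimes> inv x" using c g by (simp add: m_assoc cancel_left')
    finally show ?thesis .
  qed
  then show "inv x \<in> cen" by (intro cenI inv_closed cenD(1)[OF x])
qed

lemma cen_mult_closed: "x \<in> cen \<Longrightarrow> y \<in> cen \<Longrightarrow> x \<otimes> y \<in> cen"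
  by (rule subgroup.m_closed[OF subgroup_cen])

lemma normal_cen: "cen \<lhd> G"
  by (auto simp: normal_inv_iff subgroup_cen conj_cen)

text \<open>The set is the preimage of the centralizer of the coset of \<open>y\<close> in the
  quotient by \<open>K\<close>. Most arguments about quotient groups are phrased through such sets
  of commutators.\<close>

lemma subgroup_com_mod:
  assumes K: "K \<lhd> G" and y: "y \<in> carrier G"
  shows "subgroup {g \<in> carrier G. com g y \<in> K} G"
proof -
  interpret K: normal K G by fact
  show ?thesis
  proof
    show "{g \<in> carrier G. com g y \<in> K} \<subseteq> carrier G" by auto
    show "\<one> \<in> {g \<in> carrier G. com g y \<in> K}" using y by simp
  next
    fix a b assume "a \<in> {g \<in> carrier G. com g y \<in> K}" "b \<in> {g \<in> carrier G. com g y \<in> K}"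
    then show "a \<otimes> b \<in> {g \<in> carrier G. com g y \<in> K}"
      using y by (simp add: com_mult_left K.inv_op_closed2)
  next
    fix a assume "a \<in> {g \<in> carrier G. com g y \<in> K}"
    then show "inv a \<in> {g \<in> carrier G. com g y \<in> K}"
      using y by (simp add: com_inv_left K.inv_op_closed1)
  qed
qed

lemma com_sym_mem:
  assumes "subgroup K G" "x \<in> carrier G" "y \<in> carrier G" "com x y \<in> K"
  shows "com y x \<in> K"
  using assms inv_com subgroup.m_inv_closed by metis

text \<open>Generators that commute modulo \<open>S\<close> make the quotient abelian; the two
  arguments are freed one after the other. Generation enters as a property of all subgroups
  containing \<open>A\<close>, which is also the form in which it is used later.\<close>

lemma com_mem_of_generators:
  assumes S: "S \<lhd> G" and A: "A \<subseteq> carrier G"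
    and gen: "\<And>H. subgroup H G \<Longrightarrow> A \<subseteq> H \<Longrightarrow> carrier G \<subseteq> H"
    and com: "\<And>x y. x \<in> A \<Longrightarrow> y \<in> A \<Longrightarrow> com x y \<in> S"
    and gh: "g \<in> carrier G" "h \<in> carrier G"
  shows "com g h \<in> S"
proof -
  have S': "subgroup S G" using S normal_imp_subgroup by blast
  have 1: "com g y \<in> S" if y: "y \<in> A" and g: "g \<in> carrier G" for g y
  proof -
    have "carrier G \<subseteq> {g \<in> carrier G. com g y \<in> S}"
      using y A com by (intro gen subgroup_com_mod[OF S]) blast+
    then show ?thesis using g by blast
  qed
  have 2: "com y g \<in> S" if "y \<in> A" "g \<in> carrier G" for g y
    using 1[OF that] com_sym_mem[OF S'] that A by blast
  have "carrier G \<subseteq> {g \<in> carrier G. com g h \<in> S}"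
    using 2 gh(2) A by (intro gen subgroup_com_mod[OF S]) blast+
  then show ?thesis using gh by blast
qed

text \<open>The preimage of the centre of the quotient by \<open>K\<close>; in particular
  \<open>com_center cen\<close> is the second centre.\<close>

definition com_center where
  "com_center K = {g \<in> carrier G. \<forall>h \<in> carrier G. com g h \<in> K}"

lemma subgroup_com_center:
  assumes K: "K \<lhd> G"
  shows "subgroup (com_center K) G"
proof -
  have eq: "com_center K = (\<Inter>y\<in>carrier G. {g \<in> carrier G. com g y \<in> K})"
    by (auto simp: com_center_def)
  show ?thesis unfolding eq using subgroup_com_mod[OF K] by (intro subgroups_Inter) auto
qed

lemma normal_subset_com_center:
  assumes K: "K \<lhd> G" shows "K \<subseteq> com_center K"
proof
  fix k assume k: "k \<in> K"
  interpret K: normal K G by fact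
  have "com k h \<in> K" if "h \<in> carrier G" for h
  proof -
    have "com k h = k \<otimes> (h \<otimes> inv k \<otimes> inv h)" using k that by (simp add: word_simps)
    then show ?thesis using k that K.inv_op_closed2 by (simp add: K.m_inv_closed)
  qed
  then show "k \<in> com_center K" using k by (auto simp: com_center_def)
qed

lemma normal_of_com:
  assumes "subgroup K G" "\<And>k h. k \<in> K \<Longrightarrow> h \<in> carrier G \<Longrightarrow> com h k \<in> K"
  shows "K \<lhd> G"
proof -
  interpret K: subgroup K G by fact
  have "h \<otimes> k \<otimes> inv h \<in> K" if "k \<in> K" "h \<in> carrier G" for h k
  proof -
    have "h \<otimes> k \<otimes> inv h = com h k \<otimes> k" using that by (simp add: word_simps)
    then show ?thesis using that assms(2) by simp
  qed
  then show ?thesis using assms(1) by (auto simp: normal_inv_iff)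
qed

lemma normal_com_center:
  assumes K: "K \<lhd> G" shows "com_center K \<lhd> G"
proof (rule normal_of_com)
  fix k h assume "k \<in> com_center K" "h \<in> carrier G"
  then show "com h k \<in> com_center K"
    using normal_subset_com_center[OF K] com_sym_mem[OF normal_imp_subgroup[OF K], of k h]
    by (auto simp: com_center_def)
qed (rule subgroup_com_center[OF K])

lemma nat_pow_cen: "z \<in> cen \<Longrightarrow> z [^] (n::nat) \<in> cen"
  by (induction n) (auto simp: subgroup.one_closed[OF subgroup_cen] cen_mult_closed)

lemma com_pow_left_cen:
  assumes "x \<in> carrier G" "y \<in> carrier G" "com x y \<in> cen"
  shows "com (x [^] (n::nat)) y = com x y [^] n"
  using assms by (induction n) (auto simp: com_mult_left_cen)

lemma com_pow_right_cen:
  assumes "x \<in> carrier G" "y \<in> carrier G" "com x y \<in> cen"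
  shows "com x (y [^] (n::nat)) = com x y [^] n"
  using assms by (induction n) (auto simp: com_mult_right_cen)

lemma pow_mem_subgroup: "subgroup H G \<Longrightarrow> x \<in> H \<Longrightarrow> x [^] (n::nat) \<in> H"
  by (induction n) (auto simp: subgroup.one_closed subgroup.m_closed)

lemma pow_coprime_mem:
  assumes K: "subgroup K G" and c: "c \<in> carrier G" and m: "c [^] (m::nat) \<in> K" and n: "c [^] (n::nat) \<in> K"
    and cop: "coprime m n"
  shows "c \<in> K"
proof -
  obtain r s where rs: "int m * r + int n * s = 1" using bezout_int[of "int m" "int n"] cop
    by (metis coprime_imp_gcd_eq_1 mult.commute of_nat_1 gcd_int_int_eq)
  have "c = c [^] (1::int)" using c by simp
  also have "\<dots> = (c [^] m) [^] r \<otimes> (c [^] n) [^] s"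
    using c unfolding rs[symmetric] by (simp add: int_pow_mult flip: int_pow_pow int_pow_int)
  also have "\<dots> \<in> K" using m n K by (intro subgroup.m_closed subgroup_int_pow_closed)
  finally show ?thesis .
qed

end

section \<open>Extending complex characters\<close>

lemma complex_root_exists:
  assumes "w \<noteq> (0::complex)" "n > 0"
  shows "\<exists>c. c \<noteq> 0 \<and> c ^ n = w"
proof -
  have "rcis (root n (cmod w)) (Arg w / n) ^ n = rcis (cmod w) (Arg w)"
    using assms by (simp add: DeMoivre2 real_root_pow_pos2)
  then have "rcis (root n (cmod w)) (Arg w / n) ^ n = w" by (simp add: rcis_cmod_Arg)
  with assms show ?thesis by (metis power_0_left less_not_refl)
qed

context group
begin

definition character_on :: "'a set \<Rightarrow> ('a \<Rightarrow> complex) \<Rightarrow> bool" where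
  "character_on B \<chi> \<longleftrightarrow> subgroup B G \<and> (\<forall>a\<in>B. \<chi> a \<noteq> 0) \<and> (\<forall>a\<in>B. \<forall>b\<in>B. \<chi> (a \<otimes> b) = \<chi> a * \<chi> b)"

text \<open>One element is adjoined to the domain. As \<open>\<chi>\<close> is trivial on
  commutators, elements of \<open>B\<close> move past powers of \<open>x\<close> without changing
  the value, so \<open>b x^i\<close> can be sent to \<open>\<chi> b * c^i\<close>, where
  \<open>c\<close> is a root of the value prescribed at the first power of \<open>x\<close> that
  lies in \<open>B\<close>.\<close>

lemma character_extend_step:
  assumes chi: "character_on B \<chi>" and SB: "S \<subseteq> B" and S1: "\<And>s. s \<in> S \<Longrightarrow> \<chi> s = 1"
    and com: "\<And>g h. g \<in> carrier G \<Longrightarrow> h \<in> carrier G \<Longrightarrow> com g h \<in> S"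
    and x: "x \<in> carrier G" and m: "x [^] (m::nat) \<in> B" "m > 0"
  shows "\<exists>B' \<chi>'. character_on B' \<chi>' \<and> B \<subseteq> B' \<and> x \<in> B' \<and> (\<forall>b\<in>B. \<chi>' b = \<chi> b)"
proof -
  interpret B: subgroup B G using chi by (simp add: character_on_def)
  have nz: "\<chi> a \<noteq> 0" if "a \<in> B" for a using chi that by (simp add: character_on_def)
  have mu: "\<chi> (a \<otimes> b) = \<chi> a * \<chi> b" if "a \<in> B" "b \<in> B" for a b
    using chi that by (simp add: character_on_def)
  have chi1: "\<chi> \<one> = 1" using mu[of \<one> \<one>] nz[of \<one>] by simp
  \<comment> \<open>The order of \<open>x\<close> modulo \<open>B\<close>: the powers of
    \<open>x\<close> in \<open>B\<close> are those whose exponent is a multiple of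
    \<open>n\<close>.\<close>
  define n where "n = (LEAST k. k > 0 \<and> x [^] (k::nat) \<in> B)"
  have n: "n > 0" "x [^] n \<in> B"
    using LeastI[of "\<lambda>k. k > 0 \<and> x [^] (k::nat) \<in> B" m] m unfolding n_def by auto
  have least: "k = 0" if "k < n" "x [^] k \<in> B" for k
    using that not_less_Least[of k "\<lambda>k. k > 0 \<and> x [^] (k::nat) \<in> B"] unfolding n_def by auto
  have powB: "x [^] (n * q) \<in> B" for q
  proof -
    have "(x [^] n) [^] q \<in> B" by (induction q) (use n in auto)
    then show ?thesis using x by (simp add: nat_pow_pow)
  qed
  have dvd: "n dvd k" if k: "x [^] k \<in> B" for k
  proof -
    have "x [^] k = x [^] (n * (k div n)) \<otimes> x [^] (k mod n)"
      using x by (simp add: nat_pow_mult)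
    then have "x [^] (k mod n) = inv (x [^] (n * (k div n))) \<otimes> x [^] k"
      using x by (simp add: cancel_left')
    then have "x [^] (k mod n) \<in> B" using k powB[of "k div n"] by simp
    then have "k mod n = 0" using least[of "k mod n"] n by simp
    then show ?thesis by auto
  qed
  obtain c where c: "c \<noteq> 0" "c ^ n = \<chi> (x [^] n)"
    using complex_root_exists[of "\<chi> (x [^] n)" n] nz n by blast
  have pow: "\<chi> (x [^] k) = c ^ k" if k: "x [^] k \<in> B" for k
  proof -
    obtain q where q: "k = n * q" using dvd[OF k] by blast
    have "\<chi> (x [^] (n * q)) = c ^ (n * q)"
    proof (induction q)
      case (Suc q)
      have "x [^] (n * Suc q) = x [^] (n * q) \<otimes> x [^] n" using x by (simp add: nat_pow_mult add.commute)
      then show ?case using Suc mu[OF powB[of q] n(2)] c by (simp add: power_add)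
    qed (simp add: chi1)
    then show ?thesis using q by simp
  qed
  have wd0: "\<chi> a * c ^ i = \<chi> b * c ^ j"
    if ab: "a \<in> B" "b \<in> B" and eq: "a \<otimes> x [^] i = b \<otimes> x [^] j" and ij: "i \<le> j" for a b and i j :: nat
  proof -
    have ab': "a \<in> carrier G" "b \<in> carrier G" using ab by auto
    have "a \<otimes> x [^] i = b \<otimes> x [^] (j - i) \<otimes> x [^] i"
      using eq ij ab' x by (simp add: m_assoc nat_pow_mult)
    then have a: "a = b \<otimes> x [^] (j - i)" using ab' x by simp
    then have "x [^] (j - i) = inv b \<otimes> a" using ab' x by (simp add: cancel_left')
    then have xB: "x [^] (j - i) \<in> B" using ab by simp
    have "\<chi> a = \<chi> b * c ^ (j - i)" using a mu[OF ab(2) xB] pow[OF xB] by simp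
    then show ?thesis using ij by (simp flip: power_add)
  qed
  have wd: "\<chi> a * c ^ i = \<chi> b * c ^ j"
    if ab: "a \<in> B" "b \<in> B" and eq: "a \<otimes> x [^] i = b \<otimes> x [^] j" for a b and i j :: nat
    using wd0[OF ab eq] wd0[OF ab(2,1) eq[symmetric]] by (metis linear)
  define \<chi>' where "\<chi>' y = (SOME v. \<exists>b\<in>B. \<exists>i::nat. y = b \<otimes> x [^] i \<and> v = \<chi> b * c ^ i)" for y
  define B' where "B' = {y. \<exists>b\<in>B. \<exists>i::nat. y = b \<otimes> x [^] i}"
  have val: "\<chi>' (b \<otimes> x [^] i) = \<chi> b * c ^ i" if "b \<in> B" for b and i :: nat
  proof -
    have "\<exists>v. \<exists>b'\<in>B. \<exists>i'::nat. b \<otimes> x [^] i = b' \<otimes> x [^] i' \<and> v = \<chi> b' * c ^ i'" using that by blast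
    from someI_ex[OF this] show ?thesis unfolding \<chi>'_def[of "b \<otimes> x [^] i"] using wd that by metis
  qed
  have prod: "(b \<otimes> x [^] i) \<otimes> (b' \<otimes> x [^] j) = (b \<otimes> (com (x [^] i) b' \<otimes> b')) \<otimes> x [^] (i + j)"
    if "b \<in> B" "b' \<in> B" for b b' and i j :: nat
  proof -
    have c: "b \<in> carrier G" "b' \<in> carrier G" "x [^] i \<in> carrier G" "x [^] j \<in> carrier G" using that x by auto
    then show ?thesis using x by (simp add: word_simps flip: nat_pow_mult)
  qed
  have comB: "com g h \<in> B" if "g \<in> carrier G" "h \<in> carrier G" for g h using com[OF that] SB by blast
  have "subgroup B' G"
  proof
    show "B' \<subseteq> carrier G" using x by (auto simp: B'_def)
    show "\<one> \<in> B'" unfolding B'_def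
      by (rule CollectI, rule bexI[of _ \<one>], rule exI[of _ 0]) auto
  next
    fix a b assume "a \<in> B'" "b \<in> B'"
    then obtain s i t j where st: "s \<in> B" "t \<in> B" "a = s \<otimes> x [^] (i::nat)" "b = t \<otimes> x [^] (j::nat)"
      unfolding B'_def by blast
    have "s \<otimes> (com (x [^] i) t \<otimes> t) \<in> B" using st x by (intro B.m_closed comB) auto
    then show "a \<otimes> b \<in> B'" unfolding B'_def using prod[OF st(1,2)] st by blast
  next
    fix a assume "a \<in> B'"
    then obtain s i where st: "s \<in> B" "a = s \<otimes> x [^] (i::nat)" unfolding B'_def by blast
    \<comment> \<open>Exponents are natural numbers, so the inverse of \<open>x^i\<close> is written
      as \<open>x^((n - 1) i)\<close> times an element of \<open>B\<close>.\<close>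
    let ?y = "x [^] i" and ?z = "x [^] (n * i)" and ?w = "x [^] ((n - 1) * i)"
    have s: "s \<in> carrier G" using st by auto
    have "(n - 1) * i + i = n * i" using n by (cases n) auto
    then have "?z = ?w \<otimes> ?y" using x by (simp add: nat_pow_mult)
    then have w: "inv ?y = inv ?z \<otimes> ?w" using x by (simp add: inv_mult_group m_assoc)
    have "inv a = com (inv ?y) (inv s) \<otimes> inv s \<otimes> inv ?y"
      using x s st by (simp add: word_simps)
    also have "\<dots> = com (inv ?y) (inv s) \<otimes> inv s \<otimes> inv ?z \<otimes> ?w"
      using x s by (subst (2) w) (simp add: m_assoc)
    finally show "inv a \<in> B'" unfolding B'_def
      using st x powB[of i] by (auto intro!: B.m_closed comB bexI[of _ "com (inv ?y) (inv s) \<otimes> inv s \<otimes> inv ?z"])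
  qed
  moreover have "\<chi>' a \<noteq> 0" if "a \<in> B'" for a
    using that val nz c by (auto simp: B'_def)
  moreover have "\<chi>' (a \<otimes> b) = \<chi>' a * \<chi>' b" if ab: "a \<in> B'" "b \<in> B'" for a b
  proof -
    obtain s i t j where st: "s \<in> B" "t \<in> B" "a = s \<otimes> x [^] (i::nat)" "b = t \<otimes> x [^] (j::nat)"
      using ab unfolding B'_def by blast
    have ct: "com (x [^] i) t \<in> S" using com st x by auto
    then have ctB: "com (x [^] i) t \<in> B" using SB by blast
    have "\<chi>' (a \<otimes> b) = \<chi> (s \<otimes> (com (x [^] i) t \<otimes> t)) * c ^ (i + j)"
      unfolding st prod[OF st(1,2)] using st ctB by (intro val B.m_closed)
    also have "\<dots> = \<chi> s * \<chi> t * c ^ (i + j)"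
      using mu[OF st(1) B.m_closed[OF ctB st(2)]] mu[OF ctB st(2)] S1[OF ct] by simp
    finally show ?thesis using val st by (simp add: power_add)
  qed
  moreover have "B \<subseteq> B'"
  proof
    fix b assume "b \<in> B"
    then show "b \<in> B'" unfolding B'_def
      by (intro CollectI bexI[of _ b] exI[of _ 0]) auto
  qed
  moreover have "x \<in> B'" unfolding B'_def
    using x by (intro CollectI bexI[of _ \<one>] exI[of _ 1]) auto
  moreover have "\<chi>' b = \<chi> b" if "b \<in> B" for b using val[OF that, of 0] that by simp
  ultimately show ?thesis unfolding character_on_def by blast
qed

text \<open>Meant for an infinite group: only finitely many elements are adjoined, each with some
  power already in the domain. In \<open>coboundaryI\<close> they are the lifts of the elements of a
  finite group.\<close>

lemma character_extend:
  assumes chi: "character_on B \<chi>" and SB: "S \<subseteq> B" and S1: "\<And>s. s \<in> S \<Longrightarrow> \<chi> s = 1"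
    and com: "\<And>g h. g \<in> carrier G \<Longrightarrow> h \<in> carrier G \<Longrightarrow> com g h \<in> S"
    and A: "finite A" "A \<subseteq> carrier G" and tor: "\<And>x. x \<in> A \<Longrightarrow> \<exists>m::nat. m > 0 \<and> x [^] m \<in> B"
  shows "\<exists>B' \<chi>'. character_on B' \<chi>' \<and> B \<subseteq> B' \<and> A \<subseteq> B' \<and> (\<forall>b\<in>B. \<chi>' b = \<chi> b)"
  using A tor
proof (induction A)
  case empty
  then show ?case using chi by blast
next
  case (insert x A)
  then obtain B1 \<chi>1 where 1: "character_on B1 \<chi>1" "B \<subseteq> B1" "A \<subseteq> B1" "\<forall>b\<in>B. \<chi>1 b = \<chi> b" by blast
  obtain m where m: "x [^] (m::nat) \<in> B" "m > 0" using insert.prems by blast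
  have "S \<subseteq> B1" "\<And>s. s \<in> S \<Longrightarrow> \<chi>1 s = 1" "x \<in> carrier G" "x [^] m \<in> B1"
    using 1 SB S1 m insert.prems by auto
  from character_extend_step[OF 1(1) this(1,2) com this(3,4) m(2)] obtain B' \<chi>' where
    "character_on B' \<chi>' \<and> B1 \<subseteq> B' \<and> x \<in> B' \<and> (\<forall>b\<in>B1. \<chi>' b = \<chi>1 b)" by blast
  then show ?case using 1 by (intro exI[of _ B'] exI[of _ \<chi>']) auto
qed

end

section \<open>The central extension of a cocycle\<close>

text \<open>The central extension of \<open>G\<close> by the nonzero complex numbers. Since cocycles are not
  normalised at \<open>\<one>\<close>, the identity is \<open>(\<one>, 1 / f \<one> \<one>)\<close>.\<close>
definition twisted :: "('a, 'b) monoid_scheme \<Rightarrow> ('a \<Rightarrow> 'a \<Rightarrow> complex) \<Rightarrow> ('a \<times> complex) monoid" where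
  "twisted G f = \<lparr>carrier = carrier G \<times> (UNIV - {0}),
     monoid.mult = (\<lambda>u v. (fst u \<otimes>\<^bsub>G\<^esub> fst v, snd u * snd v * f (fst u) (fst v))),
     one = (\<one>\<^bsub>G\<^esub>, 1 / f \<one>\<^bsub>G\<^esub> \<one>\<^bsub>G\<^esub>)\<rparr>"

text \<open>For commuting \<open>x\<close> and \<open>y\<close> this is the commutator of their lifts to \<open>twisted G f\<close>; it
  has no meaning otherwise.\<close>
definition beta :: "('a \<Rightarrow> 'a \<Rightarrow> complex) \<Rightarrow> 'a \<Rightarrow> 'a \<Rightarrow> complex" where
  "beta f x y = f x y / f y x"

locale schur_ext = group G for G (structure) +
  fixes f assumes cocycle: "f \<in> schur_cocycles G"
begin

abbreviation "E \<equiv> twisted G f"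

lemma f_nz [simp]: "f x y \<noteq> 0"
  using cocycle by (simp add: schur_cocycles_def)

lemma f_cocycle: "x \<in> carrier G \<Longrightarrow> y \<in> carrier G \<Longrightarrow> z \<in> carrier G \<Longrightarrow>
    f x y * f (x \<otimes> y) z = f x (y \<otimes> z) * f y z"
  using cocycle by (simp add: schur_cocycles_def)

definition "f1 = f \<one> \<one>"

lemma f1_nz [simp]: "f1 \<noteq> 0" by (simp add: f1_def)

lemma f_one_left: "x \<in> carrier G \<Longrightarrow> f \<one> x = f1"
  using f_cocycle[of \<one> \<one> x] by (simp add: f1_def)

lemma f_one_right: "x \<in> carrier G \<Longrightarrow> f x \<one> = f1"
  using f_cocycle[of x \<one> \<one>] by (simp add: f1_def)

lemma carrier_E: "carrier E = carrier G \<times> (UNIV - {0})"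
  by (simp add: twisted_def)

lemma mult_E: "u \<otimes>\<^bsub>E\<^esub> v = (fst u \<otimes> fst v, snd u * snd v * f (fst u) (fst v))"
  by (simp add: twisted_def)

lemma fst_mult: "fst (u \<otimes>\<^bsub>E\<^esub> v) = fst u \<otimes> fst v"
  by (simp add: mult_E)

lemma one_E: "\<one>\<^bsub>E\<^esub> = (\<one>, 1 / f1)"
  by (simp add: twisted_def f1_def)

sublocale E: group "twisted G f"
proof (rule groupI)
  fix u v w assume *: "u \<in> carrier E" "v \<in> carrier E" "w \<in> carrier E"
  then show "u \<otimes>\<^bsub>E\<^esub> v \<otimes>\<^bsub>E\<^esub> w = u \<otimes>\<^bsub>E\<^esub> (v \<otimes>\<^bsub>E\<^esub> w)"
  proof -
    obtain x a y b z c where uvw: "u = (x, a)" "v = (y, b)" "w = (z, c)" by (metis surj_pair)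
    then have c: "x \<in> carrier G" "y \<in> carrier G" "z \<in> carrier G" using * by (auto simp: carrier_E)
    have "a * b * f x y * c * f (x \<otimes> y) z = a * b * c * (f x y * f (x \<otimes> y) z)" by (simp only: ac_simps)
    also have "\<dots> = a * (b * c * f y z) * f x (y \<otimes> z)" unfolding f_cocycle[OF c] by (simp only: ac_simps)
    finally show ?thesis using c by (simp add: mult_E uvw m_assoc)
  qed
next
  fix u assume "u \<in> carrier E"
  then show "\<one>\<^bsub>E\<^esub> \<otimes>\<^bsub>E\<^esub> u = u"
    by (auto simp: mult_E one_E carrier_E f_one_left)
next
  fix u assume u: "u \<in> carrier E"
  show "\<exists>v\<in>carrier E. v \<otimes>\<^bsub>E\<^esub> u = \<one>\<^bsub>E\<^esub>"
    by (rule bexI[of _ "(inv (fst u), 1 / (snd u * f1 * f (inv (fst u)) (fst u)))"])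
      (use u in \<open>auto simp: mult_E one_E carrier_E field_simps\<close>)
qed (auto simp: carrier_E mult_E one_E)

lemma fst_hom: "group_hom E G fst"
  by (auto simp: group_hom_def group_hom_axioms_def hom_def carrier_E mult_E E.group_axioms group_axioms)

lemma fst_inv: "u \<in> carrier E \<Longrightarrow> fst (inv\<^bsub>E\<^esub> u) = inv (fst u)"
  using group_hom.hom_inv[OF fst_hom] by blast

lemma fst_com: "u \<in> carrier E \<Longrightarrow> v \<in> carrier E \<Longrightarrow> fst (E.com u v) = com (fst u) (fst v)"
  by (simp add: E.com_def com_def mult_E fst_inv)

lemma fst_pow: "u \<in> carrier E \<Longrightarrow> fst (u [^]\<^bsub>E\<^esub> (n::nat)) = fst u [^] n"
  by (induction n) (auto simp: one_E mult_E)

text \<open>The embedding of the scalars. The identity of the extension has second component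
  \<open>1 / f1\<close>, and the division makes the embedding multiplicative.\<close>

definition scal :: "complex \<Rightarrow> 'a \<times> complex" where "scal a = (\<one>, a / f1)"

lemma scal_carrier [simp]: "a \<noteq> 0 \<Longrightarrow> scal a \<in> carrier E"
  by (simp add: scal_def carrier_E)

lemma scal_mult: "scal a \<otimes>\<^bsub>E\<^esub> scal b = scal (a * b)"
  by (simp add: scal_def mult_E f_one_left)

lemma scal_one: "scal 1 = \<one>\<^bsub>E\<^esub>" by (simp add: scal_def one_E)

lemma scal_eq_iff: "scal a = scal b \<longleftrightarrow> a = b" by (simp add: scal_def)

lemma scal_act: "u \<in> carrier E \<Longrightarrow> u \<otimes>\<^bsub>E\<^esub> scal a = (fst u, a * snd u)" "u \<in> carrier E \<Longrightarrow> scal a \<otimes>\<^bsub>E\<^esub> u = (fst u, a * snd u)"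
  by (auto simp: scal_def mult_E carrier_E f_one_left f_one_right)

lemma scal_cen: "a \<noteq> 0 \<Longrightarrow> scal a \<in> group_center E"
  by (intro E.cenI) (auto simp: scal_act)

lemma fst_one_scal: "u \<in> carrier E \<Longrightarrow> fst u = \<one> \<Longrightarrow> \<exists>a. a \<noteq> 0 \<and> u = scal a"
  by (rule exI[of _ "snd u * f1"]) (auto simp: scal_def carrier_E)

lemma same_fst: "u \<in> carrier E \<Longrightarrow> v \<in> carrier E \<Longrightarrow> fst u = fst v \<Longrightarrow> \<exists>a. a \<noteq> 0 \<and> u = v \<otimes>\<^bsub>E\<^esub> scal a"
  by (rule exI[of _ "snd u / snd v"]) (auto simp: scal_act carrier_E prod_eq_iff)

lemma com_commuting:
  assumes "u \<in> carrier E" "v \<in> carrier E" "fst u \<otimes> fst v = fst v \<otimes> fst u"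
  shows "E.com u v = scal (beta f (fst u) (fst v))"
proof -
  have "scal (beta f (fst u) (fst v)) \<otimes>\<^bsub>E\<^esub> (v \<otimes>\<^bsub>E\<^esub> u) = u \<otimes>\<^bsub>E\<^esub> v"
    using assms by (simp add: scal_act) (simp add: mult_E beta_def)
  then have "E.com u v \<otimes>\<^bsub>E\<^esub> (v \<otimes>\<^bsub>E\<^esub> u) = scal (beta f (fst u) (fst v)) \<otimes>\<^bsub>E\<^esub> (v \<otimes>\<^bsub>E\<^esub> u)"
    using E.com_swap[OF assms(1,2)] by simp
  then show ?thesis using assms by (subst (asm) E.right_cancel) (auto simp: beta_def)
qed

lemma beta_nz [simp]: "beta f x y \<noteq> 0" by (simp add: beta_def)
lemma beta_self [simp]: "beta f x x = 1" by (simp add: beta_def)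
lemma beta_swap: "beta f y x = 1 / beta f x y" by (simp add: beta_def)

lemma lift_carrier [simp]: "x \<in> carrier G \<Longrightarrow> (x, 1) \<in> carrier E" by (simp add: carrier_E)

lemma beta_mult_right:
  assumes "x \<in> carrier G" "y \<in> carrier G" "z \<in> carrier G" "x \<otimes> y = y \<otimes> x" "x \<otimes> z = z \<otimes> x"
  shows "beta f x (y \<otimes> z) = beta f x y * beta f x z"
proof -
  have yz: "x \<otimes> (y \<otimes> z) = (y \<otimes> z) \<otimes> x" using assms by (metis m_assoc)
  have "E.com (x, 1) ((y, 1) \<otimes>\<^bsub>E\<^esub> (z, 1)) = E.com (x, 1) (y, 1) \<otimes>\<^bsub>E\<^esub> E.com (x, 1) (z, 1)"
    using assms by (intro E.com_mult_right_cen) (auto simp: com_commuting scal_cen)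
  moreover have "E.com (x, 1) ((y, 1) \<otimes>\<^bsub>E\<^esub> (z, 1)) = scal (beta f x (y \<otimes> z))"
    using assms yz by (subst com_commuting) (auto simp: mult_E carrier_E)
  ultimately show ?thesis using assms by (simp add: com_commuting scal_mult scal_eq_iff)
qed

lemma beta_mult_left:
  assumes "x \<in> carrier G" "y \<in> carrier G" "z \<in> carrier G" "x \<otimes> y = y \<otimes> x" "x \<otimes> z = z \<otimes> x"
  shows "beta f (y \<otimes> z) x = beta f y x * beta f z x"
  using beta_mult_right[OF assms] by (simp add: beta_swap[of x])

lemma beta_one [simp]: "x \<in> carrier G \<Longrightarrow> beta f x \<one> = 1" "x \<in> carrier G \<Longrightarrow> beta f \<one> x = 1"
  by (auto simp: beta_def f_one_left f_one_right)

lemma beta_pow_right: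
  assumes "x \<in> carrier G" "y \<in> carrier G" "x \<otimes> y = y \<otimes> x"
  shows "beta f x (y [^] (n::nat)) = beta f x y ^ n"
proof (induction n)
  case (Suc n)
  have "x \<otimes> y [^] n = y [^] n \<otimes> x" using assms group_commutes_pow by metis
  then show ?case using Suc assms by (simp add: beta_mult_right)
qed (use assms in simp)

lemma beta_pow_left:
  assumes "x \<in> carrier G" "y \<in> carrier G" "x \<otimes> y = y \<otimes> x"
  shows "beta f (x [^] (n::nat)) y = beta f x y ^ n"
  using beta_pow_right[of y x n] assms by (simp add: beta_swap[of y] power_one_over)

text \<open>The image in \<open>G\<close> of the centralizer of a lift of \<open>x\<close>. As a
  subgroup it can be compared with other subgroups by order, and triviality of \<open>beta\<close>
  need only be checked on generators.\<close>

definition bker where "bker x = {g \<in> carrier G. x \<otimes> g = g \<otimes> x \<and> beta f x g = 1}"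

lemma bker_sym: "x \<in> carrier G \<Longrightarrow> g \<in> carrier G \<Longrightarrow> g \<in> bker x \<longleftrightarrow> x \<in> bker g"
  by (auto simp: bker_def beta_swap[of g])

lemma subgroup_bker: 
  assumes x: "x \<in> carrier G" shows "subgroup (bker x) G"
proof
  show "bker x \<subseteq> carrier G" by (auto simp: bker_def)
  show "\<one> \<in> bker x" using x by (auto simp: bker_def)
  fix a b assume "a \<in> bker x" "b \<in> bker x"
  then show "a \<otimes> b \<in> bker x"
    using beta_mult_right[OF x, of a b] x unfolding bker_def by clarsimp (metis m_assoc)
next
  fix a assume a: "a \<in> bker x"
  then have ac: "a \<in> carrier G" "x \<otimes> a = a \<otimes> x" "beta f x a = 1" by (auto simp: bker_def)
  have "x \<otimes> inv a = inv a \<otimes> (a \<otimes> x) \<otimes> inv a" using ac x by (simp add: m_assoc cancel_left')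
  also have "\<dots> = inv a \<otimes> (x \<otimes> a) \<otimes> inv a" using ac by simp
  also have "\<dots> = inv a \<otimes> x" using ac(1) x by (simp add: m_assoc)
  finally have c: "x \<otimes> inv a = inv a \<otimes> x" .
  have "beta f x (a \<otimes> inv a) = beta f x a * beta f x (inv a)"
    using ac c x by (intro beta_mult_right) auto
  then show "inv a \<in> bker x" using ac x c by (auto simp: bker_def)
qed

text \<open>For central \<open>z\<close> the map \<open>beta f z\<close> is a homomorphism from
  \<open>G\<close> to an abelian group.\<close>

lemma beta_cen_com:
  assumes z: "z \<in> cen" and gh: "g \<in> carrier G" "h \<in> carrier G"
  shows "com g h \<in> bker z"
proof -
  have zc: "z \<in> carrier G" and c: "z \<otimes> g = g \<otimes> z" if "g \<in> carrier G" for g using z that cenD by auto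
  have "beta f z (g \<otimes> h) = beta f z (com g h \<otimes> (h \<otimes> g))" using com_swap[OF gh] by simp
  also have "\<dots> = beta f z (com g h) * beta f z (h \<otimes> g)"
    using gh zc c by (intro beta_mult_right) auto
  finally have "beta f z (com g h) = 1"
    using gh zc[OF gh(1)] c by (simp add: beta_mult_right) 
  then show ?thesis using gh c by (simp add: bker_def)
qed

text \<open>Two lifts of the same element differ by a scalar, and scalars are central.\<close>

lemma com_cong:
  assumes "u \<in> carrier E" "v \<in> carrier E" "u' \<in> carrier E" "v' \<in> carrier E" "fst u = fst u'" "fst v = fst v'"
  shows "E.com u v = E.com u' v'"
proof -
  have 1: "E.com (u \<otimes>\<^bsub>E\<^esub> scal a) v = E.com u v" if "u \<in> carrier E" "v \<in> carrier E" "a \<noteq> 0" for u v a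
    using that scal_cen[of a] E.com_cen[OF scal_cen, of a v] 
    by (subst E.com_mult_left_cen) (auto simp: E.subgroup_cen subgroup.one_closed)
  have 2: "E.com u v = E.com u' v" if "u \<in> carrier E" "u' \<in> carrier E" "v \<in> carrier E" "fst u = fst u'" for u u' v
    using same_fst[of u u'] 1[of u' v] that by auto
  have "E.com u v = E.com u' v" using 2 assms by blast
  also have "\<dots> = inv\<^bsub>E\<^esub> (E.com v u')" using assms by (simp add: E.inv_com)
  also have "\<dots> = inv\<^bsub>E\<^esub> (E.com v' u')" using 2[of v v' u'] assms by simp
  also have "\<dots> = E.com u' v'" using assms by (simp add: E.inv_com)
  finally show ?thesis .
qed

text \<open>Conjugation by a lift of \<open>g\<close> fixes the scalar that is the commutator of the
  two lifts.\<close>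

lemma beta_conj:
  assumes "g \<in> carrier G" "x \<in> carrier G" "y \<in> carrier G" "x \<otimes> y = y \<otimes> x"
  shows "beta f (g \<otimes> x \<otimes> inv g) (g \<otimes> y \<otimes> inv g) = beta f x y"
proof -
  let ?g = "(g, 1::complex)"
  let ?u = "?g \<otimes>\<^bsub>E\<^esub> (x, 1) \<otimes>\<^bsub>E\<^esub> inv\<^bsub>E\<^esub> ?g" and ?v = "?g \<otimes>\<^bsub>E\<^esub> (y, 1) \<otimes>\<^bsub>E\<^esub> inv\<^bsub>E\<^esub> ?g"
  have fst: "fst ?u = g \<otimes> x \<otimes> inv g" "fst ?v = g \<otimes> y \<otimes> inv g"
    using assms fst_inv[of ?g] by (auto simp: mult_E)
  have cm: "(g \<otimes> x \<otimes> inv g) \<otimes> (g \<otimes> y \<otimes> inv g) = (g \<otimes> y \<otimes> inv g) \<otimes> (g \<otimes> x \<otimes> inv g)"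
  proof -
    have "(g \<otimes> x \<otimes> inv g) \<otimes> (g \<otimes> y \<otimes> inv g) = g \<otimes> (x \<otimes> y) \<otimes> inv g"
      using assms(1-3) by (simp add: m_assoc cancel_left')
    also have "\<dots> = g \<otimes> (y \<otimes> x) \<otimes> inv g" using assms by simp
    also have "\<dots> = (g \<otimes> y \<otimes> inv g) \<otimes> (g \<otimes> x \<otimes> inv g)"
      using assms(1-3) by (simp add: m_assoc cancel_left')
    finally show ?thesis .
  qed
  have "E.com ?u ?v = ?g \<otimes>\<^bsub>E\<^esub> E.com (x, 1) (y, 1) \<otimes>\<^bsub>E\<^esub> inv\<^bsub>E\<^esub> ?g"
    using assms by (simp add: E.word_simps)
  also have "E.com (x, 1) (y, 1) = scal (beta f x y)" using assms by (simp add: com_commuting)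
  also have "?g \<otimes>\<^bsub>E\<^esub> scal (beta f x y) \<otimes>\<^bsub>E\<^esub> inv\<^bsub>E\<^esub> ?g = scal (beta f x y)"
    using assms by (intro E.conj_cen scal_cen) auto
  finally have "scal (beta f (fst ?u) (fst ?v)) = scal (beta f x y)"
    using assms cm fst by (subst (asm) com_commuting) auto
  then show ?thesis using fst by (simp add: scal_eq_iff)
qed

end

section \<open>Splitting criterion for the extension\<close>

context schur_ext
begin

lemma scal_in_S_unique:
  assumes S: "subgroup S E" and triv: "\<And>a. a \<noteq> 0 \<Longrightarrow> scal a \<in> S \<Longrightarrow> a = 1"
    and st: "s \<in> S" "t \<in> S" and ab: "a \<noteq> 0" "b \<noteq> 0" and eq: "s \<otimes>\<^bsub>E\<^esub> scal a = t \<otimes>\<^bsub>E\<^esub> scal b"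
  shows "a = b"
proof -
  interpret S: subgroup S E by fact
  have c: "s \<in> carrier E" "t \<in> carrier E" using st by auto
  have "s = s \<otimes>\<^bsub>E\<^esub> scal a \<otimes>\<^bsub>E\<^esub> scal (1 / a)"
    using c ab by (simp add: E.m_assoc scal_mult scal_one)
  also have "\<dots> = t \<otimes>\<^bsub>E\<^esub> scal (b / a)"
    using c ab by (simp add: eq E.m_assoc scal_mult)
  finally have "inv\<^bsub>E\<^esub> t \<otimes>\<^bsub>E\<^esub> s = scal (b / a)" using c ab by (simp add: E.cancel_left')
  then have "scal (b / a) \<in> S" using st by (metis S.m_closed S.m_inv_closed)
  then show ?thesis using triv[of "b / a"] ab by simp
qed

text \<open>The character \<open>s \<cdot> scal a \<mapsto> a\<close> is trivial on commutators, hence extends to the whole of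
  the extension because the nonzero complex numbers are divisible; this splits the extension.\<close>
lemma coboundaryI:
  assumes fin: "finite (carrier G)" and S: "subgroup S E"
    and com: "\<And>u v. u \<in> carrier E \<Longrightarrow> v \<in> carrier E \<Longrightarrow> E.com u v \<in> S"
    and triv: "\<And>a. a \<noteq> 0 \<Longrightarrow> scal a \<in> S \<Longrightarrow> a = 1"
  shows "f \<in> schur_coboundaries G"
proof -
  interpret S: subgroup S E by fact
  have uniq: "a = b"
    if "s \<in> S" "t \<in> S" "a \<noteq> 0" "b \<noteq> 0" "s \<otimes>\<^bsub>E\<^esub> scal a = t \<otimes>\<^bsub>E\<^esub> scal b" for s t a b
    using scal_in_S_unique[OF S _ that] triv by blast
  define B where "B = {u. \<exists>s\<in>S. \<exists>a. a \<noteq> 0 \<and> u = s \<otimes>\<^bsub>E\<^esub> scal a}"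
  define \<chi> where "\<chi> u = (SOME a. \<exists>s\<in>S. a \<noteq> 0 \<and> u = s \<otimes>\<^bsub>E\<^esub> scal a)" for u
  have val: "\<chi> (s \<otimes>\<^bsub>E\<^esub> scal a) = a" if s: "s \<in> S" and a: "a \<noteq> 0" for s a
  proof -
    have "\<exists>b. \<exists>t\<in>S. b \<noteq> 0 \<and> s \<otimes>\<^bsub>E\<^esub> scal a = t \<otimes>\<^bsub>E\<^esub> scal b" using s a by blast
    from someI_ex[OF this] obtain t where "t \<in> S" "\<chi> (s \<otimes>\<^bsub>E\<^esub> scal a) \<noteq> 0"
      "s \<otimes>\<^bsub>E\<^esub> scal a = t \<otimes>\<^bsub>E\<^esub> scal (\<chi> (s \<otimes>\<^bsub>E\<^esub> scal a))"
      unfolding \<chi>_def[of "s \<otimes>\<^bsub>E\<^esub> scal a"] by blast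
    then show ?thesis using uniq[OF s, of t a] a by metis
  qed
  have prod: "s \<otimes>\<^bsub>E\<^esub> scal a \<otimes>\<^bsub>E\<^esub> (t \<otimes>\<^bsub>E\<^esub> scal b) = s \<otimes>\<^bsub>E\<^esub> t \<otimes>\<^bsub>E\<^esub> scal (a * b)"
    if "s \<in> S" "t \<in> S" "a \<noteq> 0" "b \<noteq> 0" for s t a b
  proof -
    have c: "s \<in> carrier E" "t \<in> carrier E" using that by auto
    have "s \<otimes>\<^bsub>E\<^esub> scal a \<otimes>\<^bsub>E\<^esub> (t \<otimes>\<^bsub>E\<^esub> scal b) = s \<otimes>\<^bsub>E\<^esub> (scal a \<otimes>\<^bsub>E\<^esub> t) \<otimes>\<^bsub>E\<^esub> scal b"
      using c that by (simp add: E.m_assoc)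
    also have "scal a \<otimes>\<^bsub>E\<^esub> t = t \<otimes>\<^bsub>E\<^esub> scal a" using scal_cen[of a] that c E.cenD by blast
    finally show ?thesis using c that by (simp add: E.m_assoc scal_mult)
  qed
  have scalB: "scal a \<in> B" if "a \<noteq> 0" for a
    unfolding B_def using that by (intro CollectI bexI[of _ "\<one>\<^bsub>E\<^esub>"] exI[of _ a]) auto
  have "subgroup B E"
  proof
    show "B \<subseteq> carrier E" by (auto simp: B_def)
    show "\<one>\<^bsub>E\<^esub> \<in> B" using scalB[of 1] by (simp add: scal_one)
    fix u v assume "u \<in> B" "v \<in> B"
    then obtain s a t b where "s \<in> S" "t \<in> S" "a \<noteq> 0" "b \<noteq> 0" "u = s \<otimes>\<^bsub>E\<^esub> scal a" "v = t \<otimes>\<^bsub>E\<^esub> scal b"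
      unfolding B_def by blast
    then show "u \<otimes>\<^bsub>E\<^esub> v \<in> B" unfolding B_def
      by (intro CollectI bexI[of _ "s \<otimes>\<^bsub>E\<^esub> t"] exI[of _ "a * b"]) (simp_all add: prod)
  next
    fix u assume "u \<in> B"
    then obtain s a where u: "s \<in> S" "a \<noteq> 0" "u = s \<otimes>\<^bsub>E\<^esub> scal a" unfolding B_def by blast
    have "u \<otimes>\<^bsub>E\<^esub> (inv\<^bsub>E\<^esub> s \<otimes>\<^bsub>E\<^esub> scal (1 / a)) = \<one>\<^bsub>E\<^esub>"
      using u prod[of s "inv\<^bsub>E\<^esub> s" a "1 / a"] by (simp add: scal_one)
    then have "inv\<^bsub>E\<^esub> u = inv\<^bsub>E\<^esub> s \<otimes>\<^bsub>E\<^esub> scal (1 / a)"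
      using u by (intro E.inv_equality E.inv_comm[of u]) auto
    then show "inv\<^bsub>E\<^esub> u \<in> B" unfolding B_def using u
      by (intro CollectI bexI[of _ "inv\<^bsub>E\<^esub> s"] exI[of _ "1 / a"]) auto
  qed
  moreover have "\<chi> u \<noteq> 0" if "u \<in> B" for u using that val unfolding B_def by auto
  moreover have "\<chi> (u \<otimes>\<^bsub>E\<^esub> v) = \<chi> u * \<chi> v" if "u \<in> B" "v \<in> B" for u v
  proof -
    obtain s a t b where "s \<in> S" "t \<in> S" "a \<noteq> 0" "b \<noteq> 0" "u = s \<otimes>\<^bsub>E\<^esub> scal a" "v = t \<otimes>\<^bsub>E\<^esub> scal b"
      using \<open>u \<in> B\<close> \<open>v \<in> B\<close> unfolding B_def by blast
    then show ?thesis using val prod by (simp add: val)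
  qed
  ultimately have chi: "E.character_on B \<chi>" unfolding E.character_on_def by blast
  have SB: "S \<subseteq> B"
  proof
    fix s assume "s \<in> S" then show "s \<in> B" unfolding B_def
      by (intro CollectI bexI[of _ s] exI[of _ 1]) (auto simp: scal_one)
  qed
  have S1: "\<chi> s = 1" if "s \<in> S" for s using val[OF that, of 1] that by (simp add: scal_one)
  \<comment> \<open>The power with exponent \<open>order G\<close> lies over the identity, hence is
    a scalar.\<close>
  have tor: "\<exists>m::nat. m > 0 \<and> u [^]\<^bsub>E\<^esub> m \<in> B" if u: "u \<in> (\<lambda>x. (x, 1)) ` carrier G" for u
  proof (intro exI conjI)
    show "order G > 0" using fin order_gt_0_iff_finite by blast
    have uE: "u \<in> carrier E" using u by auto
    have "fst (u [^]\<^bsub>E\<^esub> order G) = \<one>" using u fin by (auto simp: fst_pow pow_order_eq_1)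
    then show "u [^]\<^bsub>E\<^esub> order G \<in> B" using fst_one_scal[of "u [^]\<^bsub>E\<^esub> order G"] uE scalB by auto
  qed
  obtain B' \<chi>' where ext: "E.character_on B' \<chi>'" "B \<subseteq> B'" "(\<lambda>x. (x, 1)) ` carrier G \<subseteq> B'" "\<forall>b\<in>B. \<chi>' b = \<chi> b"
  proof -
    have "\<exists>B' \<chi>'. E.character_on B' \<chi>' \<and> B \<subseteq> B' \<and> (\<lambda>x. (x, 1)) ` carrier G \<subseteq> B' \<and> (\<forall>b\<in>B. \<chi>' b = \<chi> b)"
      by (rule E.character_extend[OF chi SB]) (use S1 com fin tor in auto)
    then show thesis using that by blast
  qed
  have mu: "\<chi>' (u \<otimes>\<^bsub>E\<^esub> v) = \<chi>' u * \<chi>' v" if "u \<in> B'" "v \<in> B'" for u v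
    using ext(1) that by (simp add: E.character_on_def)
  have nz: "\<chi>' u \<noteq> 0" if "u \<in> B'" for u
    using ext(1) that by (simp add: E.character_on_def)
  have sc: "\<chi>' (scal a) = a" "scal a \<in> B'" if "a \<noteq> 0" for a
    using ext scalB[OF that] val[OF S.one_closed that] that by auto
  \<comment> \<open>The scalar separating \<open>(x, 1) (y, 1)\<close> from \<open>(x y, 1)\<close>
    is \<open>f x y\<close>, so the extended character, restricted to these lifts, is a cochain with
    coboundary \<open>f\<close>.\<close>
  define g where "g x = \<chi>' (x, 1)" for x
  have in_B': "(x, 1) \<in> B'" if "x \<in> carrier G" for x using ext that by auto
  have gnz: "g x \<noteq> 0" if "x \<in> carrier G" for x using nz in_B' that by (simp add: g_def)
  have fg: "f x y = g x * g y / g (x \<otimes> y)" if x: "x \<in> carrier G" and y: "y \<in> carrier G" for x y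
  proof -
    have "(x, 1) \<otimes>\<^bsub>E\<^esub> (y, 1) = (x \<otimes> y, 1) \<otimes>\<^bsub>E\<^esub> scal (f x y)"
      using x y by (simp add: scal_act) (simp add: mult_E)
    then have "g x * g y = g (x \<otimes> y) * f x y"
      using mu[OF in_B'[OF x] in_B'[OF y]] mu[OF in_B'[of "x \<otimes> y"] sc(2)[of "f x y"]] sc(1)[of "f x y"] x y
      by (simp add: g_def)
    then show ?thesis using gnz[of "x \<otimes> y"] x y by simp
  qed
  have out: "f x y = 1" if "\<not> (x \<in> carrier G \<and> y \<in> carrier G)" for x y
    using cocycle that by (auto simp: schur_cocycles_def)
  show ?thesis unfolding schur_coboundaries_def
    by (rule CollectI, rule exI[of _ g], intro conjI HOL.ext) (use fg out gnz in auto)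
qed

text \<open>The lifts of \<open>\<one>\<close> are precisely the scalars; a subgroup containing them
  is a union of full fibres, so it is enough that its image is everything.\<close>

lemma subgroup_lift:
  assumes gen: "\<And>H. subgroup H G \<Longrightarrow> A \<subseteq> H \<Longrightarrow> carrier G \<subseteq> H" and A: "A \<subseteq> carrier G"
    and H: "subgroup H E" and AH: "{u \<in> carrier E. fst u \<in> insert \<one> A} \<subseteq> H"
  shows "carrier E \<subseteq> H"
proof
  interpret H: subgroup H E by fact
  have "A \<subseteq> fst ` H"
  proof
    fix x assume "x \<in> A"
    then have "(x, 1) \<in> H" using AH A by (auto simp: carrier_E)
    then show "x \<in> fst ` H" by (metis fst_conv imageI)
  qed
  then have sub: "carrier G \<subseteq> fst ` H"
    using gen group_hom.subgroup_img_is_subgroup[OF fst_hom H] by blast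
  fix u assume u: "u \<in> carrier E"
  then have "fst u \<in> fst ` H" using sub by (auto simp: carrier_E)
  then obtain h where h: "h \<in> H" "fst u = fst h" by (elim imageE)
  then obtain a where a: "a \<noteq> 0" "u = h \<otimes>\<^bsub>E\<^esub> scal a" using same_fst[OF u, of h] by auto
  moreover have "scal a \<in> H" using AH a by (auto simp: scal_def carrier_E)
  ultimately show "u \<in> H" using h by simp
qed

text \<open>Over a central image all commutators are scalars, and these are given by
  \<open>beta\<close>.\<close>

lemma cen_lift:
  assumes "u \<in> carrier E" "fst u \<in> cen" "\<And>g. g \<in> carrier G \<Longrightarrow> beta f (fst u) g = 1"
  shows "u \<in> group_center E"
  unfolding E.cen_iff
proof (intro conjI ballI)
  fix v assume v: "v \<in> carrier E"
  then have vG: "fst v \<in> carrier G" by (auto simp: carrier_E)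
  then show "E.com u v = \<one>\<^bsub>E\<^esub>"
    using com_commuting[OF assms(1) v] cenD(2)[OF assms(2) vG] assms(3)[OF vG] by (simp add: scal_one)
qed (fact assms(1))

end

text \<open>In the induction \<open>c^n\<close> is conjugated by \<open>x\<close>, which contributes
  \<open>v^n\<close>; the exponents of \<open>v\<close> sum up to \<open>n choose 2\<close>. For an
  odd prime \<open>n = p\<close> this is a multiple of \<open>p\<close>.\<close>

lemma (in group) com_pow_left_class3:
  assumes x: "x \<in> carrier G" and y: "y \<in> carrier G" and V: "com x (com x y) \<in> cen"
  shows "com (x [^] (n::nat)) y = com x y [^] n \<otimes> com x (com x y) [^] (n choose 2)"
proof (induction n)
  case 0
  then show ?case using y by (simp add: binomial_eq_0)
next
  case (Suc n)
  define c where "c = com x y"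
  define v where "v = com x c"
  have c: "c \<in> carrier G" using x y by (simp add: c_def)
  have v: "v \<in> cen" using V by (simp add: v_def c_def)
  note vc = cenD(1)[OF nat_pow_cen[OF v]] and vcom = cenD(2)[OF nat_pow_cen[OF v]]
  have pw: "v [^] a \<otimes> v [^] b = v [^] (a + b)" for a b :: nat
    using v cenD by (simp add: nat_pow_mult)
  have xc: "x \<otimes> c [^] n \<otimes> inv x = v [^] n \<otimes> c [^] n"
  proof -
    have "x \<otimes> c [^] n \<otimes> inv x = com x (c [^] n) \<otimes> c [^] n" using x c by (simp add: word_simps)
    also have "com x (c [^] n) = v [^] n"
      unfolding v_def using x c v by (intro com_pow_right_cen) (auto simp: v_def)
    finally show ?thesis .
  qed
  have "com (x [^] Suc n) y = com (x \<otimes> x [^] n) y" using x by (simp only: nat_pow_Suc2)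
  also have "\<dots> = x \<otimes> (c [^] n \<otimes> v [^] (n choose 2)) \<otimes> inv x \<otimes> c"
    using x y Suc by (simp add: com_mult_left c_def v_def)
  also have "\<dots> = x \<otimes> (v [^] (n choose 2) \<otimes> c [^] n) \<otimes> inv x \<otimes> c"
    using c by (simp add: vcom)
  also have "\<dots> = x \<otimes> v [^] (n choose 2) \<otimes> c [^] n \<otimes> inv x \<otimes> c"
    using c x vc by (simp add: m_assoc)
  also have "\<dots> = v [^] (n choose 2) \<otimes> x \<otimes> c [^] n \<otimes> inv x \<otimes> c"
    using x by (simp add: vcom)
  also have "\<dots> = v [^] (n choose 2) \<otimes> (x \<otimes> c [^] n \<otimes> inv x) \<otimes> c"
    using c x vc by (simp add: m_assoc)
  also have "\<dots> = v [^] (n choose 2) \<otimes> v [^] n \<otimes> (c [^] n \<otimes> c)"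
    unfolding xc using c x vc by (simp add: m_assoc)
  also have "\<dots> = c [^] Suc n \<otimes> v [^] ((n choose 2) + n)"
    unfolding pw using c by (subst vcom) auto
  also have "(n choose 2) + n = Suc n choose 2" by (simp add: numeral_2_eq_2)
  finally show ?case by (simp add: c_def v_def)
qed

section \<open>Two criteria for being a coboundary\<close>

context schur_ext
begin

text \<open>Here the commutators with a fixed lift of \<open>t\<close> form the whole derived
  subgroup: \<open>bz\<close> makes them central, and lifts of elements of \<open>A\<close> commute
  by \<open>bA\<close>. If such a commutator is scalar, the underlying element of \<open>A\<close>
  commutes with \<open>t\<close>, so it is central, and by \<open>bz\<close> its lift is central
  too.\<close>

lemma coboundary_abelian_index:
  assumes fin: "finite (carrier G)" and A: "subgroup A G" "cen \<subseteq> A"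
    and abel: "\<And>a b. a \<in> A \<Longrightarrow> b \<in> A \<Longrightarrow> a \<otimes> b = b \<otimes> a"
    and t: "t \<in> carrier G" and comt: "\<And>a. a \<in> A \<Longrightarrow> com a t \<in> cen"
    and cent: "\<And>a. a \<in> A \<Longrightarrow> com a t = \<one> \<Longrightarrow> a \<in> cen"
    and gen: "\<And>H. subgroup H G \<Longrightarrow> insert t A \<subseteq> H \<Longrightarrow> carrier G \<subseteq> H"
    and bz: "\<And>z g. z \<in> cen \<Longrightarrow> g \<in> carrier G \<Longrightarrow> beta f z g = 1"
    and bA: "\<And>a b. a \<in> A \<Longrightarrow> b \<in> A \<Longrightarrow> beta f a b = 1"
  shows "f \<in> schur_coboundaries G"
proof -
  interpret A: subgroup A G by fact
  let ?T = "(t, 1::complex)"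
  have T: "?T \<in> carrier E" using t by simp
  define S where "S = (\<lambda>u. E.com u ?T) ` {u \<in> carrier E. fst u \<in> A}"
  have Scen: "s \<in> group_center E" if "s \<in> S" for s
    using that unfolding S_def
    by (auto intro!: cen_lift bz simp: fst_com t) (auto simp: comt)
  have S: "subgroup S E"
  proof
    show "S \<subseteq> carrier E" using T by (auto simp: S_def)
    have "E.com \<one>\<^bsub>E\<^esub> ?T \<in> S" unfolding S_def by (rule imageI) (auto simp: one_E carrier_E)
    then show "\<one>\<^bsub>E\<^esub> \<in> S" using T by simp
    fix r s assume "r \<in> S" "s \<in> S"
    then obtain u v where uv: "u \<in> carrier E" "v \<in> carrier E" "fst u \<in> A" "fst v \<in> A" "r = E.com u ?T" "s = E.com v ?T"
      unfolding S_def by blast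
    have "r \<otimes>\<^bsub>E\<^esub> s = E.com (u \<otimes>\<^bsub>E\<^esub> v) ?T"
      using uv T Scen[OF \<open>s \<in> S\<close>] by (simp add: E.com_mult_left_cen)
    also have "\<dots> \<in> S" unfolding S_def using uv by (intro imageI) (auto simp: mult_E[of u v] carrier_E)
    finally show "r \<otimes>\<^bsub>E\<^esub> s \<in> S" .
  next
    fix s assume s: "s \<in> S"
    then obtain v where v: "v \<in> carrier E" "fst v \<in> A" "s = E.com v ?T"
      unfolding S_def by blast
    have iS: "E.com (inv\<^bsub>E\<^esub> v) ?T \<in> S" unfolding S_def using v by (intro imageI) (auto simp: fst_inv)
    have "E.com (inv\<^bsub>E\<^esub> v) ?T \<otimes>\<^bsub>E\<^esub> s = E.com (inv\<^bsub>E\<^esub> v \<otimes>\<^bsub>E\<^esub> v) ?T"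
      using v T Scen[OF s] by (subst E.com_mult_left_cen) auto
    also have "\<dots> = \<one>\<^bsub>E\<^esub>" using v T by simp
    finally have "inv\<^bsub>E\<^esub> s = E.com (inv\<^bsub>E\<^esub> v) ?T" using v T by (intro E.inv_equality) auto
    then show "inv\<^bsub>E\<^esub> s \<in> S" using iS by simp
  qed
  interpret S: subgroup S E by fact
  have Sn: "S \<lhd> E" using S Scen by (intro E.normal_of_com) (auto simp: E.com_cen)
  let ?X = "{u \<in> carrier E. fst u \<in> insert \<one> (insert t A)}"
  have AT: "E.com u v \<in> S" if "u \<in> carrier E" "v \<in> carrier E" "fst u \<in> A" "fst v = t" for u v
  proof -
    have "E.com u v = E.com u ?T" using that T by (intro com_cong) auto
    then show ?thesis unfolding S_def using that by blast
  qed
  have XX: "E.com u v \<in> S" if u: "u \<in> ?X" and v: "v \<in> ?X" for u v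
  proof -
    have c: "u \<in> carrier E" "v \<in> carrier E" "fst u \<in> A \<or> fst u = t" "fst v \<in> A \<or> fst v = t" using u v by auto
    consider "fst u \<in> A" "fst v \<in> A" | "fst u \<in> A" "fst v = t" | "fst u = t" "fst v \<in> A" | "fst u = t" "fst v = t"
      using c by blast
    then show ?thesis
    proof cases
      case 1
      then show ?thesis using c abel bA S.one_closed by (simp add: com_commuting scal_one)
    next
      case 2
      then show ?thesis using AT c by blast
    next
      case 3
      then show ?thesis using AT[of v u] c E.com_sym_mem[OF S] by blast
    next
      case 4
      then show ?thesis using c S.one_closed by (simp add: com_commuting scal_one)
    qed
  qed
  have "E.com u v \<in> S" if uv: "u \<in> carrier E" "v \<in> carrier E" for u v
  proof (rule E.com_mem_of_generators[OF Sn _ _ XX uv])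
    show "carrier E \<subseteq> H" if "subgroup H E" "?X \<subseteq> H" for H
      using t by (intro subgroup_lift[OF gen _ that]) auto
  qed auto
  then show ?thesis
  proof (rule coboundaryI[OF fin S])
    fix a assume a: "a \<noteq> 0" "scal a \<in> S"
    then obtain u where u: "u \<in> carrier E" "fst u \<in> A" "scal a = E.com u ?T" unfolding S_def by blast
    have "com (fst u) t = fst (scal a)" using u T by (simp add: fst_com)
    then have "fst u \<in> cen" using cent u by (simp add: scal_def)
    then have "u \<in> group_center E" using u bz by (intro cen_lift)
    then show "a = 1" using u T E.com_cen by (simp add: scal_eq_iff flip: scal_one)
  qed
qed

text \<open>The derived subgroup of the extension consists of the \<open>C\<^sup>i [C, u]\<close>, where \<open>C\<close> is
  a lift of \<open>c\<close>. Such an element is scalar only if \<open>p\<close> divides \<open>i\<close>, and then the power of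
  \<open>C\<close> can be absorbed because \<open>C\<^sup>p = [X\<^sup>p, Y]\<close> is itself a commutator with \<open>C\<close>.\<close>
lemma coboundary_class3:
  assumes fin: "finite (carrier G)" and p: "Factorial_Ring.prime (p::nat)" "odd p"
    and xy: "x \<in> carrier G" "y \<in> carrier G" and c: "c = com x y" "c \<notin> cen"
    and ccen: "\<And>g. g \<in> carrier G \<Longrightarrow> com c g \<in> cen"
    and cp: "c [^] p \<in> cen" and xp: "x [^] p = c [^] (k::nat) \<otimes> z" "z \<in> cen"
    and gen: "\<And>H. subgroup H G \<Longrightarrow> insert x (insert y cen) \<subseteq> H \<Longrightarrow> carrier G \<subseteq> H"
    and bz: "\<And>z g. z \<in> cen \<Longrightarrow> g \<in> carrier G \<Longrightarrow> beta f z g = 1"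
    and bc: "\<And>g. g \<in> carrier G \<Longrightarrow> c \<otimes> g = g \<otimes> c \<Longrightarrow> beta f c g = 1"
  shows "f \<in> schur_coboundaries G"
proof -
  let ?X = "(x, 1::complex)" and ?Y = "(y, 1::complex)"
  have X: "?X \<in> carrier E" "?Y \<in> carrier E" using xy by auto
  define C where "C = E.com ?X ?Y"
  have C: "C \<in> carrier E" "fst C = c" using X by (auto simp: C_def c fst_com)
  have cG: "c \<in> carrier G" using xy c by simp
  define K where "K = E.com C ` carrier E"
  have Ccen: "E.com C u \<in> group_center E" if u: "u \<in> carrier E" for u
  proof -
    have "fst (E.com C u) \<in> cen" using u C ccen[of "fst u"] by (auto simp: fst_com carrier_E)
    then show ?thesis using u C bz by (intro cen_lift) auto
  qed
  have Kcen: "k \<in> group_center E" if "k \<in> K" for k using Ccen that by (auto simp: K_def)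
  have Kc: "k \<in> carrier E" if "k \<in> K" for k using Kcen[OF that] E.cenD by blast
  have Kmult: "k \<otimes>\<^bsub>E\<^esub> l \<in> K" if kl: "k \<in> K" "l \<in> K" for k l
  proof -
    obtain u v where uv: "u \<in> carrier E" "v \<in> carrier E" "k = E.com C u" "l = E.com C v"
      using kl unfolding K_def by blast
    have "k \<otimes>\<^bsub>E\<^esub> l = E.com C (u \<otimes>\<^bsub>E\<^esub> v)"
      using uv C Ccen by (simp add: E.com_mult_right_cen)
    then show ?thesis using uv unfolding K_def by (metis E.m_closed imageI)
  qed
  have K1: "\<one>\<^bsub>E\<^esub> \<in> K" unfolding K_def using C by (metis E.com_one(1) E.one_closed imageI)
  have Kpow: "k [^]\<^bsub>E\<^esub> (n::nat) \<in> K" if "k \<in> K" for k n by (induction n) (auto simp: K1 Kmult that)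
  have Kinv: "inv\<^bsub>E\<^esub> k \<in> K" if k: "k \<in> K" for k
  proof -
    obtain u where u: "u \<in> carrier E" "k = E.com C u" using k unfolding K_def by blast
    have "E.com C (inv\<^bsub>E\<^esub> u) \<otimes>\<^bsub>E\<^esub> k = E.com C (inv\<^bsub>E\<^esub> u \<otimes>\<^bsub>E\<^esub> u)"
      using u C Ccen by (subst E.com_mult_right_cen) auto
    also have "\<dots> = \<one>\<^bsub>E\<^esub>" using u C by simp
    finally have "inv\<^bsub>E\<^esub> k = E.com C (inv\<^bsub>E\<^esub> u)" using u C by (intro E.inv_equality) auto
    then show ?thesis using u unfolding K_def by auto
  qed
  \<comment> \<open>\<open>v\<close> has order dividing \<open>p\<close> because
    \<open>v^p = [X, C^p]\<close> and \<open>C^p\<close> is central by \<open>bz\<close>. As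
    \<open>p\<close> is odd, the correction term in the formula for \<open>[X^p, Y]\<close>
    disappears; replacing \<open>X^p\<close> by \<open>C^k\<close> times a central lift turns the
    commutator into a power of \<open>[C, Y]\<close>.\<close>
  have Cp: "C [^]\<^bsub>E\<^esub> p \<in> K"
  proof -
    have Cpcen: "C [^]\<^bsub>E\<^esub> p \<in> group_center E"
      using C cp bz by (intro cen_lift) (auto simp: fst_pow)
    have V: "E.com ?X C \<in> group_center E"
      using E.subgroup_cen Ccen[OF X(1)] X C by (intro E.com_sym_mem[of "group_center E" C]) auto
    define v where "v = E.com ?X C"
    have "v [^]\<^bsub>E\<^esub> p = E.com ?X (C [^]\<^bsub>E\<^esub> p)" unfolding v_def using X C V by (simp add: E.com_pow_right_cen)
    then have vp: "v [^]\<^bsub>E\<^esub> p = \<one>\<^bsub>E\<^esub>" using Cpcen X E.com_cen by simp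
    have "2 < p" using p prime_ge_2_nat[of p] by (cases "p = 2") auto
    then have "p dvd (p choose 2)" using p by (intro dvd_choose_prime) auto
    then obtain q where q: "(p choose 2) = p * q" by blast
    have "v [^]\<^bsub>E\<^esub> (p choose 2) = (v [^]\<^bsub>E\<^esub> p) [^]\<^bsub>E\<^esub> q" using V E.cenD by (simp add: q E.nat_pow_pow v_def)
    then have vq: "v [^]\<^bsub>E\<^esub> (p choose 2) = \<one>\<^bsub>E\<^esub>" by (simp add: vp)
    have "E.com (?X [^]\<^bsub>E\<^esub> p) ?Y = C [^]\<^bsub>E\<^esub> p"
      using E.com_pow_left_class3[OF X, of p] V C vq by (simp add: C_def[symmetric] v_def[symmetric])
    moreover have "E.com (?X [^]\<^bsub>E\<^esub> p) ?Y = E.com (C [^]\<^bsub>E\<^esub> k \<otimes>\<^bsub>E\<^esub> (z, 1)) ?Y"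
      using X C xp cenD(1)[OF xp(2)] by (intro com_cong) (auto simp: fst_pow fst_mult)
    moreover have "\<dots> = E.com (C [^]\<^bsub>E\<^esub> k) ?Y"
    proof -
      have zc: "(z, 1) \<in> group_center E" using xp cenD(1)[OF xp(2)] bz by (intro cen_lift) auto
      then show ?thesis using C X cenD(1)[OF xp(2)] E.com_cen(1)[OF zc, of ?Y] 
        by (subst E.com_mult_left_cen) (auto simp: E.subgroup_cen subgroup.one_closed)
    qed
    moreover have "\<dots> = E.com C ?Y [^]\<^bsub>E\<^esub> k" using C X Ccen by (intro E.com_pow_left_cen)
    moreover have "E.com C ?Y \<in> K" using X unfolding K_def by blast
    ultimately show ?thesis using Kpow by metis
  qed
  define S where "S = {s. \<exists>i::nat. \<exists>k\<in>K. s = C [^]\<^bsub>E\<^esub> i \<otimes>\<^bsub>E\<^esub> k}"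
  have CS: "C [^]\<^bsub>E\<^esub> i \<otimes>\<^bsub>E\<^esub> k \<in> S" if "k \<in> K" for k and i :: nat using that unfolding S_def by blast
  have prod: "C [^]\<^bsub>E\<^esub> i \<otimes>\<^bsub>E\<^esub> k \<otimes>\<^bsub>E\<^esub> (C [^]\<^bsub>E\<^esub> j \<otimes>\<^bsub>E\<^esub> l) = C [^]\<^bsub>E\<^esub> (i + j) \<otimes>\<^bsub>E\<^esub> (k \<otimes>\<^bsub>E\<^esub> l)"
    if kl: "k \<in> K" "l \<in> K" for k l and i j :: nat
  proof -
    have kc: "k \<in> carrier E" "l \<in> carrier E" using Kc kl by auto
    have "C [^]\<^bsub>E\<^esub> i \<otimes>\<^bsub>E\<^esub> k \<otimes>\<^bsub>E\<^esub> (C [^]\<^bsub>E\<^esub> j \<otimes>\<^bsub>E\<^esub> l) = C [^]\<^bsub>E\<^esub> i \<otimes>\<^bsub>E\<^esub> (k \<otimes>\<^bsub>E\<^esub> C [^]\<^bsub>E\<^esub> j) \<otimes>\<^bsub>E\<^esub> l"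
      using kc C by (simp add: E.m_assoc)
    also have "k \<otimes>\<^bsub>E\<^esub> C [^]\<^bsub>E\<^esub> j = C [^]\<^bsub>E\<^esub> j \<otimes>\<^bsub>E\<^esub> k" using C E.cenD(2)[OF Kcen[OF kl(1)]] by simp
    finally show ?thesis using kc C by (simp add: E.m_assoc flip: E.nat_pow_mult)
  qed
  have KS: "k \<in> S" if "k \<in> K" for k using CS[OF that, of 0] Kc[OF that] by simp
  have S: "subgroup S E"
  proof
    show "S \<subseteq> carrier E" using Kc C by (auto simp: S_def)
    show "\<one>\<^bsub>E\<^esub> \<in> S" using KS K1 by blast
    fix r s assume "r \<in> S" "s \<in> S"
    then show "r \<otimes>\<^bsub>E\<^esub> s \<in> S" unfolding S_def using prod Kmult by blast
  next
    fix s assume "s \<in> S"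
    then obtain i k where s: "k \<in> K" "s = C [^]\<^bsub>E\<^esub> (i::nat) \<otimes>\<^bsub>E\<^esub> k" unfolding S_def by blast
    have sc: "s \<in> carrier E" using s C Kc by auto
    have kl: "inv\<^bsub>E\<^esub> ((C [^]\<^bsub>E\<^esub> p) [^]\<^bsub>E\<^esub> i) \<otimes>\<^bsub>E\<^esub> inv\<^bsub>E\<^esub> k \<in> K" (is "?l \<in> K") using Kinv Kpow Cp s Kmult by blast
    \<comment> \<open>The inverse gets a nonnegative exponent of \<open>C\<close>: the surplus
      \<open>C^(p i)\<close> lies in \<open>K\<close> and is cancelled by \<open>?l\<close>.\<close>
    have "i + (p - 1) * i = p * i" using prime_gt_0_nat[OF p(1)] by (cases p) auto
    then have "s \<otimes>\<^bsub>E\<^esub> (C [^]\<^bsub>E\<^esub> ((p - 1) * i) \<otimes>\<^bsub>E\<^esub> ?l) = (C [^]\<^bsub>E\<^esub> p) [^]\<^bsub>E\<^esub> i \<otimes>\<^bsub>E\<^esub> (k \<otimes>\<^bsub>E\<^esub> ?l)"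
      unfolding s prod[OF s(1) kl] using C by (simp add: E.nat_pow_pow)
    also have "\<dots> = (C [^]\<^bsub>E\<^esub> p) [^]\<^bsub>E\<^esub> i \<otimes>\<^bsub>E\<^esub> (?l \<otimes>\<^bsub>E\<^esub> k)" using E.cenD(2)[OF Kcen[OF s(1)], of ?l] Kc[OF kl] by simp
    also have "\<dots> = \<one>\<^bsub>E\<^esub>" using C Kc[OF s(1)] by (simp add: E.m_assoc E.cancel_left)
    finally have "inv\<^bsub>E\<^esub> s = C [^]\<^bsub>E\<^esub> ((p - 1) * i) \<otimes>\<^bsub>E\<^esub> ?l"
      using sc C Kc[OF kl] by (intro E.inv_equality E.inv_comm[of s]) auto
    then show "inv\<^bsub>E\<^esub> s \<in> S" using CS kl by simp
  qed
  interpret S: subgroup S E by fact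
  have comCS: "E.com h s \<in> S" if s: "s \<in> S" and h: "h \<in> carrier E" for s h
  proof -
    obtain i k where ik: "k \<in> K" "s = C [^]\<^bsub>E\<^esub> (i::nat) \<otimes>\<^bsub>E\<^esub> k" using s unfolding S_def by blast
    have "E.com s h = E.com (C [^]\<^bsub>E\<^esub> i) h"
      unfolding ik using C Kc[OF ik(1)] h E.com_cen(1)[OF Kcen[OF ik(1)] h]
      by (subst E.com_mult_left_cen) (auto simp: E.subgroup_cen subgroup.one_closed)
    also have "\<dots> = E.com C h [^]\<^bsub>E\<^esub> i" using C h Ccen by (intro E.com_pow_left_cen)
    also have "\<dots> \<in> S" using h by (intro KS Kpow) (auto simp: K_def)
    finally show ?thesis using E.com_sym_mem[OF S] s h by auto
  qed
  have Sn: "S \<lhd> E" by (rule E.normal_of_com[OF S comCS])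
  let ?A = "{u \<in> carrier E. fst u \<in> insert \<one> (insert x (insert y cen))}"
  have bx: "u \<in> group_center E" if "u \<in> carrier E" "fst u \<in> cen" for u
    using that bz by (intro cen_lift)
  have CinS: "C \<in> S" using CS[OF K1, of 1] C by simp
  have XX: "E.com u v \<in> S" if u: "u \<in> ?A" and v: "v \<in> ?A" for u v
  proof -
    have c: "u \<in> carrier E" "v \<in> carrier E" using u v by auto
    have uv: "fst u = x \<or> fst u = y \<or> fst u \<in> cen" "fst v = x \<or> fst v = y \<or> fst v \<in> cen"
      using u v subgroup.one_closed[OF subgroup_cen] by auto
    consider "fst u \<in> cen" | "fst v \<in> cen" | "fst u = fst v" | "fst u = x" "fst v = y" | "fst u = y" "fst v = x"
      using uv by auto
    then show ?thesis
    proof cases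
      case 1
      then show ?thesis using bx[of u] c E.com_cen(1)[of u v] S.one_closed by simp
    next
      case 2
      then show ?thesis using bx[of v] c E.com_cen(2)[of v u] S.one_closed by simp
    next
      case 3
      then show ?thesis using c S.one_closed by (simp add: com_commuting scal_one)
    next
      case 4
      then have "E.com u v = C" unfolding C_def using c X by (intro com_cong) auto
      then show ?thesis using CinS by simp
    next
      case 5
      then have "E.com v u = C" unfolding C_def using c X by (intro com_cong) auto
      then show ?thesis using CinS E.com_sym_mem[OF S, of v u] c by simp
    qed
  qed
  have "E.com u v \<in> S" if uv: "u \<in> carrier E" "v \<in> carrier E" for u v
  proof (rule E.com_mem_of_generators[OF Sn _ _ XX uv])
    show "carrier E \<subseteq> H" if "subgroup H E" "?A \<subseteq> H" for H
      using xy cenD by (intro subgroup_lift[OF gen _ that]) auto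
  qed auto
  then show ?thesis
  proof (rule coboundaryI[OF fin S])
    fix a assume a: "a \<noteq> 0" "scal a \<in> S"
    then obtain i k where s: "k \<in> K" "scal a = C [^]\<^bsub>E\<^esub> (i::nat) \<otimes>\<^bsub>E\<^esub> k" unfolding S_def by blast
    then obtain u where u: "u \<in> carrier E" "k = E.com C u" unfolding K_def by blast
    have uG: "fst u \<in> carrier G" using u by (auto simp: carrier_E)
    have "c [^] i \<otimes> com c (fst u) = fst (scal a)" unfolding s u using u C by (simp add: fst_com fst_pow mult_E)
    then have "c [^] i \<otimes> com c (fst u) = \<one>" by (simp add: scal_def)
    then have "c [^] i = inv (com c (fst u))" using cG uG by (intro inv_equality[symmetric]) auto
    then have ci: "c [^] i \<in> cen" using ccen[OF uG] subgroup.m_inv_closed[OF subgroup_cen] by simp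
    have "p dvd i"
    proof (rule ccontr)
      assume "\<not> p dvd i"
      then have "coprime i p" using p prime_imp_coprime_nat coprime_commute by blast
      then show False using pow_coprime_mem[OF subgroup_cen cG ci cp] c by simp
    qed
    then obtain q where q: "i = p * q" by blast
    have "scal a = (C [^]\<^bsub>E\<^esub> p) [^]\<^bsub>E\<^esub> q \<otimes>\<^bsub>E\<^esub> k" using s C by (simp add: q E.nat_pow_pow)
    then have "scal a \<in> K" using s Cp Kpow Kmult by simp
    then obtain v where v: "v \<in> carrier E" "scal a = E.com C v" unfolding K_def by blast
    have vG: "fst v \<in> carrier G" using v by (auto simp: carrier_E)
    have "com c (fst v) = fst (scal a)" using v C by (simp add: fst_com)
    then have "com c (fst v) = \<one>" by (simp add: scal_def)
    then have cv: "c \<otimes> fst v = fst v \<otimes> c" using cG vG com_eq_one_iff by simp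
    have "scal a = scal (beta f c (fst v))" using v C cv by (simp add: com_commuting)
    then show "a = 1" using bc[OF vG cv] by (simp add: scal_eq_iff)
  qed
qed

end

section \<open>Counting classes of cocycles\<close>

context group
begin

lemma cocycle_mult:
  assumes f: "f \<in> schur_cocycles G" and g: "g \<in> schur_cocycles G"
  shows "(\<lambda>x y. f x y * g x y) \<in> schur_cocycles G"
proof -
  have "f x y * g x y * (f (x \<otimes> y) z * g (x \<otimes> y) z) = f x (y \<otimes> z) * g x (y \<otimes> z) * (f y z * g y z)"
    if "x \<in> carrier G" "y \<in> carrier G" "z \<in> carrier G" for x y z
  proof -
    have "f x y * f (x \<otimes> y) z = f x (y \<otimes> z) * f y z" "g x y * g (x \<otimes> y) z = g x (y \<otimes> z) * g y z"
      using f g that by (simp_all add: schur_cocycles_def)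
    then have "(f x y * f (x \<otimes> y) z) * (g x y * g (x \<otimes> y) z) = (f x (y \<otimes> z) * f y z) * (g x (y \<otimes> z) * g y z)"
      by (rule arg_cong2)
    then show ?thesis by (simp only: ac_simps)
  qed
  then show ?thesis using f g by (simp add: schur_cocycles_def)
qed

lemma cocycle_inverse:
  assumes "f \<in> schur_cocycles G" shows "(\<lambda>x y. 1 / f x y) \<in> schur_cocycles G"
proof -
  have "1 / f x y * (1 / f (x \<otimes> y) z) = 1 / f x (y \<otimes> z) * (1 / f y z)"
    if "x \<in> carrier G" "y \<in> carrier G" "z \<in> carrier G" for x y z
  proof -
    have "f x y * f (x \<otimes> y) z = f x (y \<otimes> z) * f y z" using assms that by (simp add: schur_cocycles_def)
    then show ?thesis by simp
  qed
  then show ?thesis using assms by (simp add: schur_cocycles_def)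
qed

lemma cocycle_divide:
  "f \<in> schur_cocycles G \<Longrightarrow> g \<in> schur_cocycles G \<Longrightarrow> (\<lambda>x y. f x y / g x y) \<in> schur_cocycles G"
  using cocycle_mult[OF _ cocycle_inverse, of f g] by simp

lemma comm_group_cocycle_group: "comm_group (cocycle_group G)"
proof (rule comm_groupI)
  fix f assume f: "f \<in> carrier (cocycle_group G)"
  then have "(\<lambda>x y. 1 / f x y) \<in> carrier (cocycle_group G)"
    by (simp add: cocycle_group_def cocycle_inverse)
  moreover have "(\<lambda>x y. 1 / f x y) \<otimes>\<^bsub>cocycle_group G\<^esub> f = \<one>\<^bsub>cocycle_group G\<^esub>"
    using f by (simp add: cocycle_group_def schur_cocycles_def)
  ultimately show "\<exists>g\<in>carrier (cocycle_group G). g \<otimes>\<^bsub>cocycle_group G\<^esub> f = \<one>\<^bsub>cocycle_group G\<^esub>" by blast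
next
  show "\<one>\<^bsub>cocycle_group G\<^esub> \<in> carrier (cocycle_group G)"
    by (simp add: cocycle_group_def schur_cocycles_def)
qed (simp_all add: cocycle_group_def cocycle_mult fun_eq_iff)

lemma inv_cocycle_group:
  assumes "f \<in> schur_cocycles G" shows "inv\<^bsub>cocycle_group G\<^esub> f = (\<lambda>x y. 1 / f x y)"
proof -
  interpret Z: comm_group "cocycle_group G" by (rule comm_group_cocycle_group)
  show ?thesis
    using assms by (intro Z.inv_equality) (auto simp: cocycle_group_def cocycle_inverse schur_cocycles_def)
qed

lemma subgroup_coboundaries: "subgroup (schur_coboundaries G) (cocycle_group G)"
proof -
  interpret Z: comm_group "cocycle_group G" by (rule comm_group_cocycle_group)
  have sub: "schur_coboundaries G \<subseteq> schur_cocycles G"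
  proof
    fix f assume "f \<in> schur_coboundaries G"
    then obtain g where g: "\<forall>x\<in>carrier G. g x \<noteq> 0"
      "f = (\<lambda>x y. if x \<in> carrier G \<and> y \<in> carrier G then g x * g y / g (x \<otimes> y) else 1)"
      unfolding schur_coboundaries_def by blast
    then show "f \<in> schur_cocycles G" by (auto simp: schur_cocycles_def m_assoc)
  qed
  show ?thesis
  proof
    show "schur_coboundaries G \<subseteq> carrier (cocycle_group G)" using sub by (simp add: cocycle_group_def)
    show "\<one>\<^bsub>cocycle_group G\<^esub> \<in> schur_coboundaries G"
      unfolding schur_coboundaries_def cocycle_group_def
      by (rule CollectI, rule exI[of _ "\<lambda>_. 1"]) (auto simp: fun_eq_iff)
  next
    fix f g assume "f \<in> schur_coboundaries G" "g \<in> schur_coboundaries G"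
    then obtain a b where ab: "\<forall>x\<in>carrier G. a x \<noteq> 0"
      "f = (\<lambda>x y. if x \<in> carrier G \<and> y \<in> carrier G then a x * a y / a (x \<otimes> y) else 1)"
      "\<forall>x\<in>carrier G. b x \<noteq> 0"
      "g = (\<lambda>x y. if x \<in> carrier G \<and> y \<in> carrier G then b x * b y / b (x \<otimes> y) else 1)"
      unfolding schur_coboundaries_def by blast
    show "f \<otimes>\<^bsub>cocycle_group G\<^esub> g \<in> schur_coboundaries G"
      unfolding schur_coboundaries_def cocycle_group_def
      by (rule CollectI, rule exI[of _ "\<lambda>x. a x * b x"]) (use ab in \<open>auto simp: fun_eq_iff\<close>)
  next
    fix f assume f: "f \<in> schur_coboundaries G"
    then obtain a where ab: "\<forall>x\<in>carrier G. a x \<noteq> 0"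
      "f = (\<lambda>x y. if x \<in> carrier G \<and> y \<in> carrier G then a x * a y / a (x \<otimes> y) else 1)"
      unfolding schur_coboundaries_def by blast
    have "inv\<^bsub>cocycle_group G\<^esub> f = (\<lambda>x y. 1 / f x y)" using f sub by (intro inv_cocycle_group) auto
    also have "\<dots> \<in> schur_coboundaries G"
      unfolding schur_coboundaries_def
      by (rule CollectI, rule exI[of _ "\<lambda>x. 1 / a x"]) (use ab in \<open>auto simp: fun_eq_iff\<close>)
    finally show "inv\<^bsub>cocycle_group G\<^esub> f \<in> schur_coboundaries G" .
  qed
qed

lemma coset_eq_iff_coboundary:
  assumes f: "f \<in> schur_cocycles G" and g: "g \<in> schur_cocycles G"
  shows "schur_coboundaries G #>\<^bsub>cocycle_group G\<^esub> f = schur_coboundaries G #>\<^bsub>cocycle_group G\<^esub> g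
    \<longleftrightarrow> (\<lambda>x y. f x y / g x y) \<in> schur_coboundaries G"
proof -
  interpret Z: comm_group "cocycle_group G" by (rule comm_group_cocycle_group)
  interpret B: subgroup "schur_coboundaries G" "cocycle_group G" by (rule subgroup_coboundaries)
  have c: "f \<in> carrier (cocycle_group G)" "g \<in> carrier (cocycle_group G)" using f g by (auto simp: cocycle_group_def)
  have "f \<otimes>\<^bsub>cocycle_group G\<^esub> inv\<^bsub>cocycle_group G\<^esub> g = (\<lambda>x y. f x y / g x y)"
    using g by (simp add: inv_cocycle_group) (simp add: cocycle_group_def)
  then have "(\<lambda>x y. f x y / g x y) \<in> schur_coboundaries G \<longleftrightarrow> f \<in> schur_coboundaries G #>\<^bsub>cocycle_group G\<^esub> g"
    using B.rcos_module[OF Z.group_axioms c(2,1)] by simp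
  also have "\<dots> \<longleftrightarrow> schur_coboundaries G #>\<^bsub>cocycle_group G\<^esub> f = schur_coboundaries G #>\<^bsub>cocycle_group G\<^esub> g"
    using Z.repr_independence[OF _ c(2) subgroup_coboundaries] Z.rcos_self[OF c(1) subgroup_coboundaries] by auto
  finally show ?thesis by blast
qed

lemma carrier_schur_multiplier:
  "carrier (schur_multiplier G) = (\<lambda>f. schur_coboundaries G #>\<^bsub>cocycle_group G\<^esub> f) ` schur_cocycles G"
  by (simp add: schur_multiplier_def carrier_FactGroup) (simp add: cocycle_group_def)

text \<open>Finiteness of the multiplier is left open: \<open>order\<close> is 0 for an infinite
  carrier, and 0 excludes the value \<open>p^5\<close> as well as a large order does.\<close>

lemma order_schur_multiplier_ge:
  assumes F: "\<And>r. r \<in> R \<Longrightarrow> F r \<in> schur_cocycles G"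
    and inj: "\<And>r s. r \<in> R \<Longrightarrow> s \<in> R \<Longrightarrow> (\<lambda>x y. F r x y / F s x y) \<in> schur_coboundaries G \<Longrightarrow> r = s"
  shows "order (schur_multiplier G) = 0 \<or> card R \<le> order (schur_multiplier G)"
proof (cases "finite (carrier (schur_multiplier G))")
  case True
  have "inj_on (\<lambda>r. schur_coboundaries G #>\<^bsub>cocycle_group G\<^esub> F r) R"
    using F inj coset_eq_iff_coboundary by (intro inj_onI) blast
  then show ?thesis unfolding order_def
    using F True by (intro disjI2 card_inj_on_le) (auto simp: carrier_schur_multiplier)
qed (simp add: order_def)

text \<open>A class is determined by the values of \<open>beta\<close> on the listed pairs, since a
  quotient of two cocycles with equal values falls under \<open>triv\<close>. If two cocycles agree
  on the first \<open>i\<close> pairs, \<open>step\<close> for their quotient shows that the next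
  values differ by a p-th root of unity, which leaves at most \<open>p\<close> choices. So the
  condition at a pair may presuppose trivial values at the earlier pairs, and the order of the list
  matters.\<close>

lemma order_schur_multiplier_le:
  assumes p: "p > 0"
    and step: "\<And>f i. f \<in> schur_cocycles G \<Longrightarrow> i < length ps \<Longrightarrow>
      (\<And>j. j < i \<Longrightarrow> beta f (fst (ps ! j)) (snd (ps ! j)) = 1) \<Longrightarrow> beta f (fst (ps ! i)) (snd (ps ! i)) ^ p = 1"
    and triv: "\<And>f. f \<in> schur_cocycles G \<Longrightarrow>
      (\<And>j. j < length ps \<Longrightarrow> beta f (fst (ps ! j)) (snd (ps ! j)) = 1) \<Longrightarrow> f \<in> schur_coboundaries G"
  shows "order (schur_multiplier G) \<le> p ^ length ps"
proof -
  define b where "b f i = beta f (fst (ps ! i)) (snd (ps ! i))" for f i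
  define D where "D n f = map (b f) [0..<n]" for n f
  have bdiv: "b (\<lambda>x y. f x y / g x y) i = b f i / b g i" for f g i by (simp add: b_def beta_def)
  have bnz: "b f i \<noteq> 0" if "f \<in> schur_cocycles G" for f i
    using that by (simp add: b_def beta_def schur_cocycles_def)
  have D_eq: "b f i = b g i" if "D n f = D n g" "i < n" for n f g i
    using that by (auto simp: D_def)
  have bound: "finite (D n ` schur_cocycles G) \<and> card (D n ` schur_cocycles G) \<le> p ^ n" if "n \<le> length ps" for n
    using that
  proof (induction n)
    case 0
    have "D 0 ` schur_cocycles G \<subseteq> {[]}" by (auto simp: D_def)
    then show ?case using card_mono[of "{[]}" "D 0 ` schur_cocycles G"] finite_subset by auto
  next
    case (Suc n)
    \<comment> \<open>The values at the next pair that are compatible with the prefix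
      \<open>d\<close>; they lie in one coset of the p-th roots of unity.\<close>
    define V where "V d = {b f n | f. f \<in> schur_cocycles G \<and> D n f = d}" for d
    have V: "finite (V d) \<and> card (V d) \<le> p" if d: "d \<in> D n ` schur_cocycles G" for d
    proof -
      obtain g where g: "g \<in> schur_cocycles G" "d = D n g" using d by blast
      have "V d \<subseteq> (\<lambda>w. w * b g n) ` {w. w ^ p = 1}"
      proof
        fix v assume "v \<in> V d"
        then obtain f where f: "f \<in> schur_cocycles G" "D n f = D n g" "v = b f n" using g by (auto simp: V_def)
        have "b (\<lambda>x y. f x y / g x y) n ^ p = 1"
          unfolding b_def
        proof (rule step[OF cocycle_divide[OF f(1) g(1)]])
          fix j assume "j < n"
          then show "beta (\<lambda>x y. f x y / g x y) (fst (ps ! j)) (snd (ps ! j)) = 1"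
            using bdiv[of f g j] D_eq[OF f(2)] bnz[OF g(1), of j] by (simp add: b_def)
        qed (use Suc.prems in simp)
        then have "(b f n / b g n) ^ p = 1" by (simp add: bdiv)
        moreover have "v = b f n / b g n * b g n" using f bnz[OF g(1)] by simp
        ultimately show "v \<in> (\<lambda>w. w * b g n) ` {w. w ^ p = 1}" by blast
      qed
      moreover have "finite {w::complex. w ^ p = 1}" using p by (intro finite_roots_unity) auto
      moreover have "card {w::complex. w ^ p = 1} = p" using p by (rule card_roots_unity_eq)
      ultimately show ?thesis
        by (metis card_image_le card_mono finite_imageI finite_subset order_trans)
    qed
    have sub: "D (Suc n) ` schur_cocycles G \<subseteq> (\<Union>d\<in>D n ` schur_cocycles G. (\<lambda>v. d @ [v]) ` V d)"
      by (auto simp: D_def V_def)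
    have fin: "finite (D n ` schur_cocycles G)" and card: "card (D n ` schur_cocycles G) \<le> p ^ n"
      using Suc by auto
    have finU: "finite (\<Union>d\<in>D n ` schur_cocycles G. (\<lambda>v. d @ [v]) ` V d)" using fin V by blast
    have "card (\<Union>d\<in>D n ` schur_cocycles G. (\<lambda>v. d @ [v]) ` V d)
        \<le> (\<Sum>d\<in>D n ` schur_cocycles G. card ((\<lambda>v. d @ [v]) ` V d))"
      by (rule card_UN_le[OF fin])
    also have "\<dots> \<le> (\<Sum>d\<in>D n ` schur_cocycles G. p)"
      using V by (intro sum_mono) (meson card_image_le order_trans)
    also have "\<dots> \<le> p ^ Suc n" using card by simp
    finally show ?case using card_mono[OF finU sub] finite_subset[OF sub finU] by simp
  qed
  define c where "c f = schur_coboundaries G #>\<^bsub>cocycle_group G\<^esub> f" for f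
  have c_eq: "c f = c g" if fg: "f \<in> schur_cocycles G" "g \<in> schur_cocycles G" "D (length ps) f = D (length ps) g" for f g
  proof -
    have "(\<lambda>x y. f x y / g x y) \<in> schur_coboundaries G"
    proof (rule triv[OF cocycle_divide[OF fg(1,2)]])
      fix j assume "j < length ps"
      then show "beta (\<lambda>x y. f x y / g x y) (fst (ps ! j)) (snd (ps ! j)) = 1"
        using bdiv[of f g j] D_eq[OF fg(3)] bnz[OF fg(2), of j] by (simp add: b_def)
    qed
    then show ?thesis using coset_eq_iff_coboundary fg unfolding c_def by blast
  qed
  define h where "h d = c (SOME f. f \<in> schur_cocycles G \<and> D (length ps) f = d)" for d
  have "c ` schur_cocycles G \<subseteq> h ` (D (length ps) ` schur_cocycles G)"
  proof
    fix C assume "C \<in> c ` schur_cocycles G"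
    then obtain f where f: "f \<in> schur_cocycles G" "C = c f" by blast
    then have "\<exists>g. g \<in> schur_cocycles G \<and> D (length ps) g = D (length ps) f" by blast
    from someI_ex[OF this] have "h (D (length ps) f) = c f" unfolding h_def using c_eq f by blast
    then show "C \<in> h ` (D (length ps) ` schur_cocycles G)" using f by (metis imageI)
  qed
  then have "card (c ` schur_cocycles G) \<le> card (D (length ps) ` schur_cocycles G)"
    using bound[of "length ps"] by (meson card_image_le card_mono finite_imageI order_refl order_trans)
  then show ?thesis using bound[of "length ps"]
    unfolding order_def carrier_schur_multiplier c_def[symmetric] by simp
qed

end

section \<open>Groups of prime power order\<close>

context group
begin

lemma normal_of_subset_cen: "subgroup K G \<Longrightarrow> K \<subseteq> cen \<Longrightarrow> K \<lhd> G"
proof (rule normal_of_com)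
  fix k h assume "K \<subseteq> cen" "subgroup K G" "k \<in> K" "h \<in> carrier G"
  then have "k \<in> cen" "\<one> \<in> K" using subgroup.one_closed by blast+
  then show "com h k \<in> K" using com_cen(2)[of k h] \<open>h \<in> carrier G\<close> by simp
qed

lemma subgroup_centralizer: "x \<in> carrier G \<Longrightarrow> subgroup {g \<in> carrier G. com g x = \<one>} G"
  using subgroup_com_mod[OF one_is_normal, of x] by simp

lemma card_image_mult_card_kernel:
  assumes A: "subgroup A G" and H: "group H" and im: "\<And>a. a \<in> A \<Longrightarrow> h a \<in> carrier H"
    and hom: "\<And>a b. a \<in> A \<Longrightarrow> b \<in> A \<Longrightarrow> h (a \<otimes> b) = h a \<otimes>\<^bsub>H\<^esub> h b"
  shows "card (h ` A) * card {a \<in> A. h a = \<one>\<^bsub>H\<^esub>} = card A"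
proof -
  let ?A = "G\<lparr>carrier := A\<rparr>"
  interpret A: group ?A using A subgroup_imp_group by blast
  have hh: "group_hom ?A H h"
    using H im hom by (auto simp: group_hom_def group_hom_axioms_def hom_def A.group_axioms)
  interpret gh: group_hom ?A H h by (fact hh)
  let ?H = "H\<lparr>carrier := h ` A\<rparr>"
  have "group ?H" using group.subgroup_imp_group[OF H gh.img_is_subgroup] by simp
  then have hh': "group_hom ?A ?H h"
    using hom by (auto simp: group_hom_def group_hom_axioms_def hom_def A.group_axioms)
  interpret gh': group_hom ?A ?H h by (fact hh')
  have k: "kernel ?A ?H h = {a \<in> A. h a = \<one>\<^bsub>H\<^esub>}" by (simp add: kernel_def)
  have "card (rcosets\<^bsub>?A\<^esub> (kernel ?A ?H h)) * card (kernel ?A ?H h) = card A"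
    using A.lagrange[OF gh'.subgroup_kernel] by (simp add: order_def)
  then have lag: "card (rcosets\<^bsub>?A\<^esub> (kernel ?A ?H h)) * card {a \<in> A. h a = \<one>\<^bsub>H\<^esub>} = card A"
    by (simp only: k)
  have "(\<lambda>W. the_elem (h ` W)) \<in> iso (?A Mod (kernel ?A ?H h)) ?H"
    by (rule gh'.FactGroup_iso_set) simp
  then have bij: "bij_betw (\<lambda>W. the_elem (h ` W)) (rcosets\<^bsub>?A\<^esub> (kernel ?A ?H h)) (h ` A)"
    by (simp add: iso_def FactGroup_def)
  show ?thesis using lag unfolding bij_betw_same_card[OF bij] .
qed

end

locale prime_power_group = group G for G (structure) +
  fixes p n :: nat
  assumes p: "Factorial_Ring.prime p" and order_G: "order G = p ^ n"
begin

lemma p_gt1: "p > 1" using p prime_gt_1_nat by blast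

lemma finite_G: "finite (carrier G)"
  using order_G p_gt1 order_gt_0_iff_finite by simp

lemma finite_subgroup: "subgroup H G \<Longrightarrow> finite H"
  using finite_G subgroup.subset finite_subset by metis

lemma card_subgroup_power:
  assumes "subgroup H G" shows "\<exists>k\<le>n. card H = p ^ k"
proof -
  have "card H dvd p ^ n" using lagrange[OF assms] order_G by (metis dvd_triv_right)
  then show ?thesis using p divides_primepow_nat by blast
qed

lemma card_psubset_subgroup:
  assumes B: "subgroup B G" and H: "subgroup H G" and BH: "B \<subset> H"
  shows "p * card B \<le> card H"
proof -
  obtain j k where jk: "card B = p ^ j" "card H = p ^ k" using card_subgroup_power B H by blast
  have "card B < card H" using psubset_card_mono[OF finite_subgroup[OF H] BH] .
  then have "j < k" using jk p_gt1 by (simp add: power_strict_increasing_iff)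
  then have "p ^ Suc j \<le> p ^ k" using p_gt1 by (intro power_increasing) auto
  then show ?thesis using jk by simp
qed

text \<open>Orders of subgroups are powers of \<open>p\<close>, so each strict inclusion gains a
  factor \<open>p\<close>. Many subgroups below are identified by climbing such chains.\<close>

lemma card_subgroup_ge_Suc:
  assumes B: "subgroup B G" and H: "subgroup H G" and BH: "B \<subseteq> H" and g: "g \<in> H" "g \<notin> B"
    and k: "p ^ k \<le> card B"
  shows "p ^ Suc k \<le> card H"
proof -
  have "p * card B \<le> card H" using card_psubset_subgroup[OF B H] BH g by blast
  then show ?thesis using k by (metis mult_le_mono2 order_trans power_Suc)
qed

lemma subgroup_eqI:
  assumes "subgroup H G" "B \<subseteq> H" "card H \<le> card B" shows "B = H"
  using assms finite_subgroup card_seteq by blast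

lemma carrier_eqI: "subgroup H G \<Longrightarrow> p ^ n \<le> card H \<Longrightarrow> H = carrier G"
  using card_seteq[OF finite_G, of H] order_G subgroup.subset[of H G] unfolding order_def by simp

text \<open>By \<open>big\<close> the subgroup generated by \<open>A\<close> has index at most
  \<open>p\<close> in \<open>T\<close>, so any element of \<open>T\<close> outside it supplies the
  rest. If nothing is outside, \<open>\<one>\<close> serves.\<close>

lemma generator_exists:
  assumes T: "subgroup T G" and card: "card T \<le> p ^ Suc k" and X: "A \<subseteq> T"
    and big: "\<And>H. subgroup H G \<Longrightarrow> A \<subseteq> H \<Longrightarrow> p ^ k \<le> card H"
  shows "\<exists>t\<in>T. \<forall>H. subgroup H G \<longrightarrow> insert t A \<subseteq> H \<longrightarrow> T \<subseteq> H"
proof -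
  have Ac: "A \<subseteq> carrier G" using X T subgroup.subset by blast
  define B where "B = generate G A"
  have B: "subgroup B G" "A \<subseteq> B" "\<And>H. subgroup H G \<Longrightarrow> A \<subseteq> H \<Longrightarrow> B \<subseteq> H"
    unfolding B_def
    by (simp_all add: generate_is_subgroup[OF Ac] generate_subgroup_incl generate.incl subsetI)
  show ?thesis
  proof (cases "T \<subseteq> B")
    case True
    then show ?thesis using B subgroup.one_closed[OF T] by blast
  next
    case False
    then obtain t where t: "t \<in> T" "t \<notin> B" by blast
    have "T \<subseteq> H" if H: "subgroup H G" "insert t A \<subseteq> H" for H
    proof -
      have HT: "subgroup (H \<inter> T) G" using H T subgroups_Inter_pair by blast
      have "p ^ Suc k \<le> card (H \<inter> T)"
      proof (rule card_subgroup_ge_Suc[OF B(1) HT])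
        show "B \<subseteq> H \<inter> T" using B(3)[OF H(1)] B(3)[OF T X] H(2) by blast
        show "p ^ k \<le> card B" by (rule big[OF B(1,2)])
      qed (use t H in auto)
      then have "H \<inter> T = T" using T card by (intro subgroup_eqI) auto
      then show ?thesis by blast
    qed
    then show ?thesis using t by blast
  qed
qed

text \<open>Class equation: were the centre trivial, every conjugacy class other than that of
  \<open>\<one>\<close> would have size divisible by \<open>p\<close>, and \<open>p\<close> would
  divide 1.\<close>

lemma nontrivial_center:
  assumes n: "n > 0" shows "\<exists>z\<in>cen. z \<noteq> \<one>"
proof (rule ccontr)
  assume "\<not> (\<exists>z\<in>cen. z \<noteq> \<one>)"
  then have triv: "x = \<one>" if "x \<in> cen" for x using that by blast
  define \<phi> where "\<phi> g = (\<lambda>h \<in> carrier G. g \<otimes> h \<otimes> inv g)" for g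
  interpret act: group_action G "carrier G" \<phi> unfolding \<phi>_def by (rule action_by_conjugation)
  let ?O = "orbits G (carrier G) \<phi>"
  have cov: "\<Union> ?O = carrier G" by (rule act.orbits_coverture)
  then have finO: "finite ?O" using finite_G by (metis finite_UnionD)
  have orb1: "orbit G \<phi> \<one> = {\<one>}" by (auto simp: orbit_def \<phi>_def intro!: exI[of _ \<one>])
  have mem1: "{\<one>} \<in> ?O" unfolding orbits_def using orb1 by (metis (mono_tags, lifting) mem_Collect_eq one_closed)
  have pd: "p dvd card B" if B: "B \<in> ?O - {{\<one>}}" for B
  proof -
    obtain x where x: "x \<in> carrier G" "B = orbit G \<phi> x" using B unfolding orbits_def by blast
    have eq: "card B * card (stabilizer G \<phi> x) = p ^ n"
      using act.orbit_stabilizer_theorem[OF x(1)] x order_G by simp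
    then have "card B dvd p ^ n" by (metis dvd_triv_left)
    then obtain k where k: "card B = p ^ k" using p divides_primepow_nat by blast
    have "k \<noteq> 0"
    proof
      assume "k = 0"
      then have "card (stabilizer G \<phi> x) = order G" using eq k order_G by simp
      then have "stabilizer G \<phi> x = carrier G"
        using act.stabilizer_subset[of x] finite_G card_seteq unfolding order_def by (metis order_refl)
      then have st: "g \<otimes> x \<otimes> inv g = x" if "g \<in> carrier G" for g
        using that x unfolding stabilizer_def \<phi>_def by auto
      have "x \<otimes> g = g \<otimes> x" if g: "g \<in> carrier G" for g
      proof -
        have "x \<otimes> g = g \<otimes> x \<otimes> inv g \<otimes> g" by (simp add: st[OF g])
        then show ?thesis using g x by (simp add: m_assoc)
      qed
      then have "x = \<one>" using triv cenI x by blast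
      then show False using B x orb1 by blast
    qed
    then show ?thesis using k by simp
  qed
  have "(\<Sum>B\<in>?O. card B) = card (carrier G)"
    using act.disjoint_sum[OF finite_G, of "\<lambda>_. 1::nat"] by simp
  also have "(\<Sum>B\<in>?O. card B) = card {\<one>} + (\<Sum>B\<in>?O - {{\<one>}}. card B)"
    using finO mem1 by (rule sum.remove)
  finally have "1 + (\<Sum>B\<in>?O - {{\<one>}}. card B) = p ^ n" using order_G by (simp add: order_def)
  moreover have "p dvd (\<Sum>B\<in>?O - {{\<one>}}. card B)" using pd by (intro dvd_sum) blast
  moreover have "p dvd p ^ n" using n by simp
  ultimately have "p dvd 1" by (metis dvd_add_left_iff)
  then show False using p_gt1 by simp
qed

end

context group
begin

lemma quotient_com_mem:
  assumes K: "K \<lhd> G" and gh: "g \<in> carrier G" "h \<in> carrier G"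
    and eq: "(K #> g) <#> (K #> h) = (K #> h) <#> (K #> g)"
  shows "com g h \<in> K"
proof -
  interpret K: normal K G by fact
  have "K #> (g \<otimes> h) = K #> (h \<otimes> g)" using eq gh by (simp add: K.rcos_sum)
  then have "g \<otimes> h \<in> K #> (h \<otimes> g)" using gh rcos_self[OF _ K.subgroup_axioms, of "g \<otimes> h"] by simp
  then have "g \<otimes> h \<otimes> inv (h \<otimes> g) \<in> K" using gh K.rcos_module[OF group_axioms] by simp
  then show ?thesis using gh by (simp add: word_simps)
qed

end

context prime_power_group
begin

text \<open>A nontrivial central element of the p-group \<open>G Mod K\<close> is pulled
  back.\<close>

lemma com_center_psubset:
  assumes K: "K \<lhd> G" and ne: "K \<noteq> carrier G"
  shows "K \<subset> com_center K"
proof -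
  interpret K: normal K G by fact
  have sub: "subgroup K G" by (rule K.subgroup_axioms)
  have lag: "card (rcosets K) * card K = p ^ n" using lagrange[OF sub] order_G by simp
  then obtain m where m: "card (rcosets K) = p ^ m" using p divides_primepow_nat by (metis dvd_triv_left)
  have "card K < p ^ n"
    using ne psubset_card_mono[OF finite_G, of K] K.subset order_G unfolding order_def by auto
  then have m0: "m > 0" using m lag by (cases m) auto
  interpret Q: prime_power_group "G Mod K" p m
    using K.factorgroup_is_group p m
    by (auto simp: prime_power_group_def prime_power_group_axioms_def order_def FactGroup_def)
  obtain W where W: "W \<in> group_center (G Mod K)" "W \<noteq> K" using Q.nontrivial_center[OF m0] by auto
  then obtain g where g: "g \<in> carrier G" "W = K #> g" using Q.cenD(1)[OF W(1)] by (auto simp: carrier_FactGroup)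
  have "g \<notin> K" using g W coset_join2[OF g(1) sub] by blast
  moreover have "com g h \<in> K" if h: "h \<in> carrier G" for h
  proof (rule quotient_com_mem[OF K g(1) h])
    have "K #> h \<in> carrier (G Mod K)" using h by (simp add: carrier_FactGroup)
    from Q.cenD(2)[OF W(1) this] show "K #> g <#> (K #> h) = K #> h <#> (K #> g)" by (simp add: g)
  qed
  ultimately show ?thesis using g normal_subset_com_center[OF K] by (auto simp: com_center_def)
qed

text \<open>A centre never has index \<open>p\<close>: modulo \<open>K\<close>, the centralizer of
  an element outside the centre contains both the centre and that element, so it would be
  everything, and the element would be central after all.\<close>

lemma com_center_index:
  assumes K: "K \<lhd> G" and big: "p ^ n \<le> p * card (com_center K)"
  shows "com_center K = carrier G"
proof (rule ccontr)
  assume ne: "com_center K \<noteq> carrier G"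
  have sub: "subgroup (com_center K) G" by (rule subgroup_com_center[OF K])
  then obtain g where g: "g \<in> carrier G" "g \<notin> com_center K" using ne subgroup.subset by blast
  let ?D = "{h \<in> carrier G. com h g \<in> K}"
  have D: "subgroup ?D G" by (rule subgroup_com_mod[OF K g(1)])
  have "com_center K \<subseteq> ?D" using g by (auto simp: com_center_def)
  moreover have "g \<in> ?D" using g subgroup.one_closed[OF normal_imp_subgroup[OF K]] by simp
  ultimately have "p * card (com_center K) \<le> card ?D"
    using g by (intro card_psubset_subgroup[OF sub D]) blast
  then have "?D = carrier G" using big by (intro carrier_eqI[OF D]) simp
  then have "com g h \<in> K" if "h \<in> carrier G" for h
    using that g com_sym_mem[OF normal_imp_subgroup[OF K], of h g] by blast
  then show False using g by (auto simp: com_center_def)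
qed

lemma pow_p_mem:
  assumes H: "subgroup H G" and K: "K \<lhd> G" and KH: "K \<subseteq> H" and card: "card H = p * card K" and g: "g \<in> H"
  shows "g [^] p \<in> K"
proof -
  let ?H = "G\<lparr>carrier := H\<rparr>"
  interpret K: normal K G by fact
  interpret H: group ?H using H subgroup_imp_group by blast
  have sub: "subgroup K ?H" using K.subgroup_axioms H KH subgroup_incl by blast
  have nK: "K \<lhd> ?H" using normal_restrict_supergroup[OF H K KH] .
  interpret KH: normal K ?H by fact
  have "card (rcosets\<^bsub>?H\<^esub> K) * card K = p * card K" using H.lagrange[OF sub] card by (simp add: order_def)
  moreover have "card K \<noteq> 0" using finite_subgroup[OF K.subgroup_axioms] K.one_closed by (metis card_0_eq empty_iff)
  ultimately have c: "order (?H Mod K) = p" by (simp add: order_def FactGroup_def)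
  interpret Q: group "?H Mod K" by (rule KH.factorgroup_is_group)
  have mem: "K #>\<^bsub>?H\<^esub> g \<in> carrier (?H Mod K)" using g by (simp add: carrier_FactGroup)
  have "(K #>\<^bsub>?H\<^esub> g) [^]\<^bsub>?H Mod K\<^esub> p = K" using Q.pow_order_eq_1[OF mem] c by simp
  then have "K #>\<^bsub>?H\<^esub> (g [^]\<^bsub>?H\<^esub> p) = K" using KH.FactGroup_pow[of g p] g by simp
  then have "g [^]\<^bsub>?H\<^esub> p \<in> K" using H.coset_join1[OF _ _ sub] g sub H.nat_pow_closed[of g p] subgroup.subset[OF sub] by simp
  then show ?thesis by (simp add: nat_pow_consistent[symmetric])
qed

text \<open>The cosets of \<open>K\<close> by \<open>c^k\<close> with \<open>k < p\<close> are
  disjoint, since \<open>c^p\<close> together with a power of coprime exponent in \<open>K\<close>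
  would put \<open>c\<close> into \<open>K\<close>; counting does the rest.\<close>

lemma index_p_representation:
  assumes H: "subgroup H G" and K: "K \<lhd> G" and KH: "K \<subseteq> H" and card: "card H = p * card K"
    and c: "c \<in> H" "c \<notin> K" and h: "h \<in> H"
  shows "\<exists>k::nat. \<exists>z\<in>K. h = c [^] k \<otimes> z"
proof -
  interpret K: normal K G by fact
  interpret H: subgroup H G by fact
  have cp: "c [^] p \<in> K" by (rule pow_p_mem[OF H K KH card c(1)])
  have cG: "c \<in> carrier G" using c by simp
  let ?f = "\<lambda>(k, z). c [^] (k::nat) \<otimes> z"
  have wlog: "k = l" if "k \<le> l" "l < p" "z \<in> K" "z' \<in> K" "c [^] k \<otimes> z = c [^] l \<otimes> z'" for k l :: nat and z z'
  proof (rule ccontr)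
    assume "k \<noteq> l"
    have zz: "z \<in> carrier G" "z' \<in> carrier G" using that by auto
    have "c [^] k \<otimes> z = c [^] k \<otimes> (c [^] (l - k) \<otimes> z')"
      using that zz cG by (simp add: nat_pow_mult flip: m_assoc)
    then have "z = c [^] (l - k) \<otimes> z'" using zz cG by simp
    then have "c [^] (l - k) = z \<otimes> inv z'" using zz cG by (simp add: m_assoc)
    then have "c [^] (l - k) \<in> K" using that by simp
    moreover have "\<not> p dvd (l - k)" using that \<open>k \<noteq> l\<close> by (auto dest: dvd_imp_le)
    then have "coprime p (l - k)" using p prime_imp_coprime_nat by blast
    ultimately show False using pow_coprime_mem[OF K.subgroup_axioms cG cp] c by blast
  qed
  have inj: "inj_on ?f ({..<p} \<times> K)"
  proof (rule inj_onI, clarify)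
    fix k z l z' assume *: "k < p" "z \<in> K" "l < p" "z' \<in> K" "c [^] k \<otimes> z = c [^] l \<otimes> z'"
    have kl: "k = l"
      using wlog[of k l z z'] wlog[of l k z' z] * by (metis nat_le_linear)
    have "z \<in> carrier G" "z' \<in> carrier G" using * by auto
    then show "k = l \<and> z = z'" using * kl cG by simp
  qed
  have sub: "?f ` ({..<p} \<times> K) \<subseteq> H" using c KH pow_mem_subgroup[OF H] by auto
  have "card (?f ` ({..<p} \<times> K)) = card H" using card_image[OF inj] card by (simp add: card_cartesian_product)
  then have "?f ` ({..<p} \<times> K) = H" using sub by (intro subgroup_eqI[OF H]) auto
  then have "h \<in> ?f ` ({..<p} \<times> K)" using h by simp
  then show ?thesis by auto
qed

end

section \<open>Groups of class three\<close>

lemma (in group) com_mem_subgroup: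
  "subgroup H G \<Longrightarrow> x \<in> H \<Longrightarrow> y \<in> H \<Longrightarrow> com x y \<in> H"
  by (simp add: com_def subgroup.m_closed subgroup.m_inv_closed)

lemma (in schur_ext) com_in_bker_cen:
  assumes "z \<in> cen" "g \<in> carrier G" "h \<in> carrier G" "com g h \<in> cen"
  shows "z \<in> bker (com g h)"
  using beta_cen_com[OF assms(1-3)] bker_sym[of z "com g h"] cenD(1) assms by blast

locale order_p5 = prime_power_group G p 5 for G (structure) and p +
  assumes odd_p: "odd p" and card_cen: "card cen = p ^ 2"
begin

lemma card_G: "card (carrier G) = p ^ 5"
  using order_G by (simp add: order_def)

lemma pow_lt: "i < j \<Longrightarrow> p ^ i < p ^ j"
  using p_gt1 by (simp add: power_strict_increasing)

text \<open>The centre has order \<open>p^2\<close>, so the chain from the trivial subgroup through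
  \<open>H \<inter> B\<close> to \<open>H \<inter> cen\<close>, strict because of \<open>g\<close>
  and \<open>h\<close>, exhausts it. In the applications \<open>B\<close> is the cyclic group
  generated by \<open>g\<close>.\<close>

lemma cen_eqI: 
  assumes H: "subgroup H G" and g: "g \<in> H" "h \<in> H" "g \<noteq> \<one>"
    and B: "subgroup B G" "g \<in> B" "h \<notin> B" "B \<subseteq> cen" and h: "h \<in> cen"
  shows "cen \<subseteq> H"
proof -
  have HB: "subgroup (H \<inter> B) G" and Hc: "subgroup (H \<inter> cen) G"
    using H B subgroup_cen subgroups_Inter_pair by blast+
  have one: "\<one> \<in> H \<inter> B" using HB subgroup.one_closed by blast
  have "p ^ Suc 0 \<le> card (H \<inter> B)"
    using g B one by (intro card_subgroup_ge_Suc[of "{\<one>}"]) (auto simp: triv_subgroup HB)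
  then have "p ^ Suc (Suc 0) \<le> card (H \<inter> cen)"
    using g B h by (intro card_subgroup_ge_Suc[OF HB Hc]) auto
  then have "H \<inter> cen = cen" using card_cen subgroup_cen by (intro subgroup_eqI) (auto simp: numeral_2_eq_2)
  then show ?thesis by blast
qed

end

text \<open>The assumption says only that \<open>G\<close> modulo its centre is not abelian; that
  the class is exactly three comes out in \<open>com_in_N\<close>.\<close>

locale order_p5_class3 = order_p5 +
  assumes class3: "com_center cen \<noteq> carrier G"
begin

abbreviation "N \<equiv> com_center cen"

lemma subgroup_N: "subgroup N G" and normal_N: "N \<lhd> G" and cen_subset_N: "cen \<subseteq> N"
  using subgroup_com_center normal_com_center normal_subset_com_center normal_cen by auto

lemma N_D: "g \<in> N \<Longrightarrow> g \<in> carrier G" "g \<in> N \<Longrightarrow> h \<in> carrier G \<Longrightarrow> com g h \<in> cen" "g \<in> N \<Longrightarrow> h \<in> carrier G \<Longrightarrow> com h g \<in> cen"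
  using com_sym_mem[OF subgroup_cen, of g h] by (auto simp: com_center_def)

text \<open>\<open>N\<close> lies over the centre of \<open>G\<close> modulo \<open>cen\<close>, a
  nonabelian group of order \<open>p^3\<close>: that centre is nontrivial, proper and not of index
  \<open>p\<close>.\<close>

lemma card_N: "card N = p ^ 3"
proof -
  have ne: "cen \<noteq> carrier G" using card_cen card_G pow_lt[of 2 5] by auto
  have "p * card cen \<le> card N"
    using com_center_psubset[OF normal_cen ne] by (intro card_psubset_subgroup subgroup_cen subgroup_N)
  then have 1: "p ^ 3 \<le> card N" using card_cen by (simp add: numeral_3_eq_3 power2_eq_square)
  obtain k where k: "card N = p ^ k" "k \<le> 5" using card_subgroup_power[OF subgroup_N] by blast
  have "k \<noteq> 5" using class3 carrier_eqI[OF subgroup_N] k by auto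
  moreover have "k \<noteq> 4"
  proof
    assume "k = 4"
    then have "p ^ 5 \<le> p * card N" using k by (simp flip: power_Suc)
    then show False using com_center_index[OF normal_cen] class3 by blast
  qed
  moreover have "3 \<le> k" using 1 k p_gt1 by (metis power_le_imp_le_exp)
  ultimately have "k = 3" using k by linarith
  then show ?thesis using k by simp
qed

text \<open>The quotient by \<open>N\<close> has order \<open>p^2\<close>; its centre is nontrivial
  and cannot have index \<open>p\<close>, so the quotient is abelian.\<close>

lemma com_in_N: "g \<in> carrier G \<Longrightarrow> h \<in> carrier G \<Longrightarrow> com g h \<in> N"
proof -
  have "p * card N \<le> card (com_center N)"
    using com_center_psubset[OF normal_N class3] subgroup_com_center[OF normal_N] subgroup_N
    by (intro card_psubset_subgroup) auto
  then have "p ^ 5 \<le> p * card (com_center N)"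
    using card_N mult_le_mono2[of "p * card N" "card (com_center N)" p] by (simp add: eval_nat_numeral)
  then have "com_center N = carrier G" by (rule com_center_index[OF normal_N])
  then show "g \<in> carrier G \<Longrightarrow> h \<in> carrier G \<Longrightarrow> com g h \<in> N" unfolding com_center_def by blast
qed

lemma N_representation:
  assumes "c \<in> N" "c \<notin> cen" "g \<in> N"
  shows "\<exists>k::nat. \<exists>z\<in>cen. g = c [^] k \<otimes> z"
  using index_p_representation[OF subgroup_N normal_cen cen_subset_N _ assms] card_N card_cen
  by (simp add: eval_nat_numeral)

lemma N_subset:
  assumes H: "subgroup H G" and "cen \<subseteq> H" "c \<in> H" "c \<in> N" "c \<notin> cen"
  shows "N \<subseteq> H"
proof
  fix g assume "g \<in> N"
  then obtain k z where "z \<in> cen" "g = c [^] (k::nat) \<otimes> z" using N_representation assms by blast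
  then show "g \<in> H" using assms pow_mem_subgroup[OF H, of c k] by (auto intro: subgroup.m_closed[OF H])
qed

lemma pow_N: "c \<in> N \<Longrightarrow> c [^] p \<in> cen"
  using card_N card_cen by (intro pow_p_mem[OF subgroup_N normal_cen cen_subset_N]) (auto simp: eval_nat_numeral)

text \<open>The commutator of \<open>x\<close> and \<open>y\<close> lies in \<open>N\<close> but not
  in the centre, which has index \<open>p\<close> in \<open>N\<close>, so all of \<open>N\<close> is
  reached. Then \<open>x\<close> enlarges the subgroup inside the elements commuting with
  \<open>x\<close> modulo the centre, and \<open>y\<close> lies outside these.\<close>

lemma generated:
  assumes xy: "x \<in> carrier G" "y \<in> carrier G" "com x y \<notin> cen"
    and H: "subgroup H G" "insert x (insert y cen) \<subseteq> H"
  shows "carrier G \<subseteq> H"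
proof -
  have cH: "com x y \<in> H" using H by (intro com_mem_subgroup) auto
  have NH: "N \<subseteq> H" using N_subset[OF H(1)] H cH com_in_N xy by blast
  let ?D = "{g \<in> carrier G. com g x \<in> cen}"
  have D: "subgroup (H \<inter> ?D) G" using subgroup_com_mod[OF normal_cen xy(1)] H(1) subgroups_Inter_pair by blast
  have "p ^ Suc 3 \<le> card (H \<inter> ?D)"
  proof (rule card_subgroup_ge_Suc[OF subgroup_N D])
    show "N \<subseteq> H \<inter> ?D" using NH N_D xy by blast
    show "x \<in> H \<inter> ?D" using H xy subgroup.one_closed[OF subgroup_cen] by simp
    show "x \<notin> N" using N_D xy by blast
  qed (simp add: card_N)
  moreover have "y \<notin> ?D" using xy com_sym_mem[OF subgroup_cen, of y x] by blast
  ultimately have "p ^ Suc (Suc 3) \<le> card H"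
    using H by (intro card_subgroup_ge_Suc[OF D H(1), where g = y]) auto
  then show ?thesis using carrier_eqI[OF H(1)] by simp
qed

text \<open>The elements commuting with \<open>x\<close> modulo the centre form a subgroup of order
  \<open>p^4\<close>, in which \<open>N\<close> is normal of index \<open>p\<close>.\<close>

lemma pow_x:
  assumes xy: "x \<in> carrier G" "y \<in> carrier G" "com x y \<notin> cen"
  shows "x [^] p \<in> N"
proof -
  let ?D = "{g \<in> carrier G. com g x \<in> cen}"
  have D: "subgroup ?D G" using subgroup_com_mod[OF normal_cen xy(1)] .
  have xD: "x \<in> ?D" using xy subgroup.one_closed[OF subgroup_cen] by simp
  have ND: "N \<subseteq> ?D" using N_D xy by blast
  have "p ^ Suc 3 \<le> card ?D"
    using xD N_D xy card_N ND by (intro card_subgroup_ge_Suc[OF subgroup_N D, where g = x]) auto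
  moreover have "p * card ?D \<le> card (carrier G)"
    using xy com_sym_mem[OF subgroup_cen, of y x]
    by (intro card_psubset_subgroup[OF D subgroup_self]) blast
  ultimately have "card ?D = p * card N" using card_N card_G p_gt1 by (simp add: eval_nat_numeral)
  then show ?thesis by (intro pow_p_mem[OF D normal_N ND _ xD])
qed

lemma coboundary:
  assumes f: "f \<in> schur_cocycles G"
    and xy: "x \<in> carrier G" "y \<in> carrier G" "com x y \<notin> cen"
    and bz: "\<And>z g. z \<in> cen \<Longrightarrow> g \<in> carrier G \<Longrightarrow> beta f z g = 1"
    and bc: "\<And>g. g \<in> carrier G \<Longrightarrow> com x y \<otimes> g = g \<otimes> com x y \<Longrightarrow> beta f (com x y) g = 1"
  shows "f \<in> schur_coboundaries G"
proof -
  interpret F: schur_ext G f by unfold_locales (rule f)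
  have cN: "com x y \<in> N" using com_in_N xy by blast
  obtain k z where kz: "z \<in> cen" "x [^] p = com x y [^] (k::nat) \<otimes> z"
    using N_representation[OF cN xy(3) pow_x[OF xy]] by blast
  show ?thesis
    by (rule F.coboundary_class3[OF finite_G p odd_p xy(1,2) refl xy(3) N_D(2)[OF cN] pow_N[OF cN] kz(2,1)])
      (use generated[OF xy] bz bc in auto)
qed

text \<open>The element \<open>com c w\<close> is a commutator as well as central, so it pairs
  trivially with the centre; by \<open>generated\<close> only \<open>x\<close> and \<open>y\<close>
  are left to check.\<close>

lemma bker_com_com:
  assumes f: "f \<in> schur_cocycles G" and c: "c \<in> N" and w: "w \<in> carrier G"
    and xy: "x \<in> carrier G" "y \<in> carrier G" "com x y \<notin> cen"
    and b: "x \<in> schur_ext.bker G f (com c w)" "y \<in> schur_ext.bker G f (com c w)"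
  shows "carrier G \<subseteq> schur_ext.bker G f (com c w)"
proof -
  interpret F: schur_ext G f by unfold_locales (rule f)
  show ?thesis
  proof (rule generated[OF xy])
    show "subgroup (F.bker (com c w)) G" using F.subgroup_bker N_D c w by simp
    show "insert x (insert y cen) \<subseteq> F.bker (com c w)"
      using b F.com_in_bker_cen[of _ c w] N_D c w by blast
  qed
qed

text \<open>The centralizer of \<open>c\<close> has order at most \<open>p^3\<close>, so commutation
  with \<open>c\<close> maps \<open>G\<close> onto the centre, which \<open>u\<close> and
  \<open>v\<close> therefore generate; both have order dividing \<open>p\<close>. This accounts for
  four values. The other condition of \<open>coboundary\<close> costs nothing: an element commuting
  with \<open>c\<close> lies in \<open>N\<close>, so it is a power of \<open>c\<close> times a
  central element, and \<open>c\<close> pairs trivially with itself and, as a commutator, with the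
  centre.\<close>

lemma order_le_centralizer_N:
  assumes xy: "x \<in> carrier G" "y \<in> carrier G" and c: "c = com x y" "c \<notin> cen"
    and cent: "\<And>g. g \<in> carrier G \<Longrightarrow> com c g = \<one> \<Longrightarrow> g \<in> N"
  shows "order (schur_multiplier G) \<le> p ^ 4"
proof -
  define u where "u = com c x"
  define v where "v = com c y"
  have xy': "com x y \<notin> cen" using c by simp
  have cN: "c \<in> N" and cG: "c \<in> carrier G" using com_in_N xy c by auto
  have uv: "u \<in> cen" "v \<in> cen" using N_D cN xy by (auto simp: u_def v_def)
  have comp: "com c w [^] p = \<one>" if w: "w \<in> carrier G" for w
    using com_pow_left_cen[OF cG w N_D(2)[OF cN w], of p] com_cen(1)[OF pow_N[OF cN] w] by simp
  have surj: "cen \<subseteq> com c ` carrier G"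
  proof -
    have "card (com c ` carrier G) * card {a \<in> carrier G. com c a = \<one>} = card (carrier G)"
      using cG N_D(2)[OF cN] by (intro card_image_mult_card_kernel subgroup_self group_axioms) (auto simp: com_mult_right_cen)
    moreover have "card {a \<in> carrier G. com c a = \<one>} \<le> p ^ 3"
      using cent finite_subgroup[OF subgroup_N] card_mono[of N "{a \<in> carrier G. com c a = \<one>}"] card_N by auto
    ultimately have le: "p ^ 5 \<le> p ^ 3 * card (com c ` carrier G)"
      using card_G mult_le_mono2[of "card {a \<in> carrier G. com c a = \<one>}" "p ^ 3" "card (com c ` carrier G)"]
      by (simp add: mult.commute)
    have "p ^ 3 * p ^ 2 = p ^ 5" by (simp flip: power_add)
    also note le
    finally have "card cen \<le> card (com c ` carrier G)" using p_gt1 card_cen by (subst (asm) mult_le_cancel1) simp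
    moreover have "com c ` carrier G \<subseteq> cen" using N_D(2)[OF cN] by auto
    ultimately show ?thesis using card_seteq[OF finite_subgroup[OF subgroup_cen]] by blast
  qed
  have "order (schur_multiplier G) \<le> p ^ length [(u, x), (u, y), (v, x), (v, y)]"
  proof (rule order_schur_multiplier_le)
    show "0 < p" using p_gt1 by simp
  next
    fix f i assume f: "f \<in> schur_cocycles G" and i: "i < length [(u, x), (u, y), (v, x), (v, y)]"
    interpret F: schur_ext G f by unfold_locales (rule f)
    have b: "beta f z g ^ p = 1" if "z = u \<or> z = v" "g \<in> carrier G" for z g
    proof -
      have zc: "z \<in> cen" "z [^] p = \<one>" using that uv comp xy by (auto simp: u_def v_def)
      then have "beta f z g ^ p = beta f (z [^] p) g"
        using that(2) cenD[OF zc(1)] by (intro F.beta_pow_left[symmetric]) auto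
      then show ?thesis using zc that by simp
    qed
    show "beta f (fst ([(u, x), (u, y), (v, x), (v, y)] ! i)) (snd ([(u, x), (u, y), (v, x), (v, y)] ! i)) ^ p = 1"
      using i xy b by (auto simp: less_Suc_eq)
  next
    fix f assume f: "f \<in> schur_cocycles G"
      and *: "\<And>j. j < length [(u, x), (u, y), (v, x), (v, y)] \<Longrightarrow>
        beta f (fst ([(u, x), (u, y), (v, x), (v, y)] ! j)) (snd ([(u, x), (u, y), (v, x), (v, y)] ! j)) = 1"
    interpret F: schur_ext G f by unfold_locales (rule f)
    have 1: "beta f u x = 1" "beta f u y = 1" "beta f v x = 1" "beta f v y = 1"
      using *[of 0] *[of 1] *[of 2] *[of 3] by simp_all
    have "carrier G \<subseteq> F.bker u" "carrier G \<subseteq> F.bker v"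
      unfolding u_def v_def
      using 1 cenD(2)[OF uv(1)] cenD(2)[OF uv(2)] xy
      by (intro bker_com_com[OF f cN _ xy xy'] xy; simp add: F.bker_def u_def v_def)+
    then have uvg: "u \<in> F.bker g" "v \<in> F.bker g" if "g \<in> carrier G" for g
      using that F.bker_sym cenD(1) uv by blast+
    have bz: "beta f z g = 1" if z: "z \<in> cen" and g: "g \<in> carrier G" for z g
    proof -
      \<comment> \<open>A subgroup of the centre containing \<open>[x, c]\<close> and
        \<open>[y, c]\<close> contains all \<open>[w, c]\<close>, and the values of commutation with
        \<open>c\<close> exhaust the centre.\<close>
      let ?S = "{w \<in> carrier G. com w c \<in> F.bker g \<inter> cen}"
      have sub: "subgroup (F.bker g \<inter> cen) G"
        using subgroups_Inter_pair F.subgroup_bker[OF g] subgroup_cen by blast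
      have nS: "subgroup ?S G"
        using sub by (intro subgroup_com_mod normal_of_subset_cen cG) auto
      have "com w c \<in> F.bker g \<inter> cen" if "com c w \<in> F.bker g \<inter> cen" "w \<in> carrier G" for w
        using that com_sym_mem[OF sub cG] by blast
      then have "x \<in> ?S" "y \<in> ?S" using uvg[OF g] uv xy by (auto simp: u_def v_def)
      moreover have "cen \<subseteq> ?S" using com_cen(1)[OF _ cG] cenD(1) subgroup.one_closed[OF sub] by auto
      ultimately have "carrier G \<subseteq> ?S" by (intro generated[OF xy xy' nS]) auto
      then have "com c w \<in> F.bker g \<inter> cen" if "w \<in> carrier G" for w
        using that com_sym_mem[OF sub, of w c] cG by blast
      then have "z \<in> F.bker g" using surj z by blast
      then show ?thesis using F.beta_swap[of z g] by (simp add: F.bker_def)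
    qed
    show "f \<in> schur_coboundaries G"
    proof (rule coboundary[OF f xy xy' bz])
      fix g assume g: "g \<in> carrier G" "com x y \<otimes> g = g \<otimes> com x y"
      then have "com c g = \<one>" using com_eq_one_iff cG c by simp
      then have gN: "g \<in> N" using cent g by blast
      have "N \<subseteq> F.bker c"
      proof (rule N_subset[OF _ _ _ cN c(2)])
        show "subgroup (F.bker c) G" by (rule F.subgroup_bker[OF cG])
        show "cen \<subseteq> F.bker c"
          using F.beta_cen_com[OF _ xy] F.bker_sym cenD(1) cG c by blast
        show "c \<in> F.bker c" using cG by (simp add: F.bker_def)
      qed
      then show "beta f (com x y) g = 1" using gN c by (auto simp: F.bker_def)
    qed
  qed
  then show ?thesis by (simp add: eval_nat_numeral)
qed

end

context order_p5
begin

lemma generate_order_p: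
  assumes g: "g \<in> cen" "g \<noteq> \<one>" "g [^] p = \<one>"
  defines "B \<equiv> {g [^] k | k. k \<in> (UNIV :: nat set)}"
  shows "subgroup B G" "B \<subseteq> cen" "card B = p" "g \<in> B"
proof -
  have gG: "g \<in> carrier G" using g cenD by blast
  have "ord g dvd p" using g gG pow_eq_id by blast
  moreover have "ord g \<noteq> 1" using g gG ord_eq_1 by blast
  ultimately have o: "ord g = p" using p prime_nat_iff by blast
  then have B: "B = generate G {g}" unfolding B_def using generate_pow_nat[OF gG] p_gt1 by simp
  show "subgroup B G" unfolding B using generate_is_subgroup gG by simp
  show "B \<subseteq> cen" unfolding B_def using nat_pow_cen[OF g(1)] by blast
  show "card B = p" unfolding B using generate_pow_card[OF gG] o by simp
  show "g \<in> B" unfolding B_def using gG by (metis (mono_tags, lifting) UNIV_I mem_Collect_eq nat_pow_eone)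
qed

end

section \<open>The Hall--Witt identity and the case of a larger centralizer\<close>

context order_p5_class3
begin

text \<open>The form taken here by the Hall--Witt identity: conjugating the commuting pair \<open>(c, x)\<close> by
  \<open>y\<close> turns it into \<open>([c, y]\<^sup>-\<^sup>1 c, c\<^sup>-\<^sup>1 x)\<close>.\<close>
lemma beta_Jacobi:
  assumes f: "f \<in> schur_cocycles G"
    and xy: "x \<in> carrier G" "y \<in> carrier G" and c: "c = com x y" "c \<in> N" and cx: "c \<otimes> x = x \<otimes> c"
  shows "x \<in> schur_ext.bker G f (com c y)"
proof -
  interpret F: schur_ext G f by unfold_locales (rule f)
  define d where "d = inv (com c y)"
  have cG: "c \<in> carrier G" using c xy by simp
  have cy: "com c y \<in> cen" "d \<in> cen" using N_D(2)[OF c(2) xy(2)] subgroup.m_inv_closed[OF subgroup_cen] by (auto simp: d_def)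
  have dG: "d \<in> carrier G" using cenD cy by blast
  have yc: "y \<otimes> c \<otimes> inv y = d \<otimes> c" unfolding d_def using cG xy by (simp add: word_simps)
  have yx: "y \<otimes> x \<otimes> inv y = inv c \<otimes> x" unfolding c using xy by (simp add: word_simps)
  have ic: "c \<otimes> inv c = inv c \<otimes> c" using cG by simp
  have cic: "inv c \<otimes> x = x \<otimes> inv c"
  proof -
    have "com c x = \<one>" using com_eq_one_iff cx cG xy by simp
    then have "c \<in> {g \<in> carrier G. com g x = \<one>}" using cG by simp
    then have "inv c \<in> {g \<in> carrier G. com g x = \<one>}" using subgroup.m_inv_closed[OF subgroup_centralizer[OF xy(1)]] by blast
    then show ?thesis using com_eq_one_iff[of "inv c" x] xy(1) by blast
  qed
  have dd: "d \<otimes> g = g \<otimes> d" if "g \<in> carrier G" for g using cenD(2)[OF cy(2) that] .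
  have comm: "(d \<otimes> c) \<otimes> inv c = inv c \<otimes> (d \<otimes> c)" "(d \<otimes> c) \<otimes> x = x \<otimes> (d \<otimes> c)"
  proof -
    show "(d \<otimes> c) \<otimes> inv c = inv c \<otimes> (d \<otimes> c)" using cG dG dd[of "inv c"] by (simp add: m_assoc dd cancel_left cancel_left')
    show "(d \<otimes> c) \<otimes> x = x \<otimes> (d \<otimes> c)"
    proof -
      have "(d \<otimes> c) \<otimes> x = d \<otimes> x \<otimes> c" using cG dG xy cx by (simp add: m_assoc)
      also have "\<dots> = x \<otimes> (d \<otimes> c)" unfolding dd[OF xy(1)] using cG dG xy by (simp add: m_assoc)
      finally show ?thesis .
    qed
  qed
  \<comment> \<open>Expanding bilinearly leaves \<open>beta f c x\<close> on both sides. As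
    \<open>d\<close> is central, it pairs trivially with the commutator \<open>c\<close>, so that
    \<open>beta f d x\<close> is the only factor left and must be 1.\<close>
  have "beta f c x = beta f (d \<otimes> c) (inv c \<otimes> x)"
    using F.beta_conj[OF xy(2) cG xy(1) cx] unfolding yc yx by simp
  also have "\<dots> = beta f (d \<otimes> c) (inv c) * beta f (d \<otimes> c) x"
    using cG dG xy comm by (intro F.beta_mult_right) auto
  also have "beta f (d \<otimes> c) x = beta f d x * beta f c x"
    using cG dG xy dd cx by (intro F.beta_mult_left) auto
  also have "beta f (d \<otimes> c) (inv c) = beta f d (inv c) * beta f c (inv c)"
    using cG dG dd ic by (intro F.beta_mult_left) auto
  also have "beta f c (inv c) = 1"
    using subgroup.m_inv_closed[OF F.subgroup_bker[OF cG], of c] cG by (auto simp: F.bker_def)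
  also have "beta f d (inv c) = 1"
  proof -
    have "com y x \<in> F.bker d" using F.beta_cen_com cy xy by blast
    then show ?thesis using c inv_com xy by (simp add: F.bker_def)
  qed
  finally have "beta f d x = 1" by simp
  then have "x \<in> F.bker d" using dd xy by (simp add: F.bker_def)
  then have "d \<in> F.bker x" using F.bker_sym dG xy by blast
  then have "inv d \<in> F.bker x" using subgroup.m_inv_closed[OF F.subgroup_bker[OF xy(1)]] by blast
  then have "com c y \<in> F.bker x" using cG xy by (simp add: d_def)
  then show ?thesis using F.bker_sym cG xy by simp
qed

text \<open>Since \<open>c0\<close> and the centre generate \<open>N\<close>, the element
  \<open>x\<close> centralizes \<open>N\<close> and with it \<open>c\<close>. The centre is
  generated by \<open>\<gamma>\<close> and one further element \<open>z0\<close>. Of their four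
  pairings with \<open>x\<close> and \<open>y\<close>, \<open>beta_Jacobi\<close> makes the one of
  \<open>\<gamma>\<close> with \<open>x\<close> trivial; \<open>beta f c x\<close> takes its place
  as a fourth value.\<close>

lemma order_le_centralizer_gt_N:
  assumes c0: "c0 \<in> N" "c0 \<notin> cen" and x: "x \<in> carrier G" "x \<notin> N" "com c0 x = \<one>"
  shows "order (schur_multiplier G) \<le> p ^ 4"
proof -
  obtain y where y: "y \<in> carrier G" "com x y \<notin> cen" using x by (auto simp: com_center_def)
  note xy = x(1) y
  define c where "c = com x y"
  have c: "c \<notin> cen" and cN: "c \<in> N" and cG: "c \<in> carrier G" using xy com_in_N by (auto simp: c_def)
  have Nx: "com n x = \<one>" if "n \<in> N" for n
  proof -
    have "N \<subseteq> {g \<in> carrier G. com g x = \<one>}"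
      by (rule N_subset[OF subgroup_centralizer[OF x(1)] _ _ c0]) (use c0 x com_cen cenD N_D in auto)
    then show ?thesis using that by blast
  qed
  have cx: "c \<otimes> x = x \<otimes> c" using Nx[OF cN] com_eq_one_iff cG x by simp
  define \<gamma> where "\<gamma> = com c y"
  have \<gamma>: "\<gamma> \<in> cen" using N_D cN xy by (simp add: \<gamma>_def)
  have \<gamma>G: "\<gamma> \<in> carrier G" using \<gamma> cenD by blast
  have \<gamma>p: "\<gamma> [^] p = \<one>"
    using com_pow_left_cen[OF cG xy(2) N_D(2)[OF cN xy(2)], of p] com_cen(1)[OF pow_N[OF cN] xy(2)] by (simp add: \<gamma>_def)
  have \<gamma>1: "\<gamma> \<noteq> \<one>"
  proof
    assume "\<gamma> = \<one>"
    then have "carrier G \<subseteq> {g \<in> carrier G. com g c = \<one>}"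
      using cx cG xy com_eq_one_iff[OF cG xy(2)] com_eq_one_iff[OF xy(2) cG] com_eq_one_iff[OF x(1) cG] com_cen(1)[OF _ cG] cenD(1)
      by (intro generated[OF xy] subgroup_centralizer) (auto simp: \<gamma>_def)
    then have "c \<otimes> g = g \<otimes> c" if "g \<in> carrier G" for g
      using that com_eq_one_iff[OF that cG] by auto
    then show False using c cenI cG by blast
  qed
  define B where "B = {\<gamma> [^] k | k. k \<in> (UNIV :: nat set)}"
  have B: "subgroup B G" "B \<subseteq> cen" "card B = p" "\<gamma> \<in> B"
    unfolding B_def using generate_order_p[OF \<gamma> \<gamma>1 \<gamma>p] by auto
  have "B \<noteq> cen" using B(3) card_cen p_gt1 by (auto simp: power2_eq_square)
  then obtain z0 where z0: "z0 \<in> cen" "z0 \<notin> B" using B by blast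
  have z0G: "z0 \<in> carrier G" using z0 cenD by blast
  have "z0 [^] p \<in> B"
    using B card_cen z0 by (intro pow_p_mem[OF subgroup_cen normal_of_subset_cen]) (auto simp: power2_eq_square)
  then obtain j where j: "z0 [^] p = \<gamma> [^] (j::nat)" unfolding B_def by blast
  \<comment> \<open>Because \<open>x\<close> commutes with \<open>c\<close>, the commutator
    \<open>[x^p, y]\<close> is \<open>c^p\<close>; but \<open>x^p\<close> is \<open>c^k\<close>
    times a central element, so it is also a power of \<open>[c, y]\<close>.\<close>
  have "c [^] p \<in> B"
  proof -
    obtain k z where kz: "z \<in> cen" "x [^] p = c [^] (k::nat) \<otimes> z"
      using N_representation[OF cN c pow_x[OF xy]] by blast
    have xc: "com x c = \<one>" using cx com_eq_one_iff cG x by simp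
    have "c [^] p = com (x [^] p) y"
      using com_pow_left_class3[OF xy(1,2), of p] xc cG subgroup.one_closed[OF subgroup_cen] by (simp flip: c_def)
    also have "\<dots> = com (c [^] k) y"
      unfolding kz using cG xy cenD(1)[OF kz(1)] com_cen(1)[OF kz(1) xy(2)] subgroup.one_closed[OF subgroup_cen]
      by (subst com_mult_left_cen) auto
    also have "\<dots> = \<gamma> [^] k" unfolding \<gamma>_def using \<gamma> cG xy by (intro com_pow_left_cen) (auto simp: \<gamma>_def)
    finally show ?thesis unfolding B_def by blast
  qed
  then obtain k where k: "c [^] p = \<gamma> [^] (k::nat)" unfolding B_def by blast
  \<comment> \<open>The pair with \<open>\<gamma>\<close> precedes \<open>(z0, y)\<close>: as
    \<open>z0^p\<close> is a power of \<open>\<gamma>\<close>, the last value is a p-th root of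
    unity only once the first is 1. For \<open>(c, x)\<close> and \<open>(z0, x)\<close> the
    triviality of \<open>beta f \<gamma> x\<close> is enough.\<close>
  let ?ps = "[(\<gamma>, y), (c, x), (z0, x), (z0, y)]"
  have zcom: "z \<otimes> g = g \<otimes> z" if "z \<in> cen" "g \<in> carrier G" for z g using that cenD by blast
  have "order (schur_multiplier G) \<le> p ^ length ?ps"
  proof (rule order_schur_multiplier_le)
    show "0 < p" using p_gt1 by simp
  next
    fix f i assume f: "f \<in> schur_cocycles G" and i: "i < length ?ps"
      and prev: "\<And>j. j < i \<Longrightarrow> beta f (fst (?ps ! j)) (snd (?ps ! j)) = 1"
    interpret F: schur_ext G f by unfold_locales (rule f)
    have gx: "beta f \<gamma> x = 1" using beta_Jacobi[OF f xy(1,2) c_def cN cx] by (simp add: F.bker_def \<gamma>_def)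
    have z0p: "beta f z0 g ^ p = beta f \<gamma> g ^ j" if "g \<in> carrier G" for g
      using F.beta_pow_left[OF z0G that zcom[OF z0(1) that], of p] F.beta_pow_left[OF \<gamma>G that zcom[OF \<gamma> that], of j] j by simp
    have "beta f \<gamma> y ^ p = 1" using F.beta_pow_left[OF \<gamma>G xy(2) zcom[OF \<gamma> xy(2)], of p] \<gamma>p xy by simp
    moreover have "beta f c x ^ p = 1"
      using F.beta_pow_left[OF cG x(1) cx, of p] F.beta_pow_left[OF \<gamma>G x(1) zcom[OF \<gamma> x(1)], of k] k gx by simp
    moreover have "beta f z0 x ^ p = 1" using z0p[OF x(1)] gx by simp
    moreover have "beta f z0 y ^ p = 1" if "i = 3" using z0p[OF xy(2)] prev[of 0] that by simp
    ultimately show "beta f (fst (?ps ! i)) (snd (?ps ! i)) ^ p = 1"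
      using i by (auto simp: less_Suc_eq eval_nat_numeral)
  next
    fix f assume f: "f \<in> schur_cocycles G"
      and *: "\<And>j. j < length ?ps \<Longrightarrow> beta f (fst (?ps ! j)) (snd (?ps ! j)) = 1"
    interpret F: schur_ext G f by unfold_locales (rule f)
    have 1: "beta f \<gamma> y = 1" "beta f c x = 1" "beta f z0 x = 1" "beta f z0 y = 1"
      using *[of 0] *[of 1] *[of 2] *[of 3] by simp_all
    have gx: "x \<in> F.bker \<gamma>" unfolding \<gamma>_def by (rule beta_Jacobi[OF f xy(1,2) c_def cN cx])
    have g: "carrier G \<subseteq> F.bker \<gamma>"
      unfolding \<gamma>_def using gx 1 zcom[OF \<gamma> xy(2)] xy
      by (intro bker_com_com[OF f cN xy(2) xy]) (auto simp: F.bker_def \<gamma>_def)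
    have cz: "cen \<subseteq> F.bker z" if z: "z \<in> carrier G" "\<gamma> \<in> F.bker z" "z0 \<in> F.bker z" for z
      using cen_eqI[OF F.subgroup_bker[OF z(1)] z(2,3) \<gamma>1 B(1,4) z0(2) B(2) z0(1)] .
    have gz: "\<gamma> \<in> F.bker z" if "z \<in> carrier G" for z using g F.bker_sym \<gamma>G that by blast
    have z0z0: "z0 \<in> F.bker z0" using z0G by (simp add: F.bker_def)
    have "carrier G \<subseteq> F.bker z0"
      using cz[OF z0G gz[OF z0G] z0z0] 1 zcom[OF z0(1)] x y
      by (intro generated[OF xy] F.subgroup_bker z0G) (auto simp: F.bker_def)
    then have cenb: "cen \<subseteq> F.bker g" if "g \<in> carrier G" for g
      using cz[OF that gz[OF that]] F.bker_sym[OF z0G that] that by blast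
    have bz: "beta f z g = 1" if "z \<in> cen" "g \<in> carrier G" for z g
      using cenb[OF that(2)] that F.beta_swap[of z g] by (auto simp: F.bker_def)
    show "f \<in> schur_coboundaries G"
    proof (rule coboundary[OF f xy bz])
      let ?C = "{g \<in> carrier G. com g c = \<one>}"
      have C: "subgroup ?C G" by (rule subgroup_centralizer[OF cG])
      have bC: "F.bker c \<subseteq> ?C" using com_eq_one_iff cG by (auto simp: F.bker_def)
      have cb: "c \<in> F.bker c" using cG by (simp add: F.bker_def)
      have bs: "subgroup (F.bker c) G" using F.subgroup_bker cG by blast
      have "N \<subseteq> F.bker c" by (rule N_subset[OF bs cenb[OF cG] cb cN c])
      moreover have "x \<in> F.bker c" using 1 x cx by (simp add: F.bker_def)
      \<comment> \<open>\<open>bker c\<close> contains \<open>N\<close> and \<open>x\<close>, so it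
        has index at most \<open>p\<close>. The centralizer of \<open>c\<close> contains it and is
        proper because of \<open>y\<close>, hence the two are equal.\<close>
      ultimately have b4: "p ^ Suc 3 \<le> card (F.bker c)"
        using x card_N by (intro card_subgroup_ge_Suc[OF subgroup_N bs, where g = x]) auto
      have Cb: "?C \<subseteq> F.bker c"
      proof (rule ccontr)
        assume "\<not> ?C \<subseteq> F.bker c"
        then obtain g where g: "g \<in> ?C" "g \<notin> F.bker c" by blast
        have "p ^ Suc (Suc 3) \<le> card ?C" by (rule card_subgroup_ge_Suc[OF bs C bC g b4])
        then have "?C = carrier G" by (intro carrier_eqI[OF C]) simp
        then have "y \<in> ?C" using xy by blast
        then have "com c y = \<one>" using com_eq_one_iff xy cG by auto
        then show False using \<gamma>1 by (simp add: \<gamma>_def)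
      qed
      fix g assume g: "g \<in> carrier G" "com x y \<otimes> g = g \<otimes> com x y"
      then have "com g c = \<one>" using com_eq_one_iff[OF g(1) cG] by (simp add: c_def)
      then have "g \<in> F.bker c" using Cb g by blast
      then show "beta f (com x y) g = 1" by (simp add: F.bker_def c_def)
    qed
  qed
  then show ?thesis by (simp add: eval_nat_numeral)
qed

lemma order_le: "order (schur_multiplier G) \<le> p ^ 4"
proof -
  obtain x where x: "x \<in> carrier G" "x \<notin> N" using class3 subgroup.subset[OF subgroup_N] by blast
  then obtain y where y: "y \<in> carrier G" "com x y \<notin> cen" by (auto simp: com_center_def)
  show ?thesis
  proof (cases "\<forall>g \<in> carrier G. com (com x y) g = \<one> \<longrightarrow> g \<in> N")
    case True
    then show ?thesis using order_le_centralizer_N[OF x(1) y(1) refl y(2)] by blast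
  next
    case False
    then show ?thesis using order_le_centralizer_gt_N[OF com_in_N[OF x(1) y(1)] y(2)] by blast
  qed
qed

end

section \<open>Groups of class two\<close>

lemma (in group) one_in_cen [simp]: "\<one> \<in> cen"
  by (rule subgroup.one_closed[OF subgroup_cen])

locale order_p5_class2 = order_p5 +
  assumes class2: "com_center cen = carrier G"
begin

lemma com_in_cen [simp]: "g \<in> carrier G \<Longrightarrow> h \<in> carrier G \<Longrightarrow> com g h \<in> cen"
  using class2 by (auto simp: com_center_def)

lemmas com_bilinear = com_mult_left_cen com_mult_right_cen com_pow_left_cen com_pow_right_cen nat_pow_cen

lemma normal_of_cen_subset: "subgroup K G \<Longrightarrow> cen \<subseteq> K \<Longrightarrow> K \<lhd> G"
  using subgroup.subset by (intro normal_of_com) (fastforce intro: subsetD com_in_cen)+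

lemma com_trivial_sym: "x \<in> carrier G \<Longrightarrow> y \<in> carrier G \<Longrightarrow> com x y = \<one> \<Longrightarrow> com y x = \<one>"
  using com_eq_one_iff[of x y] com_eq_one_iff[of y x] by simp

text \<open>Commutation is an alternating map from \<open>G\<close> modulo its centre, of order
  \<open>p^3\<close>, to the centre, of order \<open>p^2\<close>. In linear terms the bivectors of a
  3-dimensional space have dimension 3, so some nonzero one is killed; in that dimension it is
  decomposable and gives two commuting elements independent modulo the centre. The proof finds them
  by hand, starting from an \<open>x\<close> whose centralizer is too small.\<close>

lemma exists_large_centralizer:
  "\<exists>a. a \<in> carrier G \<and> a \<notin> cen \<and> p ^ 4 \<le> card {g \<in> carrier G. com g a = \<one>}"
proof -
  have "cen \<noteq> carrier G" using card_cen card_G pow_lt[of 2 5] by auto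
  then obtain x where x: "x \<in> carrier G" "x \<notin> cen" using subgroup.subset[OF subgroup_cen] by blast
  define C where "C a = {g \<in> carrier G. com g a = \<one>}" for a
  have C: "subgroup (C a) G" if "a \<in> carrier G" for a unfolding C_def by (rule subgroup_centralizer[OF that])
  have cenC: "cen \<subseteq> C a" if "a \<in> carrier G" for a using that com_cen cenD by (auto simp: C_def)
  show ?thesis
  proof (cases "p ^ 4 \<le> card (C x)")
    case True
    then show ?thesis using x unfolding C_def by blast
  next
    case False
    have xC: "x \<in> C x" using x by (simp add: C_def)
    have "p ^ Suc 2 \<le> card (C x)"
      using card_cen by (intro card_subgroup_ge_Suc[OF subgroup_cen C cenC xC x(2)] x) simp
    moreover obtain k where k: "card (C x) = p ^ k" using card_subgroup_power[OF C[OF x(1)]] by blast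
    ultimately have "3 \<le> k" "k < 4" using False p_gt1 by (auto simp: power_increasing_iff)
    then have k3: "card (C x) = p ^ 3" using k by (auto simp: less_Suc_eq eval_nat_numeral)
    then have "x [^] p \<in> cen"
      using card_cen by (intro pow_p_mem[OF C[OF x(1)] normal_cen cenC[OF x(1)] _ xC]) (simp add: eval_nat_numeral)
    then have comp: "com x g [^] p = \<one>" if "g \<in> carrier G" for g
      using com_pow_left_cen[OF x(1) that, of p] com_cen(1)[of "x [^] p" g] that x by simp
    have ker: "{a \<in> carrier G. com x a = \<one>} = C x"
      using com_trivial_sym x by (auto simp: C_def)
    have "card (com x ` carrier G) * card {a \<in> carrier G. com x a = \<one>} = card (carrier G)"
      using x by (intro card_image_mult_card_kernel subgroup_self group_axioms) (auto simp: com_bilinear)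
    then have "card (com x ` carrier G) * p ^ 3 = p ^ (2 + 3)" unfolding ker k3 card_G by simp
    then have "card (com x ` carrier G) = p ^ 2" unfolding power_add using p_gt1 by (subst (asm) mult_cancel2) simp
    then have surj: "com x ` carrier G = cen"
      using card_cen x finite_subgroup[OF subgroup_cen] by (intro card_subset_eq) auto
    have "C x \<noteq> carrier G" using k3 card_G pow_lt[of 3 5] by auto
    then obtain y where y: "y \<in> carrier G" "y \<notin> C x" using subgroup.subset[OF C[OF x(1)]] by blast
    define w where "w = com x y"
    have w: "w \<in> cen" "w \<noteq> \<one>" "w [^] p = \<one>"
      using x y comp com_trivial_sym[OF x(1) y(1)] by (auto simp: w_def C_def)
    define B where "B = {w [^] k | k. k \<in> (UNIV :: nat set)}"
    have B: "subgroup B G" "B \<subseteq> cen" "card B = p" "w \<in> B"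
      unfolding B_def using generate_order_p[OF w] by auto
    have Bn: "B \<lhd> G" using B normal_of_subset_cen by blast
    have "B \<noteq> cen" using B(3) card_cen p_gt1 by (auto simp: power2_eq_square)
    then obtain v where v: "v \<in> cen" "v \<notin> B" using B by blast
    then obtain z where z: "z \<in> carrier G" "v = com x z" using surj by blast
    obtain k s where ks: "s \<in> B" "com y z = v [^] (k::nat) \<otimes> s"
      using index_p_representation[OF subgroup_cen Bn B(2) _ v, of "com y z"] y z card_cen B(3)
      by (auto simp: power2_eq_square)
    obtain i where i: "s = w [^] (i::nat)" using ks unfolding B_def by blast
    \<comment> \<open>\<open>[y, z] = v\<^sup>k w\<^sup>i\<close> with \<open>v = [x, z]\<close> and \<open>w = [x, y]\<close>, so multiplying \<open>y\<close> and \<open>z\<close> by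
      suitable powers of \<open>x\<close> makes them commute.\<close>
    define y' where "y' = y \<otimes> x [^] ((p - 1) * k)"
    define z' where "z' = z \<otimes> x [^] i"
    have car: "y' \<in> carrier G" "z' \<in> carrier G" "v \<in> carrier G" "w \<in> carrier G" using x y z by (auto simp: y'_def z'_def w_def)
    have xx: "com x (x [^] (n::nat)) = \<one>" "com (x [^] (n::nat)) x = \<one>" for n using x by (simp_all add: com_bilinear subgroup.one_closed[OF subgroup_cen])
    have xz': "com x z' = v" using x z car by (simp add: z'_def com_bilinear xx z(2)[symmetric])
    have y'x: "com y' x = inv w" using x y by (simp add: y'_def com_bilinear xx w_def inv_com)
    have yz': "com y z' = com y z \<otimes> inv w [^] i"
      using x y z by (simp add: z'_def com_bilinear w_def inv_com)
    have "com y' z' = com y z' \<otimes> com x z' [^] ((p - 1) * k)"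
      using x y car by (simp add: y'_def com_bilinear)
    also have "\<dots> = v [^] k \<otimes> (w [^] i \<otimes> inv w [^] i) \<otimes> v [^] ((p - 1) * k)"
      unfolding yz' xz' ks i using car by (simp add: m_assoc)
    also have "\<dots> = v [^] (k + (p - 1) * k)" using car by (simp add: nat_pow_inv nat_pow_mult)
    also have "k + (p - 1) * k = p * k" using p_gt1 by (cases p) auto
    also have "v [^] (p * k) = \<one>"
      using car comp[OF z(1)] z by (simp flip: nat_pow_pow)
    finally have y'z': "com y' z' = \<one>" .
    have y'c: "y' \<notin> cen" using y'x w com_cen(1)[of y' x] x car by auto
    \<comment> \<open>This separates \<open>z'\<close> from \<open>y'\<close> and the centre:
      \<open>[y', x]\<close> lies in \<open>B\<close>, but \<open>[z', x]\<close> does not.\<close>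
    let ?D = "C y' \<inter> {g \<in> carrier G. com g x \<in> B}"
    have D: "subgroup ?D G" using subgroups_Inter_pair[OF C[OF car(1)] subgroup_com_mod[OF Bn x(1)]] .
    have y'D: "y' \<in> ?D" using car y'x subgroup.m_inv_closed[OF B(1,4)] by (simp add: C_def)
    have cD: "cen \<subseteq> ?D" using cenC[OF car(1)] com_cen(1)[OF _ x(1)] cenD(1) subgroup.one_closed[OF B(1)] by auto
    have D3: "p ^ Suc 2 \<le> card ?D"
      using card_cen by (intro card_subgroup_ge_Suc[OF subgroup_cen D cD y'D y'c]) simp
    have "z' \<in> C y'" using com_trivial_sym[OF car(1,2) y'z'] car by (simp add: C_def)
    moreover have "z' \<notin> ?D" using com_sym_mem[OF B(1) car(2) x(1)] xz' v by auto
    ultimately have "p ^ Suc (Suc 2) \<le> card (C y')"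
      by (intro card_subgroup_ge_Suc[OF D C[OF car(1)] _ _ _ D3]) auto
    then show ?thesis using car y'c unfolding C_def by auto
  qed
qed

text \<open>The centralizer of \<open>a\<close> has order exactly \<open>p^4\<close>. Its own centre
  \<open>?Z\<close> contains \<open>a\<close> and the centre of \<open>G\<close>, so it has index at
  most \<open>p\<close>, which forces commutativity.\<close>

lemma exists_abelian_index_p:
  "\<exists>A t. subgroup A G \<and> cen \<subseteq> A \<and> card A = p ^ 4 \<and> (\<forall>a\<in>A. \<forall>b\<in>A. a \<otimes> b = b \<otimes> a) \<and> t \<in> carrier G \<and> t \<notin> A"
proof -
  obtain a where a: "a \<in> carrier G" "a \<notin> cen" "p ^ 4 \<le> card {g \<in> carrier G. com g a = \<one>}"
    using exists_large_centralizer by blast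
  define C where "C a = {g \<in> carrier G. com g a = \<one>}" for a
  have C: "subgroup (C a) G" if "a \<in> carrier G" for a unfolding C_def by (rule subgroup_centralizer[OF that])
  have cenC: "cen \<subseteq> C a" if "a \<in> carrier G" for a using that com_cen cenD by (auto simp: C_def)
  have "C a \<noteq> carrier G"
  proof
    assume *: "C a = carrier G"
    have "a \<otimes> x = x \<otimes> a" if "x \<in> carrier G" for x
      using that * a com_eq_one_iff[OF that a(1)] by (auto simp: C_def)
    then show False using a cenI by blast
  qed
  then obtain t where t: "t \<in> carrier G" "t \<notin> C a" using subgroup.subset[OF C[OF a(1)]] by blast
  have "p * card (C a) \<le> card (carrier G)"
    using t subgroup.subset[OF C[OF a(1)]] by (intro card_psubset_subgroup C a subgroup_self) blast
  then have cardC: "card (C a) = p ^ 4" using a(3) card_G p_gt1 by (simp add: C_def eval_nat_numeral)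
  let ?Z = "C a \<inter> (\<Inter>b\<in>C a. C b)"
  have CaG: "b \<in> carrier G" if "b \<in> C a" for b using that by (simp add: C_def)
  have one: "\<one> \<in> C a" using subgroup.one_closed C a by blast
  have "subgroup (\<Inter>b\<in>C a. C b) G" using C CaG one by (intro subgroups_Inter) auto
  then have Z: "subgroup ?Z G" using C[OF a(1)] subgroups_Inter_pair by blast
  have aZ: "a \<in> ?Z" using com_trivial_sym a by (auto simp: C_def)
  have cZ: "cen \<subseteq> ?Z" using cenC CaG a by blast
  have Z3: "p ^ Suc 2 \<le> card ?Z"
    using card_cen by (intro card_subgroup_ge_Suc[OF subgroup_cen Z cZ aZ a(2)]) simp
  have "b \<in> ?Z" if b: "b \<in> C a" for b
  proof (rule ccontr)
    assume nb: "b \<notin> ?Z"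
    have bb: "b \<in> C a \<inter> C b" using b CaG[OF b] by (simp add: C_def)
    have S: "subgroup (C a \<inter> C b) G" using C CaG[OF b] a subgroups_Inter_pair by blast
    have "p ^ Suc (Suc 2) \<le> card (C a \<inter> C b)"
      by (rule card_subgroup_ge_Suc[OF Z S _ bb nb Z3]) (use b in blast)
    then have "C a \<inter> C b = C a" using cardC by (intro subgroup_eqI C a) auto
    then have sub: "C a \<subseteq> C b" by blast
    have "b \<in> C c" if c: "c \<in> C a" for c
    proof -
      have "com c b = \<one>" using sub c unfolding C_def by blast
      then show ?thesis using com_trivial_sym[of c b] CaG[OF b] CaG[OF c] by (simp add: C_def)
    qed
    then show False using nb b by blast
  qed
  then have "b \<in> C c" if "b \<in> C a" "c \<in> C a" for b c using that by blast
  then have "com b c = \<one>" if "b \<in> C a" "c \<in> C a" for b c using that unfolding C_def by blast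
  then have "b \<otimes> c = c \<otimes> b" if "b \<in> C a" "c \<in> C a" for b c using that com_eq_one_iff CaG by blast
  then show ?thesis using C a cenC cardC t by blast
qed

text \<open>Collecting powers in class two leaves the factor \<open>[h, g]\<close> with exponent
  \<open>p choose 2\<close>, a multiple of \<open>p\<close> for odd \<open>p\<close>.\<close>

lemma power_mult_central_exponent:
  assumes exp: "\<And>z. z \<in> cen \<Longrightarrow> z [^] p = \<one>" and g: "g \<in> carrier G" "h \<in> carrier G"
  shows "(g \<otimes> h) [^] p = g [^] p \<otimes> h [^] p"
proof -
  have pw: "(g \<otimes> h) [^] n = g [^] n \<otimes> h [^] n \<otimes> com h g [^] (n choose 2)" for n :: nat
  proof (induction n)
    case (Suc n)
    define d where "d = com h g"
    have d: "d \<in> cen" "d \<in> carrier G" using g by (auto simp: d_def)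
    have dc: "d [^] k \<otimes> x = x \<otimes> d [^] k" if "x \<in> carrier G" for k :: nat and x
      using cenD(2)[OF nat_pow_cen[OF d(1)] that] .
    have hg: "h [^] n \<otimes> g = g \<otimes> h [^] n \<otimes> d [^] n"
    proof -
      have "h [^] n \<otimes> g = com (h [^] n) g \<otimes> (g \<otimes> h [^] n)" using g by (intro com_swap) auto
      also have "com (h [^] n) g = d [^] n" unfolding d_def using g by (simp add: com_bilinear)
      also have "d [^] n \<otimes> (g \<otimes> h [^] n) = g \<otimes> h [^] n \<otimes> d [^] n" using g by (intro dc) auto
      finally show ?thesis .
    qed
    have "(g \<otimes> h) [^] Suc n = g [^] n \<otimes> h [^] n \<otimes> (d [^] (n choose 2) \<otimes> (g \<otimes> h))"
      using Suc g d by (simp add: m_assoc d_def)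
    also have "d [^] (n choose 2) \<otimes> (g \<otimes> h) = g \<otimes> h \<otimes> d [^] (n choose 2)" using g by (intro dc) auto
    also have "g [^] n \<otimes> h [^] n \<otimes> (g \<otimes> h \<otimes> d [^] (n choose 2)) = g [^] n \<otimes> (h [^] n \<otimes> g) \<otimes> h \<otimes> d [^] (n choose 2)"
      using g d by (simp add: m_assoc)
    also have "\<dots> = g [^] n \<otimes> g \<otimes> h [^] n \<otimes> (d [^] n \<otimes> h) \<otimes> d [^] (n choose 2)"
      unfolding hg using g d by (simp add: m_assoc)
    also have "d [^] n \<otimes> h = h \<otimes> d [^] n" using g by (intro dc)
    also have "g [^] n \<otimes> g \<otimes> h [^] n \<otimes> (h \<otimes> d [^] n) \<otimes> d [^] (n choose 2) = g [^] Suc n \<otimes> h [^] Suc n \<otimes> d [^] (n + (n choose 2))"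
      using g d by (simp add: m_assoc flip: nat_pow_mult)
    also have "n + (n choose 2) = Suc n choose 2" by (simp add: numeral_2_eq_2)
    finally show ?case by (simp add: d_def)
  qed (simp add: binomial_eq_0)
  have "2 < p" using p odd_p prime_ge_2_nat[of p] by (cases "p = 2") auto
  then have "p dvd (p choose 2)" using p by (intro dvd_choose_prime) auto
  then obtain q where q: "(p choose 2) = p * q" by blast
  have "com h g [^] (p choose 2) = (com h g [^] p) [^] q" using g by (simp add: q nat_pow_pow)
  then show ?thesis using pw[of p] exp[of "com h g"] g by simp
qed

end

section \<open>Class two with an abelian subgroup of index p\<close>

locale order_p5_abelian = order_p5_class2 +
  fixes A t
  assumes subgroup_A: "subgroup A G" and cen_subset_A: "cen \<subseteq> A" and card_A: "card A = p ^ 4"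
    and abelian_A: "\<And>a b. a \<in> A \<Longrightarrow> b \<in> A \<Longrightarrow> a \<otimes> b = b \<otimes> a"
    and t [simp]: "t \<in> carrier G" and t_notin_A: "t \<notin> A"
begin

lemma A_carrier [simp]: "a \<in> A \<Longrightarrow> a \<in> carrier G"
  using subgroup.subset[OF subgroup_A] by blast

lemma generated_by_A_t:
  assumes H: "subgroup H G" "insert t A \<subseteq> H" shows "carrier G \<subseteq> H"
proof -
  have "p ^ Suc 4 \<le> card H"
    using H t_notin_A card_A by (intro card_subgroup_ge_Suc[OF subgroup_A H(1), where g = t]) auto
  then show ?thesis using carrier_eqI[OF H(1)] by simp
qed

lemma com_t_trivial:
  assumes a: "a \<in> A" "com a t = \<one>" shows "a \<in> cen"
proof -
  have aG: "a \<in> carrier G" using a by simp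
  have "b \<in> {g \<in> carrier G. com g a = \<one>}" if "b \<in> A" for b
    using com_eq_one_iff[of b a] abelian_A[OF that a(1)] that aG by simp
  moreover have "t \<in> {g \<in> carrier G. com g a = \<one>}" using com_trivial_sym[OF aG t a(2)] by simp
  ultimately have "carrier G \<subseteq> {g \<in> carrier G. com g a = \<one>}"
    by (intro generated_by_A_t subgroup_centralizer aG) blast
  then have "com g a = \<one>" if "g \<in> carrier G" for g using that by blast
  then show ?thesis using cen_iff com_trivial_sym aG by blast
qed

text \<open>The homomorphism taking \<open>a\<close> to \<open>com a t\<close> has kernel
  \<open>cen\<close> in \<open>A\<close>, hence an image of order \<open>p^2\<close>. Thus every
  central element is a commutator, and \<open>beta_cen_com\<close> applies to the whole
  centre.\<close>

lemma cen_eq_image: "cen = (\<lambda>a. com a t) ` A"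
proof -
  have "card ((\<lambda>a. com a t) ` A) * card {a \<in> A. com a t = \<one>} = card A"
    by (intro card_image_mult_card_kernel subgroup_A group_axioms) (auto simp: com_bilinear cenD)
  moreover have "{a \<in> A. com a t = \<one>} = cen"
    using com_t_trivial cen_subset_A com_cen(1) by auto
  ultimately have "card ((\<lambda>a. com a t) ` A) * p ^ 2 = p ^ (2 + 2)" using card_A card_cen by simp
  then have "card ((\<lambda>a. com a t) ` A) = p ^ 2" unfolding power_add using p_gt1 by (subst (asm) mult_cancel2) simp
  then show ?thesis
    using card_cen finite_subgroup[OF subgroup_cen] by (intro card_subset_eq[symmetric]) auto
qed

text \<open>The p-th power of \<open>[a, t]\<close> is \<open>[a, t^p]\<close>, and
  \<open>t^p\<close> lies in the abelian subgroup \<open>A\<close>.\<close>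

lemma cen_exponent: assumes z: "z \<in> cen" shows "z [^] p = \<one>"
proof -
  obtain a where a: "a \<in> A" "z = com a t" using z cen_eq_image by blast
  have tp: "t [^] p \<in> A"
    using card_G card_A
    by (intro pow_p_mem[OF subgroup_self normal_of_cen_subset[OF subgroup_A cen_subset_A]])
      (auto simp: eval_nat_numeral)
  have "z [^] p = com a (t [^] p)" using a by (simp add: com_bilinear)
  also have "\<dots> = \<one>" using abelian_A[OF a(1) tp] a com_eq_one_iff by simp
  finally show ?thesis .
qed

lemma pow_p_cen: assumes g: "g \<in> carrier G" shows "g [^] p \<in> cen"
  unfolding cen_iff
proof (intro conjI ballI)
  fix h assume h: "h \<in> carrier G"
  show "com (g [^] p) h = \<one>"
    using com_pow_left_cen[OF g h com_in_cen[OF g h], of p] cen_exponent[OF com_in_cen[OF g h]] by simp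
qed (use g in simp)

lemma pow_p_mult: "g \<in> carrier G \<Longrightarrow> h \<in> carrier G \<Longrightarrow> (g \<otimes> h) [^] p = g [^] p \<otimes> h [^] p"
  by (rule power_mult_central_exponent[OF cen_exponent])

lemma cen_bker:
  assumes f: "f \<in> schur_cocycles G" and z: "z \<in> cen" "w \<in> cen"
  shows "w \<in> schur_ext.bker G f z"
proof -
  interpret F: schur_ext G f by unfold_locales (rule f)
  obtain a where "a \<in> A" "w = com a t" using z cen_eq_image by blast
  then show ?thesis using F.beta_cen_com[OF z(1)] by simp
qed

lemma basis_exists:
  "\<exists>a b. a \<in> A \<and> b \<in> A \<and> a \<notin> cen \<and> (\<forall>H. subgroup H G \<longrightarrow> insert b (insert a cen) \<subseteq> H \<longrightarrow> A \<subseteq> H)"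
proof -
  have "cen \<noteq> A" using card_A card_cen pow_lt[of 2 4] by auto
  then obtain a where a: "a \<in> A" "a \<notin> cen" using cen_subset_A by blast
  have "p ^ 3 \<le> card H" if "subgroup H G" "insert a cen \<subseteq> H" for H
    using that a card_cen card_subgroup_ge_Suc[OF subgroup_cen, of H a 2] by simp
  then have "\<exists>b\<in>A. \<forall>H. subgroup H G \<longrightarrow> insert b (insert a cen) \<subseteq> H \<longrightarrow> A \<subseteq> H"
    using card_A a cen_subset_A by (intro generator_exists[OF subgroup_A, of 3]) auto
  then show ?thesis using a by blast
qed

text \<open>The centre is generated by \<open>v\<close> and a p-th power \<open>w\<close>. Once
  \<open>v\<close> pairs trivially with the generators \<open>x\<close>, \<open>y\<close>,
  \<open>z\<close>, the relation \<open>beta (g^p) g = 1\<close>, for \<open>g\<close> equal to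
  \<open>x\<close>, \<open>z\<close>, \<open>x y\<close> and \<open>x z\<close>, does the same for
  \<open>w\<close>. The fourth value then settles \<open>beta\<close> on \<open>A\<close>.\<close>

lemma order_le_of_exponent:
  assumes x: "x \<in> carrier G" "x [^] p \<noteq> \<one>"
  shows "order (schur_multiplier G) \<le> p ^ 4"
proof -
  define w where "w = x [^] p"
  have w: "w \<in> cen" "w \<noteq> \<one>" "w [^] p = \<one>"
    using x pow_p_cen cen_exponent by (auto simp: w_def)
  have wG: "w \<in> carrier G" using w cenD by blast
  define B where "B = {w [^] k | k. k \<in> (UNIV :: nat set)}"
  have B: "subgroup B G" "B \<subseteq> cen" "card B = p" "w \<in> B"
    unfolding B_def using generate_order_p[OF w] by auto
  have "B \<noteq> cen" using B(3) card_cen p_gt1 by (auto simp: power2_eq_square)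
  then obtain v where v: "v \<in> cen" "v \<notin> B" using B by blast
  have vG: "v \<in> carrier G" using v cenD by blast
  have rep: "\<exists>k j. z = v [^] (k::nat) \<otimes> w [^] (j::nat)" if "z \<in> cen" for z
    using index_p_representation[OF subgroup_cen normal_of_subset_cen[OF B(1,2)] B(2) _ v that] card_cen B(3)
    unfolding B_def by (auto simp: power2_eq_square)
  let ?P = "{g \<in> carrier G. g [^] p = \<one>}"
  have P: "subgroup ?P G"
  proof
    fix g assume "g \<in> ?P"
    then show "inv g \<in> ?P" by (simp add: nat_pow_inv)
  qed (auto simp: pow_p_mult)
  have cP: "cen \<subseteq> ?P" using cen_exponent cenD by blast
  \<comment> \<open>The p-th power map is a homomorphism into the centre, so its kernel has order at
    least \<open>p^3\<close>; this yields the noncentral \<open>y\<close> of order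
    \<open>p\<close>.\<close>
  have "cen \<noteq> ?P"
  proof
    assume eq: "cen = ?P"
    have "card ((\<lambda>g. g [^] p) ` carrier G) * card ?P = card (carrier G)"
      by (intro card_image_mult_card_kernel subgroup_self group_axioms) (auto simp: pow_p_mult)
    then have "card ((\<lambda>g. g [^] p) ` carrier G) * p ^ 2 = p ^ (3 + 2)" using card_cen card_G eq by simp
    then have "card ((\<lambda>g. g [^] p) ` carrier G) = p ^ 3" unfolding power_add using p_gt1 by (subst (asm) mult_cancel2) simp
    moreover have "card ((\<lambda>g. g [^] p) ` carrier G) \<le> card cen"
      using pow_p_cen by (intro card_mono finite_subgroup subgroup_cen) auto
    ultimately show False using card_cen pow_lt[of 2 3] by simp
  qed
  then obtain y where y: "y \<in> carrier G" "y [^] p = \<one>" "y \<notin> cen" using cP by blast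
  have xP: "x \<notin> ?P" using x by simp
  have big: "p ^ 4 \<le> card H" if H: "subgroup H G" "insert x (insert y cen) \<subseteq> H" for H
  proof -
    have S: "subgroup (H \<inter> ?P) G" using H P subgroups_Inter_pair by blast
    have "p ^ Suc 2 \<le> card (H \<inter> ?P)"
      using H y cP card_cen by (intro card_subgroup_ge_Suc[OF subgroup_cen S, where g = y]) auto
    then have "p ^ Suc (Suc 2) \<le> card H"
      using H xP by (intro card_subgroup_ge_Suc[OF S H(1), where g = x]) auto
    then show ?thesis by simp
  qed
  have "\<exists>z\<in>carrier G. \<forall>H. subgroup H G \<longrightarrow> insert z (insert x (insert y cen)) \<subseteq> H \<longrightarrow> carrier G \<subseteq> H"
    using card_G x y cenD(1) big by (intro generator_exists[OF subgroup_self, of 4]) auto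
  then obtain z where z: "z \<in> carrier G"
    and gen: "\<And>H. subgroup H G \<Longrightarrow> insert z (insert x (insert y cen)) \<subseteq> H \<Longrightarrow> carrier G \<subseteq> H" by blast
  obtain a b where ab: "a \<in> A" "b \<in> A" "a \<notin> cen"
    and genA: "\<And>H. subgroup H G \<Longrightarrow> insert b (insert a cen) \<subseteq> H \<Longrightarrow> A \<subseteq> H" using basis_exists by blast
  let ?ps = "[(v, x), (v, y), (v, z), (a, b)]"
  have zcom: "s \<otimes> g = g \<otimes> s" if "s \<in> cen" "g \<in> carrier G" for s g using that cenD by blast
  have bz: "beta f s g = 1"
    if f: "f \<in> schur_cocycles G" and 1: "beta f v x = 1" "beta f v y = 1" "beta f v z = 1"
      and s: "s \<in> cen" and g: "g \<in> carrier G" for f s g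
  proof -
    interpret F: schur_ext G f by unfold_locales (rule f)
    have vb: "carrier G \<subseteq> F.bker v"
      by (rule gen[OF F.subgroup_bker[OF vG]])
        (use cen_bker[OF f v(1)] 1 x y z zcom[OF v(1)] in \<open>auto simp: F.bker_def\<close>)
    have sp: "beta f (g [^] p) g = 1" if "g \<in> carrier G" for g
      using F.beta_pow_left[OF that that, of p] by simp
    have wx: "beta f w x = 1" using sp[OF x(1)] by (simp add: w_def)
    have wy: "beta f w y = 1"
    proof -
      have "beta f w (x \<otimes> y) = 1" using sp[of "x \<otimes> y"] x y wG by (simp add: pow_p_mult w_def[symmetric])
      moreover have "beta f w (x \<otimes> y) = beta f w x * beta f w y"
        using x y wG zcom[OF w(1)] by (intro F.beta_mult_right) auto
      ultimately show ?thesis using wx by simp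
    qed
    have wz: "beta f w z = 1"
    proof -
      obtain k j where kj: "z [^] p = v [^] (k::nat) \<otimes> w [^] (j::nat)" using rep pow_p_cen z by blast
      have wp: "w [^] j \<in> cen" "v [^] k \<in> cen" using w v nat_pow_cen by auto
      have "beta f (z [^] p) x = beta f (v [^] k) x * beta f (w [^] j) x"
        unfolding kj using x wG vG wp zcom by (intro F.beta_mult_left) auto
      also have "\<dots> = 1" using F.beta_pow_left[OF vG x(1) zcom[OF v(1) x(1)]] F.beta_pow_left[OF wG x(1) zcom[OF w(1) x(1)]] 1 wx by simp
      finally have zx: "beta f (z [^] p) x = 1" .
      \<comment> \<open>Polarisation: expanding \<open>beta ((x z)^p) (x z)\<close> leaves the
        product of two mixed terms, one of which is trivial by \<open>zx\<close>.\<close>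
      have "beta f (w \<otimes> z [^] p) (x \<otimes> z) = 1" using sp[of "x \<otimes> z"] x z by (simp add: pow_p_mult w_def[symmetric])
      moreover have "beta f (w \<otimes> z [^] p) (x \<otimes> z) = beta f w (x \<otimes> z) * beta f (z [^] p) (x \<otimes> z)"
        using x z wG zcom[OF w(1)] zcom[OF pow_p_cen[OF z]] by (intro F.beta_mult_left) auto
      moreover have "beta f w (x \<otimes> z) = beta f w x * beta f w z"
        using x z wG zcom[OF w(1)] by (intro F.beta_mult_right) auto
      moreover have "beta f (z [^] p) (x \<otimes> z) = beta f (z [^] p) x * beta f (z [^] p) z"
        using x z zcom[OF pow_p_cen[OF z]] by (intro F.beta_mult_right) auto
      ultimately show ?thesis using wx zx sp[OF z] by simp
    qed
    have wb: "carrier G \<subseteq> F.bker w"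
      by (rule gen[OF F.subgroup_bker[OF wG]])
        (use cen_bker[OF f w(1)] wx wy wz x y z zcom[OF w(1)] in \<open>auto simp: F.bker_def\<close>)
    have "w \<in> F.bker g" "v \<in> F.bker g" using wb vb F.bker_sym g wG vG by blast+
    then have "cen \<subseteq> F.bker g" using cen_eqI[OF F.subgroup_bker[OF g] _ _ w(2) B(1,4) v(2) B(2) v(1)] by blast
    then show ?thesis using s F.beta_swap[of s g] by (auto simp: F.bker_def)
  qed
  have "order (schur_multiplier G) \<le> p ^ length ?ps"
  proof (rule order_schur_multiplier_le)
    show "0 < p" using p_gt1 by simp
  next
    fix f i assume f: "f \<in> schur_cocycles G" and i: "i < length ?ps"
      and prev: "\<And>j. j < i \<Longrightarrow> beta f (fst (?ps ! j)) (snd (?ps ! j)) = 1"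
    interpret F: schur_ext G f by unfold_locales (rule f)
    have v: "beta f v g ^ p = 1" if "g \<in> carrier G" for g
      using F.beta_pow_left[OF vG that zcom[OF v(1) that], of p] cen_exponent[OF v(1)] that by simp
    \<comment> \<open>\<open>a^p\<close> is central, so this value rests on the three earlier ones,
      through \<open>bz\<close>.\<close>
    have "beta f a b ^ p = 1" if "i = 3"
    proof -
      have "beta f a b ^ p = beta f (a [^] p) b"
        by (rule F.beta_pow_left[symmetric]) (use ab abelian_A[OF ab(1,2)] in simp_all)
      also have "\<dots> = 1"
        by (rule bz[OF f]) (use prev[of 0] prev[of 1] prev[of 2] that pow_p_cen[of a] ab in simp_all)
      finally show ?thesis .
    qed
    then show "beta f (fst (?ps ! i)) (snd (?ps ! i)) ^ p = 1"
      using i v x y z by (auto simp: less_Suc_eq eval_nat_numeral)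
  next
    fix f assume f: "f \<in> schur_cocycles G"
      and *: "\<And>j. j < length ?ps \<Longrightarrow> beta f (fst (?ps ! j)) (snd (?ps ! j)) = 1"
    interpret F: schur_ext G f by unfold_locales (rule f)
    have 1: "beta f v x = 1" "beta f v y = 1" "beta f v z = 1" "beta f a b = 1"
      using *[of 0] *[of 1] *[of 2] *[of 3] by simp_all
    have cenb: "cen \<subseteq> F.bker g" if "g \<in> carrier G" for g
    proof
      fix s assume s: "s \<in> cen"
      then show "s \<in> F.bker g"
        using bz[OF f 1(1-3) s that] F.beta_swap[of g s] zcom[OF s that] that cenD(1)[OF s] by (simp add: F.bker_def)
    qed
    have "A \<subseteq> F.bker a"
      using ab 1(4) abelian_A[OF ab(1,2)] cenb[of a] by (intro genA F.subgroup_bker) (simp_all add: F.bker_def)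
    moreover have "A \<subseteq> F.bker b"
      using ab 1(4) abelian_A[OF ab(1,2)] cenb[of b] F.beta_swap[of b a] by (intro genA F.subgroup_bker) (simp_all add: F.bker_def)
    ultimately have sub: "A \<subseteq> F.bker c" if "c \<in> A" for c
      using that ab cenb F.bker_sym[of c] by (intro genA F.subgroup_bker) auto
    show "f \<in> schur_coboundaries G"
    proof (rule F.coboundary_abelian_index[OF finite_G subgroup_A cen_subset_A abelian_A t])
      fix c d assume "c \<in> A" "d \<in> A"
      then show "beta f c d = 1" using sub[of c] by (auto simp: F.bker_def)
    next
      fix s g assume "s \<in> cen" "g \<in> carrier G"
      then show "beta f s g = 1" by (rule bz[OF f 1(1-3)])
    qed (use com_t_trivial generated_by_A_t in auto)
  qed
  then show ?thesis by (simp add: eval_nat_numeral)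
qed

end

section \<open>Explicit cocycles\<close>

definition unity_root :: "nat \<Rightarrow> int \<Rightarrow> complex" where
  "unity_root p a = cis (2 * pi * of_int a / of_nat p)"

lemma unity_root_add: "unity_root p (a + b) = unity_root p a * unity_root p b"
  by (simp add: unity_root_def cis_mult add_divide_distrib distrib_left)

lemma unity_root_nz [simp]: "unity_root p a \<noteq> 0"
  by (simp add: unity_root_def)

lemma unity_root_0 [simp]: "unity_root p 0 = 1"
  by (simp add: unity_root_def)

lemma unity_root_diff: "unity_root p (a - b) = unity_root p a / unity_root p b"
  using unity_root_add[of p "a - b" b] by simp

lemma unity_root_eq_iff:
  assumes p: "p > 0"
  shows "unity_root p a = unity_root p b \<longleftrightarrow> [a = b] (mod int p)"
proof -
  have mult: "unity_root p (int p * q) = 1" for q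
    using p cis_multiple_2pi[of "of_int q"] by (simp add: unity_root_def mult.assoc)
  have red: "unity_root p c = unity_root p (c mod int p)" for c
    using unity_root_add[of p "int p * (c div int p)" "c mod int p"] by (simp add: mult)
  have inj: "inj_on (\<lambda>k. cis (2 * pi * real k / real p)) {..<p}"
    using bij_betw_roots_unity[OF p] by (simp add: bij_betw_def)
  have nat: "unity_root p c = cis (2 * pi * real (nat (c mod int p)) / real p)" for c
    using p unfolding red[of c] by (simp add: unity_root_def)
  have "unity_root p a = unity_root p b \<longleftrightarrow> nat (a mod int p) = nat (b mod int p)"
    unfolding nat using p by (intro inj_on_eq_iff[OF inj]) (auto simp: nat_less_iff)
  also have "\<dots> \<longleftrightarrow> a mod int p = b mod int p" using p by (simp add: nat_eq_iff)
  finally show ?thesis by (simp add: cong_def)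
qed

type_synonym coords = "nat \<times> nat \<times> nat \<times> nat \<times> nat"

text \<open>The coordinates of \<open>c\<^sup>m d\<^sup>n a\<^sup>i b\<^sup>j t\<^sup>k\<close>, where \<open>c = [t, a]\<close> and \<open>d = [t, b]\<close> are central.\<close>
fun coord_mult :: "coords \<Rightarrow> coords \<Rightarrow> coords" where
  "coord_mult (m, n, i, j, k) (m', n', i', j', k') = (m + m' + k * i', n + n' + k * j', i + i', j + j', k + k')"

fun coord_mod :: "nat \<Rightarrow> coords \<Rightarrow> coords" where
  "coord_mod p (m, n, i, j, k) = (m mod p, n mod p, i mod p, j mod p, k mod p)"

text \<open>The first three summands belong to the symmetric bilinear forms on \<open>\<langle>a, b\<rangle>\<close>, the next two
  to the linear forms on the centre, the last one is inflated from the quotient by the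
  centre. The factors \<open>2\<close> avoid dividing by two modulo \<open>p\<close>.\<close>
fun cocycle_exp :: "nat \<times> nat \<times> nat \<times> nat \<times> nat \<times> nat \<Rightarrow> coords \<Rightarrow> coords \<Rightarrow> int" where
  "cocycle_exp (r1, r2, r3, r4, r5, r6) (m, n, i, j, k) (m', n', i', j', k') =
     int r1 * (2 * int m * int i' + int k * int i' * int i') +
     int r2 * (2 * int n * int j' + int k * int j' * int j') +
     int r3 * (int m * int j' + int n * int i' + int k * int i' * int j') +
     int r4 * (2 * int k * int m' + int k * (int k - 1) * int i') +
     int r5 * (2 * int k * int n' + int k * (int k - 1) * int j') +
     int r6 * (int i * int j')"

text \<open>A polynomial identity over the integers, on unreduced coordinates. Only the congruences
  that follow bring in \<open>p\<close>: they allow reduction in either argument.\<close>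

lemma cocycle_exp_identity:
  "cocycle_exp r u v + cocycle_exp r (coord_mult u v) w = cocycle_exp r u (coord_mult v w) + cocycle_exp r v w"
  by (cases r; cases u; cases v; cases w) (simp add: algebra_simps)

lemma cong_int_mod: "[int (m mod p) = int m] (mod int p)"
  by (simp add: cong_def zmod_int)

lemma cocycle_exp_mod_left: "[cocycle_exp r (coord_mod p u) v = cocycle_exp r u v] (mod int p)"
  by (cases r; cases u; cases v)
    (simp, intro cong_add cong_mult cong_diff cong_int_mod cong_refl)

lemma cocycle_exp_mod_right: "[cocycle_exp r u (coord_mod p v) = cocycle_exp r u v] (mod int p)"
  by (cases r; cases u; cases v)
    (simp, intro cong_add cong_mult cong_diff cong_int_mod cong_refl)

lemma (in group) pow_mod:
  assumes "x \<in> carrier G" "x [^] (p::nat) = \<one>" shows "x [^] (m mod p) = x [^] m"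
proof -
  have "x [^] m = x [^] (p * (m div p)) \<otimes> x [^] (m mod p)" using assms by (simp add: nat_pow_mult)
  also have "x [^] (p * (m div p)) = \<one>" using assms by (simp flip: nat_pow_pow)
  finally show ?thesis using assms by simp
qed

lemma (in group) commuting_pow_mult:
  assumes x: "x \<in> carrier G" "y \<in> carrier G" and xy: "x \<otimes> y = y \<otimes> x"
  shows "x [^] (m::nat) \<otimes> y [^] (n::nat) \<otimes> (x [^] (m'::nat) \<otimes> y [^] (n'::nat)) = x [^] (m + m') \<otimes> y [^] (n + n')"
proof -
  have c: "y [^] n \<otimes> x [^] m' = x [^] m' \<otimes> y [^] n"
    using group_commutes_pow[of y "x [^] m'" n] group_commutes_pow[of x y m'] xy x by (metis nat_pow_closed)
  have "x [^] m \<otimes> y [^] n \<otimes> (x [^] m' \<otimes> y [^] n') = x [^] m \<otimes> (y [^] n \<otimes> x [^] m') \<otimes> y [^] n'"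
    using x by (simp add: m_assoc)
  also have "\<dots> = x [^] m \<otimes> x [^] m' \<otimes> (y [^] n \<otimes> y [^] n')" unfolding c using x by (simp add: m_assoc)
  finally show ?thesis using x by (simp add: nat_pow_mult)
qed

text \<open>In other words, on commuting pairs \<open>beta\<close> depends only on the class of a
  cocycle; this is what tells the explicit cocycles apart.\<close>

lemma (in group) coboundary_symmetric:
  assumes "f \<in> schur_coboundaries G" "x \<in> carrier G" "y \<in> carrier G" "x \<otimes> y = y \<otimes> x"
  shows "f x y = f y x"
  using assms by (auto simp: schur_coboundaries_def mult.commute)

section \<open>Lower bound for exponent p\<close>

context order_p5_abelian
begin

text \<open>In exponent \<open>p\<close> the coordinates modulo \<open>p\<close> parametrize
  \<open>G\<close>, so the integer polynomials \<open>cocycle_exp r\<close> define cocycles. The six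
  parameters are recovered modulo \<open>p\<close> from \<open>beta\<close> on commuting pairs of
  generators.\<close>

lemma order_ge_of_exponent:
  assumes exp: "\<And>g. g \<in> carrier G \<Longrightarrow> g [^] p = \<one>"
  shows "order (schur_multiplier G) = 0 \<or> p ^ 6 \<le> order (schur_multiplier G)"
proof -
  obtain a b where ab: "a \<in> A" "b \<in> A" "a \<notin> cen"
    and genA: "\<And>H. subgroup H G \<Longrightarrow> insert b (insert a cen) \<subseteq> H \<Longrightarrow> A \<subseteq> H" using basis_exists by blast
  define c where "c = com t a"
  define d where "d = com t b"
  have aG [simp]: "a \<in> carrier G" "b \<in> carrier G" using ab by auto
  have cd: "c \<in> cen" "d \<in> cen" by (auto simp: c_def d_def)
  have cdG [simp]: "c \<in> carrier G" "d \<in> carrier G" by (auto simp: c_def d_def)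
  have abc: "a \<otimes> b = b \<otimes> a" using abelian_A ab by blast
  define P :: "coords \<Rightarrow> 'a" where
    "P = (\<lambda>(m, n, i, j, k). (c [^] m \<otimes> d [^] n) \<otimes> (a [^] i \<otimes> b [^] j) \<otimes> t [^] k)"
  have P_carrier [simp]: "P v \<in> carrier G" for v by (cases v) (simp add: P_def)
  have P_mult: "P v \<otimes> P w = P (coord_mult v w)" for v w
  proof -
    obtain m n i j k where v: "v = (m, n, i, j, k)" by (metis surj_pair)
    obtain m' n' i' j' k' where w: "w = (m', n', i', j', k')" by (metis surj_pair)
    define z where "z = c [^] m \<otimes> d [^] n"
    define z' where "z' = c [^] m' \<otimes> d [^] n'"
    define e where "e = a [^] i \<otimes> b [^] j"
    define e' where "e' = a [^] i' \<otimes> b [^] j'"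
    define q where "q = c [^] (k * i') \<otimes> d [^] (k * j')"
    have zz: "z \<in> cen" "z' \<in> cen" "q \<in> cen" using cd by (auto simp: z_def z'_def q_def nat_pow_cen cen_mult_closed)
    then have G: "z \<in> carrier G" "z' \<in> carrier G" "q \<in> carrier G" "e \<in> carrier G" "e' \<in> carrier G"
      using cenD by (auto simp: e_def e'_def)
    have cen: "z' \<otimes> x = x \<otimes> z'" "q \<otimes> x = x \<otimes> q" if "x \<in> carrier G" for x using zz that cenD by auto
    \<comment> \<open>This crossing is the origin of the terms \<open>k * i'\<close> and
      \<open>k * j'\<close> in \<open>coord_mult\<close>.\<close>
    have te: "t [^] k \<otimes> e' = q \<otimes> (e' \<otimes> t [^] k)"
    proof -
      have cdc: "c \<otimes> d = d \<otimes> c" using cenD(2) cd by simp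
      have "com (t [^] k) e' = com t e' [^] k" using G by (simp add: com_bilinear)
      also have "com t e' = c [^] i' \<otimes> d [^] j'" by (simp add: e'_def com_bilinear c_def d_def)
      also have "(c [^] i' \<otimes> d [^] j') [^] k = q"
        unfolding q_def
      proof (induction k)
        case (Suc k)
        then show ?case using commuting_pow_mult[OF cdG cdc, of "k * i'" "k * j'" i' j'] by (simp add: add.commute)
      qed simp
      finally have "com (t [^] k) e' = q" .
      then show ?thesis using com_swap[of "t [^] k" e'] G by simp
    qed
    have PP: "P v = z \<otimes> e \<otimes> t [^] k" "P w = z' \<otimes> e' \<otimes> t [^] k'"
      by (simp_all add: P_def v w z_def e_def z'_def e'_def)
    have tz: "t [^] k \<otimes> z' = z' \<otimes> t [^] k" and ez: "e \<otimes> z' = z' \<otimes> e" and eq: "e \<otimes> q = q \<otimes> e"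
      using cen G by simp_all
    have "P v \<otimes> P w = z \<otimes> e \<otimes> (t [^] k \<otimes> z') \<otimes> e' \<otimes> t [^] k'"
      using G by (simp add: PP m_assoc)
    also have "\<dots> = z \<otimes> (e \<otimes> z') \<otimes> (t [^] k \<otimes> e') \<otimes> t [^] k'"
      unfolding tz using G by (simp add: m_assoc)
    also have "\<dots> = z \<otimes> z' \<otimes> (e \<otimes> q) \<otimes> e' \<otimes> (t [^] k \<otimes> t [^] k')"
      unfolding ez te using G by (simp add: m_assoc)
    also have "\<dots> = (z \<otimes> z' \<otimes> q) \<otimes> (e \<otimes> e') \<otimes> (t [^] k \<otimes> t [^] k')"
      unfolding eq using G by (simp add: m_assoc)
    also have "\<dots> = P (coord_mult v w)"
    proof -
      have cdc: "c \<otimes> d = d \<otimes> c" using cenD(2) cd by simp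
      have "z \<otimes> z' \<otimes> q = c [^] (m + m' + k * i') \<otimes> d [^] (n + n' + k * j')"
        unfolding z_def z'_def q_def by (simp only: commuting_pow_mult[OF cdG cdc])
      moreover have "e \<otimes> e' = a [^] (i + i') \<otimes> b [^] (j + j')"
        unfolding e_def e'_def by (simp only: commuting_pow_mult[OF aG abc])
      ultimately show ?thesis by (simp add: P_def v w nat_pow_mult)
    qed
    finally show ?thesis .
  qed
  have P_mod: "P (coord_mod p v) = P v" for v
    by (cases v) (simp add: P_def pow_mod exp)
  let ?T = "{..<p} \<times> {..<p} \<times> {..<p} \<times> {..<p} \<times> {..<p}"
  have mod_T: "coord_mod p v \<in> ?T" for v using p_gt1 by (cases v) auto
  define I where "I = range P"
  have PI: "P v \<in> I" for v by (simp add: I_def)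
  have I_ex: "\<exists>v. x = P v" if "x \<in> I" for x using that unfolding I_def by (rule rangeE) (rule exI)
  have range_sub: "subgroup (I) G"
  proof
    show "I \<subseteq> carrier G" by (auto simp: I_def)
    have "P (0, 0, 0, 0, 0) = \<one>" by (simp add: P_def)
    then show one: "\<one> \<in> I" by (metis PI)
    fix x y assume "x \<in> I" "y \<in> I"
    then show "x \<otimes> y \<in> I" using P_mult PI by (metis I_ex)
  next
    fix x assume x: "x \<in> I"
    then have xG: "x \<in> carrier G" by (auto simp: I_def)
    have pw: "x [^] (Suc n) \<in> I" for n
    proof (induction n)
      case (Suc n)
      then show ?case using x P_mult PI I_ex by (metis nat_pow_Suc)
    qed (use x xG in simp)
    have "x [^] (p - 1) \<otimes> x = \<one>" using exp[OF xG] p_gt1 by (metis Suc_diff_1 less_trans nat_pow_Suc zero_less_one)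
    then have "inv x = x [^] (p - 1)" using xG by (intro inv_equality) auto
    moreover have "p - 1 = Suc (p - 2)" using p_gt1 by simp
    ultimately show "inv x \<in> I" using pw by metis
  qed
  have Pv: "P (1, 0, 0, 0, 0) = c" "P (0, 1, 0, 0, 0) = d" "P (0, 0, 1, 0, 0) = a" "P (0, 0, 0, 1, 0) = b" "P (0, 0, 0, 0, 1) = t"
    by (simp_all add: P_def)
  then have in_range: "c \<in> I" "d \<in> I" "a \<in> I" "b \<in> I" "t \<in> I"
    by (metis PI)+
  have cen_range: "cen \<subseteq> I"
  proof -
    have S: "subgroup (I \<inter> cen) G" using range_sub subgroup_cen subgroups_Inter_pair by blast
    have "A \<subseteq> {g \<in> carrier G. com g t \<in> I \<inter> cen}"
    proof (rule genA)
      show "subgroup {g \<in> carrier G. com g t \<in> I \<inter> cen} G"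
        using S by (intro subgroup_com_mod normal_of_subset_cen t) auto
      have "com a t \<in> I \<inter> cen" "com b t \<in> I \<inter> cen"
        using in_range(1,2) cd by (intro com_sym_mem[OF S t] aG IntI; simp only: c_def d_def)+
      then show "insert b (insert a cen) \<subseteq> {g \<in> carrier G. com g t \<in> I \<inter> cen}"
        using com_cen(1)[OF _ t] cenD(1) subgroup.one_closed[OF S] by auto
    qed
    then show ?thesis using cen_eq_image by auto
  qed
  have "A \<subseteq> I" by (rule genA[OF range_sub]) (use cen_range in_range in auto)
  then have "carrier G \<subseteq> I" using in_range by (intro generated_by_A_t range_sub) auto
  then have cI: "\<exists>v. g = P v" if "g \<in> carrier G" for g using that I_ex by (metis subsetD)
  have PT: "P ` ?T = carrier G"
  proof
    show "carrier G \<subseteq> P ` ?T"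
    proof
      fix g assume "g \<in> carrier G"
      then obtain v where "g = P v" using cI by blast
      then have "g = P (coord_mod p v)" by (simp only: P_mod)
      then show "g \<in> P ` ?T" using mod_T by (rule image_eqI)
    qed
  qed (metis P_carrier image_subsetI)
  have cardT: "card ?T = p ^ 5" by (simp add: card_cartesian_product eval_nat_numeral)
  \<comment> \<open>\<open>P\<close> maps a set of \<open>p^5\<close> tuples onto a group of the
    same size.\<close>
  have inj: "inj_on P ?T"
    by (rule eq_card_imp_inj_on) (simp, simp only: PT cardT card_G)
  define co where "co = inv_into ?T P"
  have co: "co g \<in> ?T" "P (co g) = g" if "g \<in> carrier G" for g
    using that unfolding co_def PT[symmetric] by (auto intro: inv_into_into f_inv_into_f simp del: mem_Times_iff)
  have co_P: "co (P v) = v" if "v \<in> ?T" for v unfolding co_def using inv_into_f_f[OF inj that] .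
  have co_mult: "co (g \<otimes> h) = coord_mod p (coord_mult (co g) (co h))" if "g \<in> carrier G" "h \<in> carrier G" for g h
  proof -
    have "P (coord_mod p (coord_mult (co g) (co h))) = g \<otimes> h" using co that by (simp add: P_mod flip: P_mult)
    then show ?thesis using co_P[OF mod_T] by metis
  qed
  define F where "F r x y = (if x \<in> carrier G \<and> y \<in> carrier G then unity_root p (cocycle_exp r (co x) (co y)) else 1)" for r x y
  have p0: "p > 0" using p_gt1 by simp
  have F: "F r \<in> schur_cocycles G" for r
  proof -
    have "F r x y * F r (x \<otimes> y) z = F r x (y \<otimes> z) * F r y z"
      if "x \<in> carrier G" "y \<in> carrier G" "z \<in> carrier G" for x y z
    proof -
      have "[cocycle_exp r (co x) (co y) + cocycle_exp r (co (x \<otimes> y)) (co z)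
          = cocycle_exp r (co x) (co y) + cocycle_exp r (coord_mult (co x) (co y)) (co z)] (mod int p)"
        unfolding co_mult[OF that(1,2)] by (intro cong_add cong_refl cocycle_exp_mod_left)
      also have "cocycle_exp r (co x) (co y) + cocycle_exp r (coord_mult (co x) (co y)) (co z)
          = cocycle_exp r (co x) (coord_mult (co y) (co z)) + cocycle_exp r (co y) (co z)"
        by (rule cocycle_exp_identity)
      also have "[\<dots> = cocycle_exp r (co x) (co (y \<otimes> z)) + cocycle_exp r (co y) (co z)] (mod int p)"
        unfolding co_mult[OF that(2,3)] by (intro cong_add cong_refl cong_sym[OF cocycle_exp_mod_right])
      finally have "unity_root p (cocycle_exp r (co x) (co y) + cocycle_exp r (co (x \<otimes> y)) (co z))
          = unity_root p (cocycle_exp r (co x) (co (y \<otimes> z)) + cocycle_exp r (co y) (co z))"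
        using unity_root_eq_iff[OF p0] by blast
      then show ?thesis using that by (simp add: F_def unity_root_add)
    qed
    moreover have "F r x y \<noteq> 0" for x y by (simp add: F_def)
    moreover have "F r x y = 1" if "x \<notin> carrier G \<or> y \<notin> carrier G" for x y using that by (auto simp: F_def)
    ultimately show ?thesis unfolding schur_cocycles_def by blast
  qed
  let ?R = "{..<p} \<times> {..<p} \<times> {..<p} \<times> {..<p} \<times> {..<p} \<times> {..<p}"
  have co_gen: "co c = (1, 0, 0, 0, 0)" "co d = (0, 1, 0, 0, 0)" "co a = (0, 0, 1, 0, 0)" "co b = (0, 0, 0, 1, 0)" "co t = (0, 0, 0, 0, 1)"
    using Pv co_P p_gt1 by (metis SigmaI lessThan_iff p0)+
  have "r = s" if r: "r \<in> ?R" and s: "s \<in> ?R" and cob: "(\<lambda>x y. F r x y / F s x y) \<in> schur_coboundaries G" for r s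
  proof -
    obtain r1 r2 r3 r4 r5 r6 where rr: "r = (r1, r2, r3, r4, r5, r6)" by (metis surj_pair)
    obtain s1 s2 s3 s4 s5 s6 where ss: "s = (s1, s2, s3, s4, s5, s6)" by (metis surj_pair)
    have key: "[cocycle_exp r (co x) (co y) - cocycle_exp r (co y) (co x) = cocycle_exp s (co x) (co y) - cocycle_exp s (co y) (co x)] (mod int p)"
      if xy: "x \<in> carrier G" "y \<in> carrier G" "x \<otimes> y = y \<otimes> x" for x y
    proof -
      have "F r x y / F s x y = F r y x / F s y x" using coboundary_symmetric[OF cob xy] .
      moreover have "F r x y \<noteq> 0" "F s x y \<noteq> 0" "F r y x \<noteq> 0" "F s y x \<noteq> 0" by (simp_all add: F_def)
      ultimately have "F r x y / F r y x = F s x y / F s y x" by (simp add: field_simps)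
      then show ?thesis using xy unfolding unity_root_eq_iff[OF p0, symmetric] by (simp add: F_def unity_root_diff)
    qed
    have cm: "c \<otimes> x = x \<otimes> c" "d \<otimes> x = x \<otimes> d" if "x \<in> carrier G" for x using that cd cenD by auto
    have inj1: "x = y" if "[int x = int y] (mod int p)" "x < p" "y < p" for x y :: nat
      using that by (simp add: cong_int_iff cong_def)
    have inj2: "x = y" if *: "[2 * int x = 2 * int y] (mod int p)" "x < p" "y < p" for x y :: nat
    proof -
      have "coprime 2 (int p)" using odd_p by simp
      then show ?thesis using *(1) inj1[OF _ *(2,3)] by (simp add: cong_mult_lcancel)
    qed
    have bnd: "r1 < p" "r2 < p" "r3 < p" "r4 < p" "r5 < p" "r6 < p" "s1 < p" "s2 < p" "s3 < p" "s4 < p" "s5 < p" "s6 < p"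
      using r s by (simp_all add: rr ss)
    \<comment> \<open>The six pairs are \<open>(c, a)\<close>, \<open>(d, b)\<close>,
      \<open>(c, b)\<close>, \<open>(t, c)\<close>, \<open>(t, d)\<close> and \<open>(a, b)\<close>;
      antisymmetrizing the exponent on them gives 2 r1, 2 r2, r3, 2 r4, 2 r5 and r6. The factor 2
      cancels because \<open>p\<close> is odd.\<close>
    have "r1 = s1"
      by (rule inj2) (use key[OF _ _ cm(1), of a] bnd in \<open>simp_all add: co_gen rr ss mult.commute\<close>)
    moreover have "r2 = s2"
      by (rule inj2) (use key[OF _ _ cm(2), of b] bnd in \<open>simp_all add: co_gen rr ss mult.commute\<close>)
    moreover have "r3 = s3"
      by (rule inj1) (use key[OF _ _ cm(1), of b] bnd in \<open>simp_all add: co_gen rr ss\<close>)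
    moreover have "r4 = s4"
      by (rule inj2) (use key[OF _ _ cm(1)[symmetric], of t] bnd in \<open>simp_all add: co_gen rr ss mult.commute\<close>)
    moreover have "r5 = s5"
      by (rule inj2) (use key[OF _ _ cm(2)[symmetric], of t] bnd in \<open>simp_all add: co_gen rr ss mult.commute\<close>)
    moreover have "r6 = s6"
      by (rule inj1) (use key[OF _ _ abc] bnd in \<open>simp_all add: co_gen rr ss\<close>)
    ultimately have "r1 = s1" "r2 = s2" "r3 = s3" "r4 = s4" "r5 = s5" "r6 = s6" by simp_all
    then show ?thesis by (simp add: rr ss)
  qed
  then have "order (schur_multiplier G) = 0 \<or> card ?R \<le> order (schur_multiplier G)"
    by (rule order_schur_multiplier_ge[of ?R F, OF F])
  moreover have "card ?R = p ^ 6" by (simp add: card_cartesian_product eval_nat_numeral)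
  ultimately show ?thesis by simp
qed

end

theorem theorem3p6:
  fixes G :: "('a, 'b) monoid_scheme" and p :: nat
  assumes "group G"
    and "Factorial_Ring.prime p" and "odd p"
    and "order G = p ^ 5"
    and "card (group_center G) = p ^ 2"
  shows "order (schur_multiplier G) \<noteq> p ^ 5"
proof -
  interpret group G by fact
  interpret order_p5 G p by unfold_locales fact+
  have le4: ?thesis if "order (schur_multiplier G) \<le> p ^ 4"
    using that pow_lt[of 4 5] by simp
  show ?thesis
  proof (cases "com_center (group_center G) = carrier G")
    case False
    then interpret order_p5_class3 G p by unfold_locales
    show ?thesis using order_le le4 by blast
  next
    case True
    then interpret order_p5_class2 G p by unfold_locales
    obtain A t where "subgroup A G" "group_center G \<subseteq> A" "card A = p ^ 4"
      "\<forall>a\<in>A. \<forall>b\<in>A. a \<otimes>\<^bsub>G\<^esub> b = b \<otimes>\<^bsub>G\<^esub> a" "t \<in> carrier G" "t \<notin> A"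
      using exists_abelian_index_p by blast
    then interpret order_p5_abelian G p A t
      by (intro order_p5_abelian.intro order_p5_abelian_axioms.intro order_p5_class2_axioms) auto
    show ?thesis
    proof (cases "\<forall>g\<in>carrier G. g [^]\<^bsub>G\<^esub> p = \<one>\<^bsub>G\<^esub>")
      case True
      \<comment> \<open>Both alternatives, order 0 and order at least \<open>p^6\<close>, differ
        from \<open>p^5\<close>.\<close>
      then show ?thesis using order_ge_of_exponent pow_lt[of 5 6] p_gt1 by fastforce
    next
      case False
      then show ?thesis using order_le_of_exponent le4 by blast
    qed
  qed
qed

end
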